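(* Let $H$ be an infinite-dimensional real separable Hilbert space and $B$ the Banach space obtained as the completion of $H$ with respect to a measurable norm. Let $L$ be a closed affine subspace of $H$ of finite codimension. Let $f$ be a Borel function on a finite-dimensional nonzero subspace $V$ of $H$ such that the orthogonal projection $P^H_V:H\to V$ maps $L$ onto $V$. Suppose $Z_1,Z_2,\ldots$ are finite-dimensional subspaces of $H$ with $$V\subset Z_1\subset Z_2\subset\cdots\subset H$$ and $\bigcup_{N\ge1}Z_N$ dense in $H$. Then $$\lim_{N\to\infty}\int_{L\cap S_{Z_N}}f_{Z_N}\,d\overline{\sigma}=\int_B f_B\,d\mu_L,$$ where $S_{Z_N}$ is the sphere in $Z_N$ centered at $0$ of radius $\sqrt{\dim Z_N}$, $\overline\sigma$ is the surface-area measure on the sphere $L\cap S_{Z_N}$ normalized to have unit total mass, $f_{Z_N}=f\circ P^{Z_N}_V$ with $P^{Z_N}_V:Z_N\to V$ the orthogonal projection, and $f_B=f\circ P^B_V$.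
   Context: Measurable norm: a norm $|\cdot|$ on $H$ such that for every $\epsilon>0$ there is a finite-dimensional subspace $F_\epsilon\subset H$ such that for every finite-dimensional subspace $F'\subset H$ orthogonal to $F_\epsilon$ one has $\gamma_{F'}\{x\in F':|x|>\epsilon\}<\epsilon$, where $\gamma_{F'}$ is the standard Gaussian measure on $F'$. The natural injection $j:H\to B$ is continuous for the Hilbert-space topology on $H$; for $\phi\in B^*$, $j^*\phi\in H$ denotes the element with $\phi(j(x))=\langle j^*\phi,x\rangle$ for all $x\in H$; $j^*:B^*\to H$ is an injection with dense image. For a closed affine subspace $L$ of $H$, $p_L$ denotes the point on $L$ closest to $0$ and $P_0:H\to H$ the orthogonal projection onto $L-p_L$. $\mu_L$ is the Borel probability measure on $B$ (known to exist) such that for every $\phi\in B^*$, $$\int_B\exp(it\phi)\,d\mu_L=\exp\left(it\langle p_L,j^*\phi\rangle-\tfrac{t^2}{2}\|P_0(j^*\phi)\|^2\right)\quad\text{for all }t\in\mathbb{R}.$$ The linear map $j^*(B^* )\to L^2(B,\mu_L)$, $j^*\phi\mapsto\phi$, extends to a continuous linear map $I_L:H\to L^2(B,\mu_L)$, which satisfies $\int_B\exp(iI_L(h))\,d\mu_L=\exp\left(i\langle p_L,h\rangle-\tfrac12\|P_0h\|^2\right)$ for all $h\in H$. $P^B_V$ is the $\mu_L$-almost-everywhere defined $V$-valued map on $B$ given by $P^B_V=\sum_{r=1}^n I_L(h_r)h_r$, where $h_1,\ldots,h_n$ is an orthonormal basis of $V$. For all large enough $N$, $L\cap Z_N$ is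 a nonempty affine subspace whose distance from $0$ is less than $\sqrt{\dim Z_N}$, so $L\cap S_{Z_N}$ is a sphere of positive radius in $L\cap Z_N$; the limit is over such $N$. *)

theory Defs
  imports "HOL-Probability.Probability"
begin

definition fin_dim_subspace :: "'a::real_vector set \<Rightarrow> bool" where
  "fin_dim_subspace S \<longleftrightarrow> (\<exists>C. finite C \<and> span C = S)"

definition orthonormal_basis :: "'a::real_inner set \<Rightarrow> 'a set \<Rightarrow> bool" where
  "orthonormal_basis S E \<longleftrightarrow>
     finite E \<and> pairwise orthogonal E \<and> (\<forall>e\<in>E. norm e = 1) \<and> span E = S"

definition orth_proj :: "'a::real_inner set \<Rightarrow> 'a \<Rightarrow> 'a" where
  "orth_proj S x = (THE y. y \<in> S \<and> (\<forall>s\<in>S. inner (x - y) s = 0))"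

text \<open>The point of \<open>A\<close> closest to the origin. The library's closest_point is
  restricted to Heine-Borel spaces and hence not available in infinite dimensions.\<close>

definition foot :: "'a::real_normed_vector set \<Rightarrow> 'a" where
  "foot A = arg_min_on norm A"

definition direction :: "'a::real_normed_vector set \<Rightarrow> 'a set" where
  "direction A = (\<lambda>x. x - foot A) ` A"

definition finite_codim :: "'a::real_normed_vector set \<Rightarrow> bool" where
  "finite_codim A \<longleftrightarrow> (\<exists>C. finite C \<and> span (direction A \<union> C) = UNIV)"

text \<open>Lebesgue measure of a finite-dimensional subspace \<open>S\<close>, as a Borel measure on the
  ambient space carried by \<open>S\<close>; the result does not depend on the orthonormal basis chosen.\<close>

definition lebesgue_subspace :: "'a::real_inner set \<Rightarrow> 'a measure" where
  "lebesgue_subspace S =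
     (let E = (SOME E. orthonormal_basis S E)
      in distr (Pi\<^sub>M E (\<lambda>_. lborel)) borel (\<lambda>x. \<Sum>e\<in>E. x e *\<^sub>R e))"

definition std_gaussian :: "'a::real_inner set \<Rightarrow> 'a measure" where
  "std_gaussian S = density (lebesgue_subspace S)
     (\<lambda>x. ennreal (exp (- (norm x)\<^sup>2 / 2) / sqrt (2 * pi) ^ dim S))"

definition measurable_norm :: "('a::real_inner \<Rightarrow> real) \<Rightarrow> bool" where
  "measurable_norm nrm \<longleftrightarrow>
     (\<forall>x. 0 \<le> nrm x) \<and> (\<forall>x. nrm x = 0 \<longleftrightarrow> x = 0) \<and>
     (\<forall>x y. nrm (x + y) \<le> nrm x + nrm y) \<and> (\<forall>c x. nrm (c *\<^sub>R x) = \<bar>c\<bar> * nrm x) \<and>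
     (\<forall>\<epsilon>>0. \<exists>F. fin_dim_subspace F \<and>
        (\<forall>F'. fin_dim_subspace F' \<and> (\<forall>x\<in>F'. \<forall>y\<in>F. inner x y = 0) \<longrightarrow>
           measure (std_gaussian F') {x \<in> F'. nrm x > \<epsilon>} < \<epsilon>))"

text \<open>A Banach space is the completion of \<open>'a\<close> under \<open>nrm\<close>, with natural injection \<open>j\<close>,
  iff \<open>j\<close> is a linear isometry for \<open>nrm\<close> with dense range.\<close>

definition is_completion :: "('a::real_vector \<Rightarrow> real) \<Rightarrow> ('a \<Rightarrow> 'b::banach) \<Rightarrow> bool" where
  "is_completion nrm j \<longleftrightarrow>
     linear j \<and> (\<forall>x. norm (j x) = nrm x) \<and> closure (range j) = UNIV"

definition jstar :: "('a::real_inner \<Rightarrow> 'b::banach) \<Rightarrow> ('b \<Rightarrow>\<^sub>L real) \<Rightarrow> 'a" where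
  "jstar j \<phi> = (THE h. \<forall>x. blinfun_apply \<phi> (j x) = inner h x)"

text \<open>The characteristic functional determines the measure \<open>\<mu>\<^sub>L\<close> uniquely.\<close>

definition is_mu_L ::
    "('a::real_inner \<Rightarrow> 'b::banach) \<Rightarrow> 'a set \<Rightarrow> 'b measure \<Rightarrow> bool" where
  "is_mu_L j L \<mu> \<longleftrightarrow> prob_space \<mu> \<and> sets \<mu> = sets borel \<and>
     (\<forall>\<phi> t. (LINT x|\<mu>. exp (\<i> * complex_of_real (t * blinfun_apply \<phi> x))) =
        exp (\<i> * complex_of_real (t * inner (foot L) (jstar j \<phi>))
             - complex_of_real (t\<^sup>2 / 2 * (norm (orth_proj (direction L) (jstar j \<phi>)))\<^sup>2)))"

text \<open>\<open>I h\<close> is a representative of the element \<open>I\<^sub>L(h)\<close> of \<open>L\<^sup>2(\<mu>)\<close>, so that linearity and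
  the extension property hold almost everywhere. As \<open>j\<^sup>*(B\<^sup>*)\<close> is dense, they determine
  each \<open>I h\<close> up to null sets.\<close>

definition is_I_L ::
    "('a::real_inner \<Rightarrow> 'b::banach) \<Rightarrow> 'b measure \<Rightarrow> ('a \<Rightarrow> 'b \<Rightarrow> real) \<Rightarrow> bool" where
  "is_I_L j \<mu> I \<longleftrightarrow>
     (\<forall>h. I h \<in> borel_measurable \<mu> \<and> integrable \<mu> (\<lambda>x. (I h x)\<^sup>2)) \<and>
     (\<forall>h k. AE x in \<mu>. I (h + k) x = I h x + I k x) \<and>
     (\<forall>c h. AE x in \<mu>. I (c *\<^sub>R h) x = c * I h x) \<and>
     (\<exists>K. \<forall>h. sqrt (LINT x|\<mu>. (I h x)\<^sup>2) \<le> K * norm h) \<and>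
     (\<forall>\<phi>. AE x in \<mu>. I (jstar j \<phi>) x = blinfun_apply \<phi> x)"

text \<open>The map \<open>P\<^sup>B\<^sub>V\<close> computed in the orthonormal basis \<open>E\<close> of \<open>V\<close>.\<close>

definition proj_B :: "('a::real_vector \<Rightarrow> 'b \<Rightarrow> real) \<Rightarrow> 'a set \<Rightarrow> 'b \<Rightarrow> 'a" where
  "proj_B I E x = (\<Sum>h\<in>E. I h x *\<^sub>R h)"

text \<open>Surface-area measure of the sphere of radius \<open>r\<close> about \<open>c\<close> in the affine subspace
  \<open>c + W\<close>, from the polar decomposition of Lebesgue measure: with \<open>n = dim W\<close>, the area of
  a Borel set \<open>A\<close> in the sphere is \<open>n / r\<close> times the Lebesgue measure of the cone
  \<open>{t (x - c) | x \<in> A, 0 < t \<le> 1}\<close>. That cone is the preimage of \<open>A\<close> under the radial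
  projection of the punctured ball onto the sphere.\<close>

definition sphere_area :: "'a::real_inner set \<Rightarrow> 'a \<Rightarrow> real \<Rightarrow> 'a measure" where
  "sphere_area W c r = scale_measure (ennreal (real (dim W) / r))
     (distr (restrict_space (lebesgue_subspace W) (cball 0 r - {0})) borel
        (\<lambda>y. c + (r / norm y) *\<^sub>R y))"

definition big_sphere :: "'a::real_inner set \<Rightarrow> 'a set" where
  "big_sphere Z = {z \<in> Z. norm z = sqrt (real (dim Z))}"

text \<open>By Pythagoras, \<open>L \<inter> big_sphere Z\<close> is the sphere in \<open>L \<inter> Z\<close> about the foot \<open>p\<close> of
  \<open>L \<inter> Z\<close> with squared radius \<open>dim Z - (norm p)\<^sup>2\<close>. The definition is meaningful when
  \<open>L \<inter> Z\<close> is nonempty and this number is positive.\<close>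

definition sigma_bar :: "'a::real_inner set \<Rightarrow> 'a set \<Rightarrow> 'a measure" where
  "sigma_bar L Z = uniform_measure
     (sphere_area (direction (L \<inter> Z)) (foot (L \<inter> Z))
        (sqrt (real (dim Z) - (norm (foot (L \<inter> Z)))\<^sup>2)))
     (L \<inter> big_sphere Z)"

end

theory Submission
  imports Defs
begin

text \<open>
  Both sides are integrals over \<open>V\<close> against explicit densities. For a closed affine subspace \<open>A\<close>
  that projects onto \<open>V\<close> let \<open>m\<^sub>A(v)\<close> be the squared distance from \<open>0\<close> to
  \<open>{y \<in> A. P\<^sub>V y = v}\<close>. Up to a constant factor, the law of \<open>P\<^sup>B\<^sub>V\<close> under \<open>\<mu>\<^sub>L\<close> has density
  \<open>exp (- m\<^sub>L / 2)\<close>, by uniqueness of characteristic functions, and the projection to \<open>V\<close> of the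
  uniform distribution on the sphere has density \<open>(1 - m\<^sub>N / d\<^sub>N)\<close>, cut off at \<open>0\<close>, to a power
  that differs from \<open>d\<^sub>N / 2\<close> by a bounded amount. Here \<open>m\<^sub>N\<close> belongs to the affine subspace
  \<open>L \<inter> Z\<^sub>N\<close> and \<open>d\<^sub>N = dim Z\<^sub>N\<close>.

  Since \<open>L \<inter> Z\<^sub>N\<close> lies in \<open>L\<close>, we have \<open>m\<^sub>N \<ge> m\<^sub>L\<close>, so the spherical densities are bounded by a
  constant multiple of the Gaussian one. By density of the union of the \<open>Z\<^sub>N\<close> they also converge
  pointwise. Hence dominated convergence applies to every integrable \<open>f\<close>. The constant factors converge because
  all the laws have mass one.
\<close>

section \<open>Projections in Hilbert space\<close>

text \<open>Over a point \<open>v\<close> of \<open>V\<close>, the slice of the sphere in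
  \<open>L \<inter> Z N\<close> is a sphere about the nearest point of the fibre, with squared
  radius \<open>d\<^sub>N - m\<^sub>N\<close>; this is where the squared distance comes from. On the
  Gaussian side it appears because the directions orthogonal to the fibres carry a standard Gaussian
  around the foot of \<open>L\<close>. The same kind of linear change of variables, from those
  directions to \<open>V\<close>, serves both sides.

  The exponent loses at most one dimension for each constraint defining \<open>L\<close>, at most
  \<open>dim V\<close> for the directions visible from \<open>V\<close>, and two in polar
  coordinates. That none of these losses grows with \<open>N\<close> gives both the uniform
  domination and the limit.

  Measure identities are carried up to an unspecified positive factor, so neither determinants nor
  sphere volumes are evaluated.

  Since \<open>V\<close> need not lie in the range of \<open>jstar j\<close>, the characteristic
  functional of \<open>\<mu>\<close> must first be extended to all of \<open>H\<close>. This uses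
  density of that range, which in turn rests on continuity of \<open>j\<close>, extracted from the
  measurability of the norm.\<close>

lemma min_norm_exists:
  fixes K :: "'a::{real_inner,complete_space} set"
  assumes "closed K" "convex K" "K \<noteq> {}"
  shows "\<exists>x\<in>K. \<forall>y\<in>K. norm x \<le> norm y"
proof -
  define d where "d = (INF x\<in>K. norm x)"
  have d_le: "d \<le> norm y" if "y \<in> K" for y
    unfolding d_def by (rule cINF_lower[OF _ that]) (auto intro!: bdd_belowI2[where m=0])
  have d0: "0 \<le> d"
    unfolding d_def using assms(3) by (intro cINF_greatest) auto
  have "\<exists>x\<in>K. norm x < d + 1 / Suc n" for n
  proof -
    have "Inf (norm ` K) < d + 1 / Suc n" unfolding d_def by simp
    then show ?thesis
      using assms(3) cInf_lessD[of "norm ` K"] by blast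
  qed
  then obtain s where s: "\<And>n. s n \<in> K" "\<And>n. norm (s n) < d + 1 / Suc n" by metis
  \<comment> \<open>Parallelogram law: the midpoint of \<open>x\<close> and \<open>y\<close> lies in
    \<open>K\<close> by convexity, so its norm is at least \<open>d\<close>. Applied to two late
    terms of a minimizing sequence, this makes the sequence Cauchy.\<close>
  have par: "(norm (x - y))\<^sup>2 \<le> 2 * (norm x)\<^sup>2 + 2 * (norm y)\<^sup>2 - 4 * d\<^sup>2" if "x \<in> K" "y \<in> K" for x y
  proof -
    have "(1/2) *\<^sub>R x + (1/2) *\<^sub>R y \<in> K"
      using assms(2) that by (intro convexD) auto
    then have "d \<le> norm ((1/2) *\<^sub>R x + (1/2) *\<^sub>R y)" by (rule d_le)
    then have "d\<^sup>2 \<le> (norm ((1/2) *\<^sub>R x + (1/2) *\<^sub>R y))\<^sup>2"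
      using d0 by (intro power_mono) auto
    also have "\<dots> = ((norm x)\<^sup>2 + (norm y)\<^sup>2 + 2 * inner x y) / 4"
      by (simp add: power2_norm_eq_inner inner_add_left inner_add_right inner_commute field_simps)
    finally show ?thesis
      by (simp add: power2_norm_eq_inner inner_diff_left inner_diff_right inner_commute field_simps)
  qed
  have small: "(norm (s m - s n))\<^sup>2 \<le> (8 * d + 4) / Suc k" if "k \<le> m" "k \<le> n" for k m n
  proof -
    have *: "(norm (s i))\<^sup>2 \<le> d\<^sup>2 + (2 * d + 1) / Suc k" if "k \<le> i" for i
    proof -
      have "norm (s i) \<le> d + 1 / Suc k"
        using s(2)[of i] that by (smt (verit) frac_le of_nat_0_less_iff of_nat_le_iff zero_less_Suc Suc_le_mono)
      then have "(norm (s i))\<^sup>2 \<le> (d + 1 / Suc k)\<^sup>2" by (intro power_mono) auto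
      also have "\<dots> = d\<^sup>2 + 2 * d * (1 / Suc k) + (1 / Suc k) * (1 / Suc k)"
        unfolding power2_sum by (simp only: power2_eq_square)
      also have "\<dots> \<le> d\<^sup>2 + 2 * d * (1 / Suc k) + (1 / Suc k) * 1"
        by (intro add_left_mono mult_left_mono) auto
      also have "\<dots> = d\<^sup>2 + (2 * d + 1) / Suc k" by (simp add: add_divide_distrib)
      finally show ?thesis .
    qed
    have "(norm (s m - s n))\<^sup>2 \<le> 4 * ((2 * d + 1) / Suc k)"
      using par[OF s(1) s(1), of m n] *[OF that(1)] *[OF that(2)] by linarith
    also have "\<dots> = (8 * d + 4) / Suc k" by (simp add: field_simps)
    finally show ?thesis .
  qed
  have "Cauchy s"
  proof (rule metric_CauchyI)
    fix e :: real assume "e > 0"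
    obtain k where k: "(8 * d + 4) / e\<^sup>2 < real (Suc k)"
      using reals_Archimedean2 by (meson less_trans lessI of_nat_less_iff)
    have "dist (s m) (s n) < e" if "k \<le> m" "k \<le> n" for m n
    proof -
      have "(norm (s m - s n))\<^sup>2 \<le> (8 * d + 4) / Suc k" using small that by blast
      also have "\<dots> < e\<^sup>2" using k \<open>e > 0\<close> by (simp add: field_simps)
      finally show ?thesis
        using \<open>e > 0\<close> by (simp add: dist_norm power2_less_imp_less)
    qed
    then show "\<exists>M. \<forall>m\<ge>M. \<forall>n\<ge>M. dist (s m) (s n) < e" by blast
  qed
  then obtain x where x: "s \<longlonglongrightarrow> x" using Cauchy_convergent convergent_def by blast
  have "x \<in> K" using closed_sequentially[OF assms(1) _ x] s(1) by blast
  moreover have "norm x \<le> d"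
  proof (rule LIMSEQ_le)
    show "(\<lambda>n. norm (s n)) \<longlonglongrightarrow> norm x" using x by (rule tendsto_norm)
    show "(\<lambda>n. d + 1 / real (Suc n)) \<longlonglongrightarrow> d"
      using tendsto_add[OF tendsto_const[of d] LIMSEQ_inverse_real_of_nat] by (simp add: inverse_eq_divide)
    show "\<exists>N. \<forall>n\<ge>N. norm (s n) \<le> d + 1 / real (Suc n)" using s(2) less_imp_le by blast
  qed
  ultimately show ?thesis using d_le by force
qed

lemma
  fixes A :: "'a::{real_inner,complete_space} set"
  assumes "closed A" "convex A" "A \<noteq> {}"
  shows foot_in: "foot A \<in> A"
    and norm_foot_le: "y \<in> A \<Longrightarrow> norm (foot A) \<le> norm y"
proof -
  obtain x where "x \<in> A" "\<forall>y\<in>A. norm x \<le> norm y" using min_norm_exists[OF assms] by blast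
  then have "is_arg_min norm (\<lambda>x. x \<in> A) x" by (auto simp: is_arg_min_linorder)
  then have "is_arg_min norm (\<lambda>x. x \<in> A) (foot A)"
    unfolding foot_def arg_min_on_def arg_min_def by (rule someI)
  then show "foot A \<in> A" "y \<in> A \<Longrightarrow> norm (foot A) \<le> norm y"
    by (auto simp: is_arg_min_linorder)
qed

lemma inner_eq_0_if_min:
  fixes p w :: "'a::real_inner"
  assumes "\<And>t. norm p \<le> norm (p + t *\<^sub>R w)"
  shows "inner p w = 0"
proof (cases "w = 0")
  case False
  then have w: "inner w w > 0" by simp
  \<comment> \<open>The vertex of the quadratic
    \<open>t \<mapsto> (norm (p + t *\<^sub>R w))\<^sup>2\<close>, where its value is
    lowest.\<close>
  define t where "t = - inner p w / inner w w"
  have "(norm p)\<^sup>2 \<le> (norm (p + t *\<^sub>R w))\<^sup>2" using assms by (intro power_mono) auto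
  also have "\<dots> = inner p p + 2 * t * inner p w + t * t * inner w w"
    by (simp add: power2_norm_eq_inner inner_add_left inner_add_right inner_commute)
  also have "\<dots> = inner p p - (inner p w)\<^sup>2 / inner w w"
    using w by (simp add: t_def field_simps power2_eq_square)
  finally have "(inner p w)\<^sup>2 / inner w w \<le> 0" by (simp add: power2_norm_eq_inner)
  then have "(inner p w)\<^sup>2 \<le> 0" using w by (simp add: divide_le_0_iff)
  then show ?thesis by simp
qed simp

lemma subspace_direction:
  assumes "affine A" "foot A \<in> A"
  shows "subspace (direction A)"
proof -
  have "direction A = (+) (- foot A) ` A" by (auto simp: direction_def)
  then show ?thesis using affine_diffs_subspace[OF assms] by simp
qed

lemma closed_direction: "closed A \<Longrightarrow> closed (direction A)"
  unfolding direction_def by (rule closed_translation_subtract)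

text \<open>The whole line through the foot in direction \<open>w\<close> stays in the affine set,
  so the norm along it is minimal at the foot and its first variation vanishes.\<close>

lemma foot_orthogonal:
  fixes A :: "'a::{real_inner,complete_space} set"
  assumes "affine A" "closed A" "A \<noteq> {}" "w \<in> direction A"
  shows "inner (foot A) w = 0"
proof (rule inner_eq_0_if_min)
  fix t
  have cx: "convex A" using assms(1) by (rule affine_imp_convex)
  obtain y where y: "y \<in> A" "w = y - foot A" using assms(4) by (auto simp: direction_def)
  have "(1 - t) *\<^sub>R foot A + t *\<^sub>R y \<in> A"
    using assms(1) foot_in[OF assms(2) cx assms(3)] y(1) by (intro mem_affine) auto
  moreover have "(1 - t) *\<^sub>R foot A + t *\<^sub>R y = foot A + t *\<^sub>R w"
    by (simp add: y(2) algebra_simps)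
  ultimately show "norm (foot A) \<le> norm (foot A + t *\<^sub>R w)"
    using norm_foot_le[OF assms(2) cx assms(3)] by metis
qed

lemma orth_proj_unique:
  assumes "subspace S" "y \<in> S" "\<And>s. s \<in> S \<Longrightarrow> inner (x - y) s = 0"
  shows "orth_proj S x = y"
  unfolding orth_proj_def
proof (rule the_equality)
  show "y \<in> S \<and> (\<forall>s\<in>S. inner (x - y) s = 0)" using assms by simp
  fix z assume z: "z \<in> S \<and> (\<forall>s\<in>S. inner (x - z) s = 0)"
  have "z - y \<in> S" using assms z by (simp add: subspace_diff)
  then have "inner (x - y) (z - y) = 0" "inner (x - z) (z - y) = 0" using assms(3) z by auto
  then have "inner (z - y) (z - y) = 0" by (simp add: inner_diff_left)
  then show "z = y" by simp
qed


text \<open>Existence of the projection is made the hypothesis, so that closed subspaces of a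
  Hilbert space and spans of finite orthonormal sets, which need no completeness, share one theory
  of \<open>orth_proj\<close>.\<close>

definition proj_subspace :: "'a::real_inner set \<Rightarrow> bool" where
  "proj_subspace S \<longleftrightarrow> subspace S \<and> (\<forall>x. \<exists>y\<in>S. \<forall>s\<in>S. inner (x - y) s = 0)"

text \<open>The foot of the translate \<open>x + S\<close> is the residual of \<open>x\<close>: it
  is orthogonal to \<open>S\<close> and differs from \<open>x\<close> by an element of
  \<open>S\<close>.\<close>

lemma closed_proj_subspace:
  fixes S :: "'a::{real_inner,complete_space} set"
  assumes "subspace S" "closed S"
  shows "proj_subspace S"
  unfolding proj_subspace_def
proof (intro conjI allI)
  fix x
  let ?A = "(\<lambda>s. x + s) ` S"
  have A: "affine ?A" "closed ?A" "?A \<noteq> {}"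
    using assms subspace_0[OF assms(1)]
    by (auto simp: affine_translation[symmetric] subspace_imp_affine closed_translation)
  have ft: "foot ?A \<in> ?A" by (rule foot_in[OF A(2) affine_imp_convex[OF A(1)] A(3)])
  then obtain s0 where s0: "s0 \<in> S" "foot ?A = x + s0" by blast
  have "inner (x - (- s0)) s = 0" if "s \<in> S" for s
  proof -
    have "x + (s0 + s) \<in> ?A" using that s0(1) assms(1) by (intro imageI subspace_add)
    then have "s \<in> direction ?A"
      unfolding direction_def s0(2) by (rule image_eqI[rotated]) simp
    then have "inner (foot ?A) s = 0" by (rule foot_orthogonal[OF A])
    then show ?thesis by (simp add: s0(2))
  qed
  moreover have "- s0 \<in> S" using s0 assms by (simp add: subspace_neg)
  ultimately show "\<exists>y\<in>S. \<forall>s\<in>S. inner (x - y) s = 0" by blast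
qed (fact assms)

context
  fixes S :: "'a::real_inner set"
  assumes S: "proj_subspace S"
begin

lemma orth_proj_mem: "orth_proj S x \<in> S"
  and orth_proj_orth: "s \<in> S \<Longrightarrow> inner (x - orth_proj S x) s = 0"
proof -
  obtain y where y: "y \<in> S" "\<forall>s\<in>S. inner (x - y) s = 0" using S by (auto simp: proj_subspace_def)
  then have "orth_proj S x = y" using S by (intro orth_proj_unique) (auto simp: proj_subspace_def)
  then show "orth_proj S x \<in> S" "s \<in> S \<Longrightarrow> inner (x - orth_proj S x) s = 0" using y by auto
qed

lemma orth_proj_inner: "s \<in> S \<Longrightarrow> inner (orth_proj S x) s = inner x s"
  using orth_proj_orth[of s x] by (simp add: inner_diff_left)


lemma orth_proj_id: "s \<in> S \<Longrightarrow> orth_proj S s = s"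
  using S by (intro orth_proj_unique) (auto simp: proj_subspace_def)

lemma linear_orth_proj: "linear (orth_proj S)"
proof (rule linearI)
  have sub: "subspace S" using S by (simp add: proj_subspace_def)
  show "orth_proj S (x + y) = orth_proj S x + orth_proj S y" for x y
    using sub by (intro orth_proj_unique subspace_add orth_proj_mem)
      (auto simp: inner_diff_left inner_add_left orth_proj_inner)
  show "orth_proj S (c *\<^sub>R x) = c *\<^sub>R orth_proj S x" for c x
    using sub by (intro orth_proj_unique subspace_scale orth_proj_mem)
      (auto simp: inner_diff_left inner_add_left orth_proj_inner)
qed

lemma norm_orth_proj_pythagoras: "(norm x)\<^sup>2 = (norm (orth_proj S x))\<^sup>2 + (norm (x - orth_proj S x))\<^sup>2"
  using orth_proj_inner[OF orth_proj_mem, of x x]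
  by (simp add: power2_norm_eq_inner inner_diff_left inner_diff_right inner_commute)

lemma norm_orth_proj_le: "norm (orth_proj S x) \<le> norm x"
proof (rule power2_le_imp_le)
  show "(norm (orth_proj S x))\<^sup>2 \<le> (norm x)\<^sup>2" using norm_orth_proj_pythagoras[of x] by simp
qed simp

lemma bounded_linear_orth_proj: "bounded_linear (orth_proj S)"
  using linear_orth_proj norm_orth_proj_le
  by (intro bounded_linear_intro[where K=1]) (auto simp: linear_add linear_scale)

lemma continuous_orth_proj: "continuous_on X (orth_proj S)"
  using bounded_linear_orth_proj by (rule linear_continuous_on)

end

text \<open>The foot \<open>p\<close> of the hyperplane where \<open>\<psi>\<close> equals 1 is
  normal to the kernel of \<open>\<psi>\<close>; dividing by \<open>inner p p\<close> fixes the
  scale.\<close>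

lemma riesz_representation:
  fixes \<psi> :: "'a::{real_inner,complete_space} \<Rightarrow> real"
  assumes "bounded_linear \<psi>"
  shows "\<exists>h. \<forall>x. \<psi> x = inner h x"
proof (cases "\<forall>x. \<psi> x = 0")
  case True
  then show ?thesis by (intro exI[of _ 0]) simp
next
  case False
  then obtain x0 where x0: "\<psi> x0 \<noteq> 0" by blast
  interpret bounded_linear \<psi> by fact
  let ?A = "{x. \<psi> x = 1}"
  have A: "affine ?A" "closed ?A" "?A \<noteq> {}"
  proof -
    show "affine ?A" by (auto simp: affine_def add scaleR)
    show "closed ?A"
      by (intro closed_Collect_eq linear_continuous_on assms continuous_intros)
    show "?A \<noteq> {}" using x0 by (auto intro!: exI[of _ "(1 / \<psi> x0) *\<^sub>R x0"] simp: scaleR)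
  qed
  define p where "p = foot ?A"
  have p1: "\<psi> p = 1" using foot_in[OF A(2) affine_imp_convex[OF A(1)] A(3)] by (simp add: p_def)
  then have p0: "inner p p > 0" using zero by auto
  have "\<psi> x = inner (p /\<^sub>R inner p p) x" for x
  proof -
    have "x - \<psi> x *\<^sub>R p \<in> direction ?A"
      unfolding direction_def p_def[symmetric]
      by (intro image_eqI[of _ _ "x - \<psi> x *\<^sub>R p + p"]) (auto simp: add diff scaleR p1)
    then have "inner p (x - \<psi> x *\<^sub>R p) = 0" unfolding p_def by (rule foot_orthogonal[OF A])
    then show ?thesis using p0 by (simp add: inner_diff_right field_simps)
  qed
  then show ?thesis by blast
qed

section \<open>Orthonormal bases\<close>

definition orthonormal :: "'a::real_inner set \<Rightarrow> bool" where
  "orthonormal E \<longleftrightarrow> finite E \<and> (\<forall>e\<in>E. \<forall>e'\<in>E. inner e e' = (if e = e' then 1 else 0))"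

lemma orthonormal_basis_iff: "orthonormal_basis S E \<longleftrightarrow> orthonormal E \<and> span E = S"
  by (auto simp: orthonormal_basis_def orthonormal_def pairwise_def orthogonal_def norm_eq_1)

lemma orthonormal_subset: "orthonormal E \<Longrightarrow> B \<subseteq> E \<Longrightarrow> orthonormal B"
  unfolding orthonormal_def by (meson finite_subset subset_iff)

lemma inner_sum_orthonormal:
  assumes "orthonormal E" "e \<in> E"
  shows "inner (\<Sum>e'\<in>E. x e' *\<^sub>R e') e = x e"
proof -
  have "inner (\<Sum>e'\<in>E. x e' *\<^sub>R e') e = (\<Sum>e'\<in>E. if e' = e then x e' else 0)"
    using assms by (auto simp: inner_sum_left orthonormal_def intro!: sum.cong simp del: sum.delta sum.delta')
  also have "\<dots> = x e" using assms by (subst sum.delta) (auto simp: orthonormal_def)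
  finally show ?thesis .
qed

lemma norm_sum_orthonormal:
  assumes "orthonormal E"
  shows "(norm (\<Sum>e\<in>E. x e *\<^sub>R e))\<^sup>2 = (\<Sum>e\<in>E. (x e)\<^sup>2)"
proof -
  have "(norm (\<Sum>e\<in>E. x e *\<^sub>R e))\<^sup>2 = (\<Sum>e\<in>E. x e * inner (\<Sum>e\<in>E. x e *\<^sub>R e) e)"
    unfolding power2_norm_eq_inner by (subst inner_sum_right) simp
  also have "\<dots> = (\<Sum>e\<in>E. (x e)\<^sup>2)"
    using assms by (intro sum.cong) (auto simp: inner_sum_orthonormal power2_eq_square)
  finally show ?thesis .
qed

lemma orthonormal_expand_proj:
  assumes "orthonormal E" "s \<in> span E"
  shows "inner (x - (\<Sum>e\<in>E. inner x e *\<^sub>R e)) s = 0"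
proof -
  have "span E \<subseteq> {s. inner (x - (\<Sum>e\<in>E. inner x e *\<^sub>R e)) s = 0}"
    using assms(1)
    by (intro span_minimal)
      (auto simp: inner_diff_left inner_sum_orthonormal subspace_def inner_add_right)
  then show ?thesis using assms by blast
qed

lemma orthonormal_proj_subspace: "orthonormal E \<Longrightarrow> proj_subspace (span E)"
  unfolding proj_subspace_def
  by (intro conjI allI subspace_span bexI[of _ "\<Sum>e\<in>E. inner x e *\<^sub>R e" for x])
     (auto intro: orthonormal_expand_proj span_sum span_scale span_base)

lemma orth_proj_orthonormal:
  "orthonormal E \<Longrightarrow> orth_proj (span E) x = (\<Sum>e\<in>E. inner x e *\<^sub>R e)"
  by (intro orth_proj_unique subspace_span orthonormal_expand_proj)
     (auto intro: orthonormal_expand_proj span_sum span_scale span_base)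

lemma orthonormal_expand: "orthonormal E \<Longrightarrow> s \<in> span E \<Longrightarrow> (\<Sum>e\<in>E. inner s e *\<^sub>R e) = s"
  by (metis orth_proj_id orth_proj_orthonormal orthonormal_proj_subspace)

lemma orthonormal_independent: "orthonormal E \<Longrightarrow> independent E"
  by (intro pairwise_orthogonal_independent)
     (auto simp: orthonormal_def pairwise_def orthogonal_def, metis inner_zero_left zero_neq_one)

lemma orthonormal_dim: "orthonormal E \<Longrightarrow> dim (span E) = card E"
  by (simp add: dim_eq_card_independent orthonormal_independent)

lemma dim_singleton_0: "dim {0 :: 'a::real_inner} = 0"
  using orthonormal_dim[of "{} :: 'a set"] by (simp add: orthonormal_def)

text \<open>The span is the set of fixed points of its continuous projection.\<close>

lemma closed_span_orthonormal: "orthonormal E \<Longrightarrow> closed (span E)"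
proof -
  assume E: "orthonormal E"
  have "span E = {x. orth_proj (span E) x = x}"
  proof (intro set_eqI iffI CollectI)
    show "x \<in> span E" if "x \<in> {x. orth_proj (span E) x = x}" for x
      using that orth_proj_mem[OF orthonormal_proj_subspace[OF E], of x] by simp
  qed (rule orth_proj_id[OF orthonormal_proj_subspace[OF E]])
  moreover have "closed {x. orth_proj (span E) x = x}"
    by (intro closed_Collect_eq continuous_orth_proj orthonormal_proj_subspace E continuous_intros)
  ultimately show ?thesis by simp
qed

text \<open>Gram-Schmidt, one vector of \<open>C\<close> at a time; a vector whose residual
  \<open>w\<close> vanishes contributes nothing. Starting from a given \<open>A\<close> is what
  later allows a basis of a subspace to be completed to one of a larger space.\<close>

lemma orthonormal_extend_finite:
  assumes "orthonormal A" "finite C"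
  shows "\<exists>B. A \<subseteq> B \<and> orthonormal B \<and> span B = span (A \<union> C)"
  using assms(2)
proof (induction C)
  case empty
  then show ?case using assms by auto
next
  case (insert c C)
  then obtain B where B: "A \<subseteq> B" "orthonormal B" "span B = span (A \<union> C)" by blast
  have sp: "span (insert c B) = span (A \<union> insert c C)"
    using B(3) by (simp add: span_insert)
  define w where "w = c - (\<Sum>e\<in>B. inner c e *\<^sub>R e)"
  have sB: "(\<Sum>e\<in>B. inner c e *\<^sub>R e) \<in> span B" by (auto intro: span_sum span_scale span_base)
  show ?case
  proof (cases "w = 0")
    case True
    then have "c \<in> span B" using sB by (simp add: w_def)
    then have "span (insert c B) = span B" by (rule span_redundant)
    then show ?thesis using B sp by metis
  next
    case False
    have orth: "inner w e = 0" if "e \<in> span B" for e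
      unfolding w_def by (rule orthonormal_expand_proj[OF B(2) that])
    let ?u = "w /\<^sub>R norm w"
    have "inner ?u ?u = 1" using False by (simp add: power2_norm_eq_inner[symmetric] power2_eq_square field_simps)
    moreover have "inner ?u e = 0" "inner e ?u = 0" if "e \<in> B" for e
      using orth[OF span_base[OF that]] by (auto simp: inner_commute)
    ultimately have on: "orthonormal (insert ?u B)"
      using B(2) by (auto simp: orthonormal_def)
    have "span (insert ?u B) = span (insert c B)"
    proof (rule span_eq[THEN iffD2, OF conjI])
      show "insert ?u B \<subseteq> span (insert c B)"
        using sB span_mono[of B "insert c B"] unfolding w_def
        by (auto intro!: span_scale span_diff intro: span_base)
      have "w \<in> span (insert ?u B)"
        using False span_scale[OF span_base[of ?u "insert ?u B"], of "norm w"] by simp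
      moreover have "(\<Sum>e\<in>B. inner c e *\<^sub>R e) \<in> span (insert ?u B)"
        using sB span_mono[of B "insert ?u B"] by blast
      ultimately have "w + (\<Sum>e\<in>B. inner c e *\<^sub>R e) \<in> span (insert ?u B)" by (rule span_add)
      then show "insert c B \<subseteq> span (insert ?u B)"
        by (auto simp: w_def intro: span_base)
    qed
    then show ?thesis using on B(1) sp by (intro exI[of _ "insert ?u B"]) auto
  qed
qed

lemma orthonormal_extend:
  assumes "orthonormal A" "span A \<subseteq> S" "fin_dim_subspace S"
  obtains B where "orthonormal (A \<union> B)" "A \<inter> B = {}" "span (A \<union> B) = S"
proof -
  obtain C where C: "finite C" "span C = S" using assms(3) by (auto simp: fin_dim_subspace_def)
  obtain B where B: "A \<subseteq> B" "orthonormal B" "span B = span (A \<union> C)"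
    using orthonormal_extend_finite[OF assms(1) C(1)] by blast
  have "span (A \<union> C) = S"
  proof (rule antisym)
    have "A \<subseteq> S" using assms(2) span_superset by blast
    then have "A \<union> C \<subseteq> S" using C(2) span_superset by auto
    moreover have "subspace S" using C(2) by auto
    ultimately show "span (A \<union> C) \<subseteq> S" by (intro span_minimal)
    show "S \<subseteq> span (A \<union> C)" unfolding C(2)[symmetric] by (intro span_mono) simp
  qed
  then show ?thesis using that[of "B - A"] B by (simp add: Un_absorb1)
qed

lemma fin_dim_basis:
  assumes "fin_dim_subspace S"
  obtains B where "orthonormal B" "span B = S"
proof -
  have "subspace S" using assms by (auto simp: fin_dim_subspace_def)
  then have "span {} \<subseteq> S" by (simp add: subspace_0)
  then show ?thesis
    using orthonormal_extend[of "{}" S] assms that by (auto simp: orthonormal_def)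
qed

lemma fin_dim_subset:
  assumes "subspace W" "W \<subseteq> S" "fin_dim_subspace S"
  shows "fin_dim_subspace W"
proof -
  obtain C where C: "finite C" "span C = S" using assms(3) by (auto simp: fin_dim_subspace_def)
  obtain B where B: "B \<subseteq> W" "independent B" "W \<subseteq> span B" using maximal_independent_subset by blast
  have "finite B" using independent_span_bound[OF C(1) B(2)] B(1) C assms(2) by auto
  moreover have "span B = W" using B assms(1) by (simp add: span_subspace)
  ultimately show ?thesis by (auto simp: fin_dim_subspace_def)
qed

section \<open>Fibres of an affine subspace over \<open>V\<close>\<close>

definition fiber :: "'a::real_inner set \<Rightarrow> 'a set \<Rightarrow> 'a \<Rightarrow> 'a set" where
  "fiber A V v = {y \<in> A. orth_proj V y = v}"

definition minsq :: "'a::real_inner set \<Rightarrow> 'a set \<Rightarrow> 'a \<Rightarrow> real" where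
  "minsq A V v = (norm (foot (fiber A V v)))\<^sup>2"

lemma fiber_properties:
  fixes A V :: "'a::{real_inner,complete_space} set"
  assumes A: "affine A" "closed A" and V: "proj_subspace V" and v: "v \<in> orth_proj V ` A"
  shows "affine (fiber A V v)" "closed (fiber A V v)" "fiber A V v \<noteq> {}"
proof -
  show "affine (fiber A V v)"
    using A(1) unfolding affine_def fiber_def
    by (auto simp: linear_add[OF linear_orth_proj[OF V]] linear_scale[OF linear_orth_proj[OF V]]
        scaleR_left_distrib[symmetric])
  have "fiber A V v = A \<inter> {y. orth_proj V y = v}" by (auto simp: fiber_def)
  moreover have "closed {y. orth_proj V y = v}"
    by (intro closed_Collect_eq continuous_orth_proj[OF V] continuous_intros)
  ultimately show "closed (fiber A V v)" using A(2) by (simp add: closed_Int)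
  show "fiber A V v \<noteq> {}" using v by (auto simp: fiber_def)
qed

text \<open>The map \<open>orth_proj V\<close> on \<open>direction A\<close> and the map
  \<open>orth_proj (direction A)\<close> on \<open>V\<close> are adjoint. Hence the kernel of the
  first is the orthogonal complement, inside \<open>direction A\<close>, of the image of the second,
  which is \<open>span B\<close>. Displacements orthogonal to \<open>B\<close> stay in a fibre,
  while \<open>span B\<close> is mapped isomorphically onto \<open>V\<close>. So
  \<open>foot A + u\<close> with \<open>u \<in> span B\<close> is the nearest point of its fibre,
  and Pythagoras yields \<open>minsq\<close>. The vectors \<open>t e\<close> are dual to the images
  of \<open>B\<close>, which need not be orthonormal.\<close>

lemma fiber_frame:
  fixes A V :: "'a::{real_inner,complete_space} set"
  assumes A: "affine A" "closed A" "A \<noteq> {}" and E: "orthonormal E" "span E = V"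
    and onto: "orth_proj V ` A = V"
  obtains B t where "orthonormal B" "span B \<subseteq> direction A" "card B \<le> card E"
    "\<forall>e\<in>B. t e \<in> V \<and> orth_proj (direction A) (t e) = e"
    "\<forall>e\<in>B. \<forall>e'\<in>B. inner (t e) (orth_proj V e') = (if e = e' then 1 else 0)"
    "span (orth_proj V ` B) = V"
    "\<forall>w\<in>direction A. (\<forall>e\<in>B. inner w e = 0) \<longrightarrow> orth_proj V w = 0"
    "\<forall>u\<in>span B. minsq A V (orth_proj V (foot A + u)) = (norm (foot A))\<^sup>2 + (norm u)\<^sup>2"
    "span B = orth_proj (direction A) ` V"
proof -
  let ?D = "direction A" and ?p = "foot A" and ?P = "orth_proj V"
  have p: "?p \<in> A" using A by (intro foot_in affine_imp_convex)
  have D: "subspace ?D" "closed ?D" using A p by (auto intro: subspace_direction closed_direction)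
  then have PD: "proj_subspace ?D" by (rule closed_proj_subspace)
  have PV: "proj_subspace V" using orthonormal_proj_subspace E by blast
  then have V: "subspace V" by (simp add: proj_subspace_def)
  let ?Q = "orth_proj ?D"
  note linP = linear_orth_proj[OF PV] and linQ = linear_orth_proj[OF PD]
  have QV: "?Q ` V = span (?Q ` E)" using E(2) linear_span_image[OF linQ, of E] by simp
  have "fin_dim_subspace (?Q ` V)"
    unfolding fin_dim_subspace_def QV using E(1) by (auto simp: orthonormal_def)
  then obtain B where B: "orthonormal B" "span B = ?Q ` V" by (rule fin_dim_basis)
  have "card B = dim (?Q ` V)" using orthonormal_dim[OF B(1)] B(2) by simp
  also have "\<dots> \<le> card (?Q ` E)"
    unfolding QV using E(1) by (intro dim_le_card) (auto simp: orthonormal_def)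
  also have "\<dots> \<le> card E" using E(1) by (intro card_image_le) (auto simp: orthonormal_def)
  finally have cB: "card B \<le> card E" .
  have BD: "span B \<subseteq> ?D" using B(2) orth_proj_mem[OF PD] by auto
  \<comment> \<open>The adjointness: each projection may be dropped against a vector of its own
    subspace.\<close>
  have key: "inner (?P w) \<tau> = inner w (?Q \<tau>)" if "w \<in> ?D" "\<tau> \<in> V" for w \<tau>
    using orth_proj_inner[OF PV that(2), of w] orth_proj_inner[OF PD that(1), of \<tau>]
    by (simp add: inner_commute)
  have "\<forall>e\<in>B. \<exists>s. s \<in> V \<and> ?Q s = e"
    using B(2) span_superset[of B] by auto
  then obtain t where t: "\<And>e. e \<in> B \<Longrightarrow> t e \<in> V \<and> ?Q (t e) = e" by metis
  have dual: "inner (t e) (?P e') = (if e = e' then 1 else 0)" if "e \<in> B" "e' \<in> B" for e e'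
  proof -
    have "e' \<in> ?D" using BD span_base[OF that(2)] by blast
    then have "inner (?P e') (t e) = inner e' e" using key t that by simp
    then show ?thesis using B(1) that by (auto simp: orthonormal_def inner_commute)
  qed
  have ker: "?P w = 0" if "w \<in> ?D" "\<forall>e\<in>B. inner w e = 0" for w
  proof -
    have "inner w u = 0" if "u \<in> span B" for u
      using orthogonal_to_span[OF that, of w] \<open>\<forall>e\<in>B. inner w e = 0\<close> by (simp add: orthogonal_def)
    \<comment> \<open>Adjointness is used with \<open>?P w\<close> itself as the vector of
      \<open>V\<close>; its image under \<open>?Q\<close> lies in \<open>span B\<close>, to which
      \<open>w\<close> is orthogonal.\<close>
    then have "inner (?P w) (?P w) = 0"
      using key[OF \<open>w \<in> ?D\<close> orth_proj_mem[OF PV, of w]] orth_proj_mem[OF PV, of w] B(2) by auto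
    then show ?thesis by simp
  qed
  have sp: "span (?P ` B) = V"
  proof (rule antisym)
    show "span (?P ` B) \<subseteq> V" using orth_proj_mem[OF PV] V by (intro span_minimal) auto
    show "V \<subseteq> span (?P ` B)"
    proof
      fix v assume "v \<in> V"
      \<comment> \<open>Surjectivity is known for \<open>A\<close>, not for its direction; the shift
        by \<open>?P ?p\<close> passes from one to the other.\<close>
      then have "v + ?P ?p \<in> ?P ` A" using onto V orth_proj_mem[OF PV] by (auto intro: subspace_add)
      then obtain y where y: "y \<in> A" "?P y = v + ?P ?p" by auto
      define w where "w = y - ?p"
      have w: "w \<in> ?D" "?P w = v"
        using y by (auto simp: w_def direction_def linear_diff[OF linP])
      define u where "u = (\<Sum>e\<in>B. inner w e *\<^sub>R e)"
      have u: "u \<in> span B" unfolding u_def by (intro span_sum span_scale span_base)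
      have "?P (w - u) = 0"
        using w(1) u BD D by (intro ker)
          (auto simp: u_def inner_diff_left inner_sum_orthonormal[OF B(1)] intro: subspace_diff)
      then have "v = ?P u" using w(2) by (simp add: linear_diff[OF linP])
      also have "\<dots> \<in> span (?P ` B)" using u linear_span_image[OF linP, of B] by auto
      finally show "v \<in> span (?P ` B)" .
    qed
  qed
  have mn: "minsq A V (?P (?p + u)) = (norm ?p)\<^sup>2 + (norm u)\<^sup>2" if u: "u \<in> span B" for u
  proof -
    let ?F = "fiber A V (?P (?p + u))"
    have uD: "u \<in> ?D" using u BD by blast
    then have puA: "?p + u \<in> A" by (auto simp: direction_def)
    then have F: "affine ?F" "closed ?F" "?F \<noteq> {}"
      using fiber_properties[OF A(1,2) PV] by auto
    have pyth: "(norm (?p + w))\<^sup>2 = (norm ?p)\<^sup>2 + (norm w)\<^sup>2" if "w \<in> ?D" for w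
      using foot_orthogonal[OF A that]
      by (simp add: power2_norm_eq_inner inner_add_left inner_add_right inner_commute)
    have le: "(norm ?p)\<^sup>2 + (norm u)\<^sup>2 \<le> (norm y)\<^sup>2" if "y \<in> ?F" for y
    proof -
      define w where "w = y - ?p"
      have w: "w \<in> ?D" "?P w = ?P u"
        using that by (auto simp: w_def direction_def fiber_def linear_diff[OF linP] linear_add[OF linP])
      \<comment> \<open>Because \<open>u\<close> is the image of some \<open>\<tau>\<close> in
        \<open>V\<close>, pairing with \<open>u\<close> sees only the projection to
        \<open>V\<close>, and there \<open>w\<close> and \<open>u\<close> agree. So
        \<open>w - u\<close> is orthogonal to \<open>u\<close>.\<close>
      obtain \<tau> where \<tau>: "\<tau> \<in> V" "u = ?Q \<tau>" using u B(2) by auto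
      have "inner (w - u) u = inner (?P (w - u)) \<tau>"
        using key[of "w - u" \<tau>] w(1) uD D \<tau> by (simp add: subspace_diff)
      also have "\<dots> = 0" using w(2) by (simp add: linear_diff[OF linP])
      finally have "(norm w)\<^sup>2 = (norm u)\<^sup>2 + (norm (w - u))\<^sup>2"
        by (simp add: power2_norm_eq_inner inner_diff_left inner_diff_right inner_commute)
      moreover have "(norm y)\<^sup>2 = (norm ?p)\<^sup>2 + (norm w)\<^sup>2" using pyth[OF w(1)] by (simp add: w_def)
      ultimately show ?thesis by simp
    qed
    have "?p + u \<in> ?F" using puA by (simp add: fiber_def)
    then have "norm (foot ?F) \<le> norm (?p + u)"
      using F by (intro norm_foot_le affine_imp_convex)
    then have "(norm (foot ?F))\<^sup>2 \<le> (norm (?p + u))\<^sup>2" by (intro power_mono) auto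
    moreover have "foot ?F \<in> ?F" using F by (intro foot_in affine_imp_convex)
    ultimately show ?thesis using le pyth[OF uD] by (force simp: minsq_def)
  qed
  show ?thesis
    by (rule that[of B t]) (use B BD cB t dual sp ker mn in auto)
qed

section \<open>Approximation by the subspaces \<open>Z N\<close>\<close>

lemma affine_Collect_inner: "affine {y. \<forall>g\<in>G. inner g y = b g}"
  by (auto simp: affine_def inner_add_right distrib_right[symmetric])

lemma closed_Collect_inner: "closed {y. \<forall>g\<in>G. inner g y = b g}"
proof -
  have "{y. \<forall>g\<in>G. inner g y = b g} = (\<Inter>g\<in>G. {y. inner g y = b g})" by auto
  then show ?thesis by (auto intro!: closed_INT closed_Collect_eq continuous_intros)
qed

text \<open>Induction on the constraints: near a point satisfying a new constraint there are points of
  the dense subspace on both sides of it, and a convex combination satisfies it exactly.\<close>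

lemma closure_affine_Int_dense:
  fixes D :: "'a::real_inner set"
  assumes "finite G" "subspace D" "closure D = UNIV" "\<forall>g\<in>G. inner g y = b g"
  shows "y \<in> closure ({y. \<forall>g\<in>G. inner g y = b g} \<inter> D)"
  using assms(1,4)
proof (induction G arbitrary: y)
  case empty
  then show ?case using assms(3) by simp
next
  case (insert g G)
  define A where "A = {y. \<forall>g\<in>G. inner g y = b g}"
  have A: "affine A" unfolding A_def by (rule affine_Collect_inner)
  have IH: "z \<in> closure (A \<inter> D)" if "z \<in> A" for z using insert.IH that by (simp add: A_def)
  have yA: "y \<in> A" "inner g y = b g" using insert.prems by (auto simp: A_def)
  have eq: "{y. \<forall>h\<in>insert g G. inner h y = b h} = A \<inter> {y. inner g y = b g}" by (auto simp: A_def)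
  show ?case
  proof (cases "\<forall>z\<in>A. inner g z = b g")
    case True
    then have "A \<inter> {y. inner g y = b g} = A" by auto
    then show ?thesis using eq IH[OF yA(1)] by simp
  next
    case False
    then obtain y1 where y1: "y1 \<in> A" "inner g y1 \<noteq> b g" by auto
    show ?thesis unfolding eq closure_approachable
    proof (intro allI impI)
      fix \<epsilon> :: real assume "\<epsilon> > 0"
      \<comment> \<open>The sign makes \<open>inner g\<close> increase along \<open>w\<close>, and
        the scale gives \<open>w\<close> length \<open>\<epsilon> / 2\<close>, so that
        \<open>y + w\<close> and \<open>y - w\<close> lie strictly on the two sides of the
        constraint and inside the ball.\<close>
      define s where "s = sgn (inner g (y1 - y)) * \<epsilon> / (2 * norm (y1 - y))"
      define w where "w = s *\<^sub>R (y1 - y)"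
      have ne: "inner g (y1 - y) \<noteq> 0" using y1 yA by (simp add: inner_diff_right)
      then have "y1 \<noteq> y" by auto
      have gw: "inner g w > 0"
        using ne \<open>\<epsilon> > 0\<close> \<open>y1 \<noteq> y\<close>
        by (cases "inner g (y1 - y)" "0 :: real" rule: linorder_cases)
          (auto simp: w_def s_def divide_simps mult_pos_neg)
      have nw: "norm w = \<epsilon> / 2"
        using ne \<open>\<epsilon> > 0\<close> \<open>y1 \<noteq> y\<close> by (simp add: w_def s_def abs_mult abs_sgn_eq)
      have mem: "y + c *\<^sub>R w \<in> A" for c
      proof -
        have "(1 - c * s) *\<^sub>R y + (c * s) *\<^sub>R y1 \<in> A" using A yA(1) y1(1) by (intro mem_affine) auto
        then show ?thesis by (simp add: w_def algebra_simps)
      qed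
      have near: "\<exists>d\<in>A \<inter> D. d \<in> U" if "open U" "y + c *\<^sub>R w \<in> U" for c U
        using IH[OF mem] that by (auto simp: closure_iff_nhds_not_empty) (metis IntI IntD1 IntD2 disjoint_iff interior_open interior_subset subsetD)
      have "\<exists>d\<in>A \<inter> D. d \<in> ball y \<epsilon> \<inter> {z. inner g z > b g}"
        using yA(2) gw nw \<open>\<epsilon> > 0\<close>
        by (intro near[where c = 1] open_Int open_ball open_Collect_less continuous_intros)
          (auto simp: dist_norm inner_add_right)
      then obtain d1 where d1: "d1 \<in> A" "d1 \<in> D" "dist y d1 < \<epsilon>" "inner g d1 > b g" by auto
      have "\<exists>d\<in>A \<inter> D. d \<in> ball y \<epsilon> \<inter> {z. inner g z < b g}"
        using yA(2) gw nw \<open>\<epsilon> > 0\<close>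
        by (intro near[where c = "-1"] open_Int open_ball open_Collect_less continuous_intros)
          (auto simp: dist_norm inner_diff_right)
      then obtain d2 where d2: "d2 \<in> A" "d2 \<in> D" "dist y d2 < \<epsilon>" "inner g d2 < b g" by auto
      define l where "l = (inner g d1 - b g) / (inner g d1 - inner g d2)"
      have l: "0 \<le> l" "l \<le> 1" using d1 d2 by (auto simp: l_def field_simps)
      define d where "d = (1 - l) *\<^sub>R d1 + l *\<^sub>R d2"
      have "l * (inner g d1 - inner g d2) = inner g d1 - b g" using d1 d2 by (simp add: l_def)
      then have "inner g d = b g" by (simp add: d_def inner_add_right algebra_simps)
      moreover have "d \<in> A" unfolding d_def using A d1 d2 by (intro mem_affine) auto
      moreover have "d \<in> D" unfolding d_def using assms(2) d1 d2 by (auto intro: subspace_add subspace_scale)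
      moreover have "d \<in> ball y \<epsilon>"
        unfolding d_def using d1 d2 l by (intro convexD[OF convex_ball]) auto
      ultimately show "\<exists>d\<in>A \<inter> {y. inner g y = b g} \<inter> D. dist d y < \<epsilon>"
        by (auto simp: dist_commute)
    qed
  qed
qed

text \<open>The normals are the residuals \<open>c - ?Q c\<close> of the finitely many vectors
  \<open>c\<close> completing the direction. If \<open>y\<close> is orthogonal to all of them, then
  \<open>y - ?Q y\<close> is orthogonal to the direction and to \<open>C\<close>, hence to the whole
  space.\<close>

lemma finite_codim_constraints:
  fixes L :: "'a::{real_inner,complete_space} set"
  assumes "affine L" "closed L" "L \<noteq> {}" "finite_codim L"
  obtains G b where "finite G" "L = {y. \<forall>g\<in>G. inner g y = b g}"
proof -
  let ?D = "direction L" and ?p = "foot L"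
  have p: "?p \<in> L" using assms by (intro foot_in affine_imp_convex)
  have D: "subspace ?D" "closed ?D" using assms p by (auto intro: subspace_direction closed_direction)
  then have PD: "proj_subspace ?D" by (rule closed_proj_subspace)
  let ?Q = "orth_proj ?D"
  obtain C where C: "finite C" "span (?D \<union> C) = UNIV" using assms(4) by (auto simp: finite_codim_def)
  define G where "G = (\<lambda>c. c - ?Q c) ` C"
  have "y \<in> ?D \<longleftrightarrow> (\<forall>g\<in>G. inner g y = 0)" for y
  proof
    assume "y \<in> ?D"
    then show "\<forall>g\<in>G. inner g y = 0" using orth_proj_orth[OF PD] by (auto simp: G_def)
  next
    assume *: "\<forall>g\<in>G. inner g y = 0"
    have "orthogonal (y - ?Q y) x" if "x \<in> ?D \<union> C" for x
    proof (cases "x \<in> ?D")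
      case True
      then show ?thesis using orth_proj_orth[OF PD] by (simp add: orthogonal_def)
    next
      case False
      then have "inner (x - ?Q x) y = 0" using that * by (auto simp: G_def)
      moreover have "inner (x - ?Q x) (?Q y) = 0" "inner (y - ?Q y) (?Q x) = 0"
        using orth_proj_orth[OF PD orth_proj_mem[OF PD]] by auto
      ultimately show ?thesis
        by (simp add: orthogonal_def inner_diff_left inner_diff_right inner_commute)
    qed
    moreover have "y - ?Q y \<in> span (?D \<union> C)" unfolding C(2) by simp
    ultimately have "orthogonal (y - ?Q y) (y - ?Q y)" by (rule orthogonal_to_span[rotated])
    then have "y = ?Q y" by (simp add: orthogonal_def)
    then show "y \<in> ?D" using orth_proj_mem[OF PD] by metis
  qed
  moreover have "y \<in> L \<longleftrightarrow> y - ?p \<in> ?D" for y by (auto simp: direction_def)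
  ultimately have "L = {y. \<forall>g\<in>G. inner g y = inner g ?p}" by (auto simp: inner_diff_right)
  then show ?thesis using C(1) by (intro that[of G]) (auto simp: G_def)
qed

text \<open>A basis of the constrained subspace together with the projections of \<open>G\<close> to
  \<open>Z\<close> spans \<open>Z\<close>: a vector of \<open>Z\<close> orthogonal to those
  projections satisfies the constraints, and being orthogonal to the constrained subspace as well it
  is zero. The point is that the loss \<open>card G\<close> does not depend on
  \<open>Z\<close>.\<close>

lemma dim_constraints:
  fixes Z :: "'a::real_inner set"
  assumes Z: "fin_dim_subspace Z" and G: "finite G"
  shows "dim Z \<le> dim {z \<in> Z. \<forall>g\<in>G. inner g z = 0} + card G"
proof -
  let ?W = "{z \<in> Z. \<forall>g\<in>G. inner g z = 0}"
  obtain BZ where BZ: "orthonormal BZ" "span BZ = Z" using Z by (rule fin_dim_basis)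
  then have PZ: "proj_subspace Z" using orthonormal_proj_subspace by blast
  then have sZ: "subspace Z" by (simp add: proj_subspace_def)
  have "subspace ?W"
    using sZ by (auto simp: subspace_def inner_add_right)
  then have "fin_dim_subspace ?W" by (rule fin_dim_subset[OF _ _ Z]) auto
  then obtain B where B: "orthonormal B" "span B = ?W" by (rule fin_dim_basis)
  let ?PG = "orth_proj Z ` G"
  obtain B2 where B2: "B \<subseteq> B2" "orthonormal B2" "span B2 = span (B \<union> ?PG)"
    using orthonormal_extend_finite[OF B(1), of ?PG] G by auto
  have P2: "proj_subspace (span B2)" by (rule orthonormal_proj_subspace[OF B2(2)])
  have sub: "span B2 \<subseteq> Z"
  proof -
    have "B \<subseteq> Z" using B(2) span_superset[of B] by auto
    then show ?thesis unfolding B2(3) using orth_proj_mem[OF PZ] sZ by (intro span_minimal) auto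
  qed
  have "Z \<subseteq> span B2"
  proof
    fix z assume z: "z \<in> Z"
    define w where "w = z - orth_proj (span B2) z"
    have w: "inner w x = 0" if "x \<in> span B2" for x
      unfolding w_def using orth_proj_orth[OF P2 that] .
    have wZ: "w \<in> Z" unfolding w_def using z sub orth_proj_mem[OF P2] sZ by (auto intro: subspace_diff)
    have "inner g w = 0" if "g \<in> G" for g
    proof -
      have "orth_proj Z g \<in> span B2" unfolding B2(3) using that by (intro span_base) auto
      then have "inner w (orth_proj Z g) = 0" by (rule w)
      then show ?thesis using orth_proj_inner[OF PZ wZ, of g] by (simp add: inner_commute)
    qed
    then have "w \<in> span B2" using wZ B(2) span_mono[OF B2(1)] by auto
    then have "w = 0" using w[of w] by simp
    then have "z = orth_proj (span B2) z" by (simp add: w_def)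
    then show "z \<in> span B2" using orth_proj_mem[OF P2] by metis
  qed
  then have "dim Z \<le> card (B \<union> ?PG)"
    using B2(3) B(1) G by (intro dim_le_card) (auto simp: orthonormal_def)
  also have "\<dots> \<le> card B + card ?PG" by (rule card_Un_le)
  also have "card ?PG \<le> card G" using G by (rule card_image_le)
  finally show ?thesis using orthonormal_dim[OF B(1)] B(2) by simp
qed

lemma direction_Int_constraints:
  assumes "foot ({y. \<forall>g\<in>G. inner g y = b g} \<inter> Z) \<in> {y. \<forall>g\<in>G. inner g y = b g} \<inter> Z"
    and "subspace Z"
  shows "direction ({y. \<forall>g\<in>G. inner g y = b g} \<inter> Z) = {z \<in> Z. \<forall>g\<in>G. inner g z = 0}"
  (is "direction ?A = ?W")
proof (intro set_eqI iffI)
  fix x assume "x \<in> direction ?A"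
  then show "x \<in> ?W" using assms by (auto simp: direction_def inner_diff_right intro: subspace_diff)
next
  fix x assume x: "x \<in> ?W"
  then have "x + foot ?A \<in> ?A" using assms by (auto simp: inner_add_right intro: subspace_add)
  then show "x \<in> direction ?A" unfolding direction_def by (intro image_eqI[of _ _ "x + foot ?A"]) auto
qed

locale exhausting =
  fixes Z :: "nat \<Rightarrow> 'a::{real_inner,complete_space} set"
  assumes fin: "\<And>N. fin_dim_subspace (Z N)" and mono: "\<And>N. Z N \<subseteq> Z (Suc N)"
    and dense: "closure (\<Union>N. Z N) = UNIV"
begin

lemma Z_mono: "M \<le> N \<Longrightarrow> Z M \<subseteq> Z N"
  using lift_Suc_mono_le[of Z] mono by blast

lemma subspace_Z: "subspace (Z N)"
  using fin[of N] subspace_span unfolding fin_dim_subspace_def by metis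

lemma closed_Z: "closed (Z N)"
  using fin_dim_basis[OF fin] closed_span_orthonormal by metis

lemma subspace_UN_Z: "subspace (\<Union>N. Z N)"
proof (rule subspaceI)
  show "0 \<in> (\<Union>N. Z N)" using subspace_0[OF subspace_Z] by blast
  show "c *\<^sub>R x \<in> (\<Union>N. Z N)" if "x \<in> (\<Union>N. Z N)" for c x
    using that subspace_scale[OF subspace_Z] by blast
  fix x y assume "x \<in> (\<Union>N. Z N)" "y \<in> (\<Union>N. Z N)"
  then obtain M N where "x \<in> Z M" "y \<in> Z N" by blast
  then have "x + y \<in> Z (max M N)"
    using Z_mono[of M "max M N"] Z_mono[of N "max M N"] by (intro subspace_add[OF subspace_Z]) auto
  then show "x + y \<in> (\<Union>N. Z N)" by blast
qed

context
  fixes G :: "'a set" and b :: "'a \<Rightarrow> real" and A :: "'a set"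
  assumes G: "finite G" and A_def: "A = {y. \<forall>g\<in>G. inner g y = b g}" and ne: "A \<noteq> {}"
begin

text \<open>Density gives one approximating point in some \<open>Z N0\<close>, and monotonicity
  keeps it available for all later \<open>N\<close>.\<close>

lemma approx_in_Z:
  assumes "y \<in> A" "\<epsilon> > 0"
  shows "\<forall>\<^sub>F N in sequentially. \<exists>z\<in>A \<inter> Z N. dist z y < \<epsilon>"
proof -
  have "y \<in> closure (A \<inter> (\<Union>N. Z N))"
    using closure_affine_Int_dense[OF G subspace_UN_Z dense, of y b] assms(1) unfolding A_def by simp
  then obtain z N0 where z: "z \<in> A" "z \<in> Z N0" "dist z y < \<epsilon>"
    using assms(2) unfolding closure_approachable by blast
  then have "\<exists>z\<in>A \<inter> Z N. dist z y < \<epsilon>" if "N0 \<le> N" for N using Z_mono[OF that] by blast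
  then show ?thesis by (auto simp: eventually_sequentially)
qed

lemma Int_Z_properties:
  "affine (A \<inter> Z N)" "closed (A \<inter> Z N)"
  unfolding A_def
  by (intro affine_Int closed_Int subspace_imp_affine[OF subspace_Z] closed_Z
      affine_Collect_inner closed_Collect_inner)+

lemma eventually_Int_nonempty: "\<forall>\<^sub>F N in sequentially. A \<inter> Z N \<noteq> {}"
proof -
  obtain y where "y \<in> A" using ne by blast
  from approx_in_Z[OF this zero_less_one] show ?thesis by eventually_elim auto
qed

lemma norm_foot_le_Int:
  assumes "A \<inter> Z N \<noteq> {}"
  shows "norm (foot A) \<le> norm (foot (A \<inter> Z N))"
proof -
  have "foot (A \<inter> Z N) \<in> A \<inter> Z N"
    using assms Int_Z_properties by (intro foot_in affine_imp_convex)
  then show ?thesis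
    using affine_Collect_inner[of G b] closed_Collect_inner[of G b] ne
    unfolding A_def by (intro norm_foot_le affine_imp_convex) auto
qed

text \<open>Points of \<open>A \<inter> Z N\<close> near the foot of \<open>A\<close> bound the
  norms from above, and inclusion bounds them from below. The set \<open>A\<close> is a parameter
  because the result is needed for \<open>L\<close> and also for the fibres of \<open>L\<close> over
  \<open>V\<close>, where it gives convergence of \<open>minsq\<close>.\<close>

lemma tendsto_norm_foot: "(\<lambda>N. norm (foot (A \<inter> Z N))) \<longlonglongrightarrow> norm (foot A)"
proof (rule tendstoI)
  fix \<epsilon> :: real assume e: "\<epsilon> > 0"
  have fA: "foot A \<in> A"
    using affine_Collect_inner[of G b] closed_Collect_inner[of G b] ne
    unfolding A_def by (intro foot_in affine_imp_convex) auto
  show "\<forall>\<^sub>F N in sequentially. dist (norm (foot (A \<inter> Z N))) (norm (foot A)) < \<epsilon>"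
    using approx_in_Z[OF fA e]
  proof eventually_elim
    case (elim N)
    then obtain z where z: "z \<in> A \<inter> Z N" "dist z (foot A) < \<epsilon>" by blast
    have "norm (foot (A \<inter> Z N)) \<le> norm z"
      using Int_Z_properties z by (intro norm_foot_le affine_imp_convex) auto
    also have "\<dots> < norm (foot A) + \<epsilon>"
      using z(2) norm_triangle_ineq2[of z "foot A"] by (simp add: dist_norm)
    finally have "norm (foot (A \<inter> Z N)) < norm (foot A) + \<epsilon>" .
    moreover have "A \<inter> Z N \<noteq> {}" using z(1) by blast
    ultimately show ?case using norm_foot_le_Int[of N] by (simp add: dist_real_def)
  qed
qed

end

text \<open>Each \<open>Z M\<close> is closed, so if it contained all the others it would contain
  the closure of their union, which is the whole infinite-dimensional space. Hence the dimension
  keeps increasing.\<close>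

lemma filterlim_dim_Z:
  assumes "\<not> fin_dim_subspace (UNIV :: 'a set)"
  shows "filterlim (\<lambda>N. dim (Z N)) at_top sequentially"
proof -
  have dim_mono: "dim (Z M) \<le> dim (Z N)" if le: "M \<le> N" for M N
  proof -
    obtain B where B: "orthonormal B" "span B = Z M" using fin[of M] by (rule fin_dim_basis)
    obtain C where "orthonormal (B \<union> C)" "B \<inter> C = {}" "span (B \<union> C) = Z N"
      using Z_mono[OF le] by (rule orthonormal_extend[OF B(1) _ fin[of N], unfolded B(2)])
    then show ?thesis
      using B orthonormal_dim[of B] orthonormal_dim[of "B \<union> C"]
      by (metis card_mono orthonormal_def sup_ge1)
  qed
  have "\<exists>N. K \<le> dim (Z N)" for K
  proof (induction K)
    case (Suc K)
    then obtain M where M: "K \<le> dim (Z M)" by blast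
    obtain x where x: "x \<in> (\<Union>N. Z N)" "x \<notin> Z M"
    proof -
      have "\<not> (\<Union>N. Z N) \<subseteq> Z M"
      proof
        assume "(\<Union>N. Z N) \<subseteq> Z M"
        then have "closure (\<Union>N. Z N) \<subseteq> Z M" using closed_Z by (rule closure_minimal)
        then show False using dense fin[of M] assms by (simp add: top.extremum_unique)
      qed
      then show ?thesis using that by blast
    qed
    then obtain N' where "x \<in> Z N'" by blast
    define N where "N = max M N'"
    have xN: "x \<in> Z N" "Z M \<subseteq> Z N" using \<open>x \<in> Z N'\<close> Z_mono[of N' N] Z_mono[of M N] by (auto simp: N_def)
    obtain B where B: "orthonormal B" "span B = Z M" using fin[of M] by (rule fin_dim_basis)
    obtain C where C: "orthonormal (B \<union> C)" "B \<inter> C = {}" "span (B \<union> C) = Z N"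
      using xN(2) by (rule orthonormal_extend[OF B(1) _ fin[of N], unfolded B(2)])
    have "C \<noteq> {}" using C(3) B(2) x(2) xN(1) by auto
    moreover have "finite B" "finite C" using C(1) by (auto simp: orthonormal_def)
    ultimately have "card (B \<union> C) > card B"
      using C(2) by (simp add: card_Un_disjoint card_gt_0_iff)
    then show ?case
      using M orthonormal_dim[OF B(1)] orthonormal_dim[OF C(1)] B(2) C(3) by (intro exI[of _ N]) simp
  qed simp
  then show ?thesis
    unfolding filterlim_at_top eventually_sequentially using dim_mono le_trans by metis
qed

end

section \<open>Lebesgue measure in linear coordinates\<close>

abbreviation PL :: "'i set \<Rightarrow> ('i \<Rightarrow> real) measure" where
  "PL B \<equiv> Pi\<^sub>M B (\<lambda>_. lborel)"

interpretation PL: product_sigma_finite "\<lambda>_ :: 'i. lborel :: real measure"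
  by standard

text \<open>It suffices to compare boxes, where every coordinate contributes one factor
  \<open>s\<close>.\<close>

lemma PL_affine:
  fixes b :: "'i \<Rightarrow> real"
  assumes B: "finite B" and s: "s > 0"
  shows "scale_measure (ennreal (s ^ card B)) (distr (PL B) (PL B) (\<lambda>x. \<lambda>e\<in>B. s * x e + b e)) = PL B"
proof (rule PL.PiM_eqI[OF B])
  fix A :: "'i \<Rightarrow> real set" assume A: "\<And>i. i \<in> B \<Longrightarrow> A i \<in> sets lborel"
  let ?A' = "\<lambda>e. {x. s * x + b e \<in> A e}"
  have m: "?A' e \<in> sets lborel" if "e \<in> B" for e
    using A[OF that] by measurable
  have sc: "emeasure lborel (A e) = ennreal s * emeasure lborel (?A' e)" if "e \<in> B" for e
  proof -
    have "emeasure lborel (A e) = (\<integral>\<^sup>+x. indicator (A e) x \<partial>lborel)" using A[OF that] by simp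
    also have "\<dots> = s * (\<integral>\<^sup>+x. indicator (A e) (b e + s * x) \<partial>lborel)"
      using s A[OF that] by (subst nn_integral_real_affine[where c = s and t = "b e"]) auto
    also have "(\<integral>\<^sup>+x. indicator (A e) (b e + s * x) \<partial>lborel) = (\<integral>\<^sup>+x. indicator (?A' e) x \<partial>lborel)"
      by (intro nn_integral_cong) (auto simp: indicator_def add.commute)
    also have "\<dots> = emeasure lborel (?A' e)" using m[OF that] by simp
    finally show ?thesis .
  qed
  have "emeasure (distr (PL B) (PL B) (\<lambda>x. \<lambda>e\<in>B. s * x e + b e)) (Pi\<^sub>E B A)
      = emeasure (PL B) (Pi\<^sub>E B ?A')"
  proof (subst emeasure_distr)
    show "Pi\<^sub>E B A \<in> sets (PL B)" using A B by (intro sets_PiM_I_finite) auto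
    show "emeasure (PL B) ((\<lambda>x. \<lambda>e\<in>B. s * x e + b e) -` Pi\<^sub>E B A \<inter> space (PL B)) = emeasure (PL B) (Pi\<^sub>E B ?A')"
      by (intro arg_cong[where f = "emeasure (PL B)"]) (auto simp: space_PiM PiE_def Pi_def extensional_def)
  qed measurable
  also have "\<dots> = (\<Prod>e\<in>B. emeasure lborel (?A' e))"
    using m B by (intro PL.emeasure_PiM) auto
  finally show "emeasure (scale_measure (ennreal (s ^ card B)) (distr (PL B) (PL B) (\<lambda>x. \<lambda>e\<in>B. s * x e + b e))) (Pi\<^sub>E B A)
      = (\<Prod>e\<in>B. emeasure lborel (A e))"
    using s by (simp add: sc prod.distrib ennreal_power[symmetric])
qed simp

lemma emeasure_PL_box:
  assumes "finite B" "r \<ge> 0"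
  shows "emeasure (PL B) (Pi\<^sub>E B (\<lambda>_. {-r..r})) = ennreal ((2 * r) ^ card B)"
  using assms by (subst PL.emeasure_PiM) (auto simp: ennreal_power)

text \<open>For an orthonormal family this is Lebesgue measure of the span; for a merely independent
  one it is a multiple of it. Index set and vectors are kept apart so that a basis and its image
  under a linear map use the same coordinates.\<close>

definition frame_leb :: "'i set \<Rightarrow> ('i \<Rightarrow> 'a) \<Rightarrow> 'a::{real_inner,second_countable_topology} measure" where
  "frame_leb B T = distr (PL B) borel (\<lambda>x. \<Sum>e\<in>B. x e *\<^sub>R T e)"

lemma measurable_frame [measurable]:
  fixes T :: "'i \<Rightarrow> 'a::{real_inner,second_countable_topology}"
  shows "(\<lambda>x. \<Sum>e\<in>B. x e *\<^sub>R T e) \<in> borel_measurable (PL B)"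
  by (intro borel_measurable_sum borel_measurable_scaleR borel_measurable_const)
     (simp add: measurable_component_singleton)

lemma sets_frame_leb [simp, measurable_cong]: "sets (frame_leb B T) = sets borel"
  by (simp add: frame_leb_def)

lemma space_frame_leb [simp]: "space (frame_leb B T) = UNIV"
  by (simp add: frame_leb_def)

lemma nn_integral_frame_leb:
  "g \<in> borel_measurable borel \<Longrightarrow>
    (\<integral>\<^sup>+y. g y \<partial>frame_leb B T) = (\<integral>\<^sup>+x. g (\<Sum>e\<in>B. x e *\<^sub>R T e) \<partial>PL B)"
  unfolding frame_leb_def by (rule nn_integral_distr) measurable

text \<open>The dual family \<open>d\<close> expresses independence through inner products: it reads
  off the coordinates continuously, which gives closedness of the span and bounds on balls.\<close>

locale frame =
  fixes B :: "'i set" and T :: "'i \<Rightarrow> 'a::{real_inner,second_countable_topology}" and d :: "'i \<Rightarrow> 'a"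
  assumes fin [simp]: "finite B"
    and dual: "\<And>e e'. e \<in> B \<Longrightarrow> e' \<in> B \<Longrightarrow> inner (d e) (T e') = (if e = e' then 1 else 0)"
begin

abbreviation M where "M \<equiv> frame_leb B T"
abbreviation S where "S \<equiv> span (T ` B)"
abbreviation comb where "comb x \<equiv> \<Sum>e\<in>B. x e *\<^sub>R T e"

lemma inner_comb: "e \<in> B \<Longrightarrow> inner (d e) (comb x) = x e"
proof -
  assume "e \<in> B"
  then have "inner (d e) (comb x) = (\<Sum>e'\<in>B. if e = e' then x e' else 0)"
    by (auto simp: inner_sum_right dual intro!: sum.cong simp del: sum.delta sum.delta')
  then show ?thesis using \<open>e \<in> B\<close> by simp
qed

lemma comb_in: "comb x \<in> S"
  by (intro span_sum span_scale span_base) auto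

lemma comb_expand: "y \<in> S \<Longrightarrow> comb (\<lambda>e. inner (d e) y) = y"
proof -
  assume "y \<in> S"
  moreover have "S \<subseteq> {y. comb (\<lambda>e. inner (d e) y) = y}"
  proof (rule span_minimal)
    show "T ` B \<subseteq> {y. comb (\<lambda>e. inner (d e) y) = y}"
      by (auto simp: dual if_distrib[where f = "\<lambda>c. c *\<^sub>R _"] cong: if_cong)
    show "subspace {y. comb (\<lambda>e. inner (d e) y) = y}"
    proof (rule subspaceI; simp)
      show "comb (\<lambda>e. inner (d e) (x + y)) = x + y"
        if "comb (\<lambda>e. inner (d e) x) = x" "comb (\<lambda>e. inner (d e) y) = y" for x y
        using that by (simp add: inner_add_right scaleR_add_left sum.distrib)
      show "comb (\<lambda>e. c * inner (d e) x) = c *\<^sub>R x" if "comb (\<lambda>e. inner (d e) x) = x" for c x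
        using arg_cong[OF that, of "scaleR c"] by (simp add: scaleR_sum_right)
    qed
  qed
  ultimately show ?thesis by blast
qed

lemma closed_S: "closed S"
proof -
  have "S = {y. comb (\<lambda>e. inner (d e) y) = y}"
  proof (intro set_eqI iffI CollectI)
    show "y \<in> S" if "y \<in> {y. comb (\<lambda>e. inner (d e) y) = y}" for y
      using that comb_in[of "\<lambda>e. inner (d e) y"] by simp
  qed (rule comb_expand)
  moreover have "closed {y. comb (\<lambda>e. inner (d e) y) = y}"
    by (intro closed_Collect_eq continuous_intros)
  ultimately show ?thesis by simp
qed

lemma AE_in_S: "AE y in M. y \<in> S"
  unfolding frame_leb_def using closed_S
  by (subst AE_distr_iff) (auto simp: comb_in)

lemma nn_integral_affine:
  assumes [measurable]: "g \<in> borel_measurable borel" and s: "s > 0" and v: "v \<in> S"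
  shows "(\<integral>\<^sup>+y. g y \<partial>M) = ennreal (s ^ card B) * (\<integral>\<^sup>+y. g (s *\<^sub>R y + v) \<partial>M)"
proof -
  let ?h = "\<lambda>x. \<lambda>e\<in>B. s * x e + inner (d e) v"
  have [measurable]: "?h \<in> PL B \<rightarrow>\<^sub>M PL B" by measurable
  have eq: "comb (?h x) = s *\<^sub>R comb x + v" for x
    using comb_expand[OF v] by (simp add: scaleR_add_left sum.distrib scaleR_sum_right)
  have "(\<integral>\<^sup>+y. g y \<partial>M) = (\<integral>\<^sup>+x. g (comb x) \<partial>PL B)" by (simp add: nn_integral_frame_leb)
  also have "\<dots> = (\<integral>\<^sup>+x. g (comb x) \<partial>scale_measure (ennreal (s ^ card B)) (distr (PL B) (PL B) ?h))"
    by (subst PL_affine[OF fin s]) simp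
  also have "\<dots> = ennreal (s ^ card B) * (\<integral>\<^sup>+x. g (comb (?h x)) \<partial>PL B)"
    by (subst nn_integral_scale_measure) (simp_all add: nn_integral_distr)
  also have "(\<integral>\<^sup>+x. g (comb (?h x)) \<partial>PL B) = (\<integral>\<^sup>+y. g (s *\<^sub>R y + v) \<partial>M)"
    unfolding eq by (subst nn_integral_frame_leb) auto
  finally show ?thesis .
qed

lemma nn_integral_translate:
  assumes "g \<in> borel_measurable borel" "v \<in> S"
  shows "(\<integral>\<^sup>+y. g (y + v) \<partial>M) = (\<integral>\<^sup>+y. g y \<partial>M)"
  using nn_integral_affine[of g 1 v] assms by simp

lemma box_sets: "{y. \<forall>e\<in>B. \<bar>inner (d e) y\<bar> \<le> r} \<in> sets borel"
proof -
  have "{y. \<forall>e\<in>B. \<bar>inner (d e) y\<bar> \<le> r} = (\<Inter>e\<in>B. {y. \<bar>inner (d e) y\<bar> \<le> r})" by auto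
  then show ?thesis
    by (auto intro!: borel_closed closed_INT closed_Collect_le continuous_intros)
qed

lemma emeasure_box:
  assumes "r \<ge> 0"
  shows "emeasure M {y. \<forall>e\<in>B. \<bar>inner (d e) y\<bar> \<le> r} = ennreal ((2 * r) ^ card B)"
proof -
  have "emeasure M {y. \<forall>e\<in>B. \<bar>inner (d e) y\<bar> \<le> r} = emeasure (PL B) (Pi\<^sub>E B (\<lambda>_. {-r..r}))"
    unfolding frame_leb_def using box_sets
    by (subst emeasure_distr) (auto simp: inner_comb space_PiM abs_le_iff PiE_def Pi_def
        intro!: arg_cong[where f = "emeasure (PL B)"])
  then show ?thesis using emeasure_PL_box[OF fin assms] by simp
qed

lemma ball_subset_box:
  assumes "R \<ge> 0"
  shows "cball (0 :: 'a) R \<subseteq> {y. \<forall>e\<in>B. \<bar>inner (d e) y\<bar> \<le> (\<Sum>e\<in>B. norm (d e)) * R}"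
proof (safe)
  fix y :: 'a and e assume "y \<in> cball 0 R" "e \<in> B"
  then have "\<bar>inner (d e) y\<bar> \<le> norm (d e) * norm y" by (intro Cauchy_Schwarz_ineq2)
  also have "\<dots> \<le> (\<Sum>e\<in>B. norm (d e)) * R"
    using \<open>y \<in> cball 0 R\<close> \<open>e \<in> B\<close> by (intro mult_mono member_le_sum sum_nonneg) auto
  finally show "\<bar>inner (d e) y\<bar> \<le> (\<Sum>e\<in>B. norm (d e)) * R" .
qed

lemma emeasure_cball_finite: "emeasure M (cball 0 R) < \<infinity>"
proof (cases "R \<ge> 0")
  case True
  have "emeasure M (cball 0 R) \<le> emeasure M {y. \<forall>e\<in>B. \<bar>inner (d e) y\<bar> \<le> (\<Sum>e\<in>B. norm (d e)) * R}"
    using ball_subset_box[OF True] box_sets by (intro emeasure_mono) auto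
  also have "\<dots> < \<infinity>" using True by (subst emeasure_box) (auto intro!: mult_nonneg_nonneg sum_nonneg)
  finally show ?thesis .
qed simp

lemma emeasure_cball_pos:
  assumes "R > 0"
  shows "emeasure M (cball 0 R) > 0"
proof -
  \<comment> \<open>A box of half-width \<open>r\<close> is mapped into the ball of radius
    \<open>R\<close>. The summand 1 keeps the denominator positive when \<open>B\<close> is
    empty.\<close>
  define r where "r = R / (1 + (\<Sum>e\<in>B. norm (T e)))"
  have s: "(\<Sum>e\<in>B. norm (T e)) \<ge> 0" by (intro sum_nonneg) auto
  then have r: "r > 0" using assms by (simp add: r_def)
  have "0 < ennreal ((2 * r) ^ card B)" using r by simp
  also have "\<dots> = emeasure (PL B) (Pi\<^sub>E B (\<lambda>_. {-r..r}))" using r by (subst emeasure_PL_box) auto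
  also have "\<dots> \<le> emeasure (PL B) (comb -` cball 0 R \<inter> space (PL B))"
  proof (rule emeasure_mono)
    show "Pi\<^sub>E B (\<lambda>_. {-r..r}) \<subseteq> comb -` cball 0 R \<inter> space (PL B)"
    proof (intro subsetI IntI vimageI2)
      fix x assume x: "x \<in> Pi\<^sub>E B (\<lambda>_. {-r..r})"
      have "norm (comb x) \<le> (\<Sum>e\<in>B. norm (x e *\<^sub>R T e))" by (rule norm_sum)
      also have "\<dots> \<le> (\<Sum>e\<in>B. r * norm (T e))"
        using x by (intro sum_mono) (auto intro!: mult_right_mono simp: PiE_def Pi_def abs_le_iff minus_le_iff)
      also have "\<dots> = r * (\<Sum>e\<in>B. norm (T e))" by (simp add: sum_distrib_left)
      also have "\<dots> \<le> R" using s assms by (simp add: r_def field_simps)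
      finally show "comb x \<in> cball 0 R" by simp
      show "x \<in> space (PL B)" using x by (simp add: space_PiM PiE_def)
    qed
  qed measurable
  also have "\<dots> = emeasure M (cball 0 R)" unfolding frame_leb_def by (subst emeasure_distr) auto
  finally show ?thesis .
qed

sublocale sigma_finite_measure M
proof
  show "\<exists>A. countable A \<and> A \<subseteq> sets M \<and> \<Union> A = space M \<and> (\<forall>a\<in>A. emeasure M a \<noteq> \<infinity>)"
    using emeasure_cball_finite
    by (intro exI[of _ "range (\<lambda>n :: nat. cball 0 (real n))"])
       (auto simp: less_top real_arch_simple)
qed

end

text \<open>The Fubini argument for the uniqueness of Haar measure.\<close>

lemma frame_leb_proportional:
  fixes T :: "'i \<Rightarrow> 'a::{real_inner,second_countable_topology}" and T' :: "'j \<Rightarrow> 'a"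
  assumes "frame B T d" "frame B' T' d'" and sp: "span (T ` B) = span (T' ` B')"
  shows "\<exists>c>0. \<forall>g\<in>borel_measurable borel.
    (\<integral>\<^sup>+y. g y \<partial>frame_leb B T) = ennreal c * (\<integral>\<^sup>+y. g y \<partial>frame_leb B' T')"
proof -
  interpret M: frame B T d by fact
  interpret N: frame B' T' d' by fact
  interpret P: pair_sigma_finite M.M N.M by standard
  \<comment> \<open>The unit ball has finite positive mass for both measures, which permits the
    final division, and it is symmetric, which is used when the argument \<open>x - y\<close> is
    reversed.\<close>
  let ?f = "indicator (cball 0 1) :: 'a \<Rightarrow> ennreal"
  have [measurable]: "?f \<in> borel_measurable borel"
    by (intro borel_measurable_indicator borel_closed closed_cball)
  have f_neg: "?f (x - y) = ?f (y - x)" for x y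
    by (simp add: indicator_def norm_minus_commute)
  have key: "(\<integral>\<^sup>+x. ?f x \<partial>M.M) * (\<integral>\<^sup>+y. g y \<partial>N.M) = (\<integral>\<^sup>+x. g x \<partial>M.M) * (\<integral>\<^sup>+y. ?f y \<partial>N.M)"
    if [measurable]: "g \<in> borel_measurable borel" for g
  proof -
    have "(\<integral>\<^sup>+x. ?f x \<partial>M.M) * (\<integral>\<^sup>+y. g y \<partial>N.M) = (\<integral>\<^sup>+x. ?f x * (\<integral>\<^sup>+y. g y \<partial>N.M) \<partial>M.M)"
      by (rule nn_integral_multc[symmetric]) simp
    also have "\<dots> = (\<integral>\<^sup>+x. (\<integral>\<^sup>+y. ?f x * g (y + x) \<partial>N.M) \<partial>M.M)"
      using M.AE_in_S by (intro nn_integral_cong_AE)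
        (auto simp: sp N.nn_integral_translate nn_integral_cmult elim!: eventually_mono)
    also have "\<dots> = (\<integral>\<^sup>+y. (\<integral>\<^sup>+x. ?f x * g (y + x) \<partial>M.M) \<partial>N.M)"
      by (rule P.Fubini'[symmetric]) measurable
    also have "\<dots> = (\<integral>\<^sup>+y. (\<integral>\<^sup>+x. ?f (x - y) * g x \<partial>M.M) \<partial>N.M)"
    proof (rule nn_integral_cong_AE, rule eventually_mono[OF N.AE_in_S])
      fix y assume "y \<in> N.S"
      then have "- y \<in> M.S" by (simp add: sp span_neg)
      from M.nn_integral_translate[OF _ this, of "\<lambda>x. ?f x * g (y + x)"]
      show "(\<integral>\<^sup>+x. ?f x * g (y + x) \<partial>M.M) = (\<integral>\<^sup>+x. ?f (x - y) * g x \<partial>M.M)"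
        by simp
    qed
    also have "\<dots> = (\<integral>\<^sup>+x. (\<integral>\<^sup>+y. ?f (x - y) * g x \<partial>N.M) \<partial>M.M)"
      by (rule P.Fubini') measurable
    also have "\<dots> = (\<integral>\<^sup>+x. (\<integral>\<^sup>+y. ?f y \<partial>N.M) * g x \<partial>M.M)"
    proof (rule nn_integral_cong_AE, rule eventually_mono[OF M.AE_in_S])
      fix x assume "x \<in> M.S"
      then have "- x \<in> N.S" by (simp add: sp span_neg)
      from N.nn_integral_translate[OF _ this, of ?f]
      have "(\<integral>\<^sup>+y. ?f (x - y) \<partial>N.M) = (\<integral>\<^sup>+y. ?f y \<partial>N.M)" by (simp add: f_neg[of x])
      then show "(\<integral>\<^sup>+y. ?f (x - y) * g x \<partial>N.M) = (\<integral>\<^sup>+y. ?f y \<partial>N.M) * g x"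
        by (simp add: nn_integral_multc)
    qed
    also have "\<dots> = (\<integral>\<^sup>+x. g x \<partial>M.M) * (\<integral>\<^sup>+y. ?f y \<partial>N.M)"
      by (subst mult.commute) (simp add: nn_integral_multc del: nn_integral_indicator)
    finally show ?thesis .
  qed
  have fin: "(\<integral>\<^sup>+x. ?f x \<partial>M.M) < \<infinity>" "(\<integral>\<^sup>+x. ?f x \<partial>N.M) < \<infinity>"
    using M.emeasure_cball_finite N.emeasure_cball_finite by auto
  have pos: "(\<integral>\<^sup>+x. ?f x \<partial>M.M) > 0" "(\<integral>\<^sup>+x. ?f x \<partial>N.M) > 0"
    using M.emeasure_cball_pos[of 1] N.emeasure_cball_pos[of 1] by auto
  obtain a where a: "(\<integral>\<^sup>+x. ?f x \<partial>M.M) = ennreal a" "a > 0"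
    using fin(1) pos(1) by (cases "\<integral>\<^sup>+x. ?f x \<partial>M.M") auto
  obtain b where b: "(\<integral>\<^sup>+x. ?f x \<partial>N.M) = ennreal b" "b > 0"
    using fin(2) pos(2) by (cases "\<integral>\<^sup>+x. ?f x \<partial>N.M") auto
  have "(\<integral>\<^sup>+y. g y \<partial>M.M) = ennreal (a / b) * (\<integral>\<^sup>+y. g y \<partial>N.M)" if "g \<in> borel_measurable borel" for g
  proof -
    have "ennreal (a / b) * (\<integral>\<^sup>+y. g y \<partial>N.M) = ennreal (1 / b) * (ennreal a * (\<integral>\<^sup>+y. g y \<partial>N.M))"
      using a b by (simp add: mult.assoc[symmetric] ennreal_mult[symmetric])
    also have "\<dots> = ennreal (1 / b) * (ennreal b * (\<integral>\<^sup>+y. g y \<partial>M.M))"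
      using key[OF that] unfolding a(1) b(1) by (simp add: mult.commute)
    also have "\<dots> = (\<integral>\<^sup>+y. g y \<partial>M.M)"
      using b by (simp add: mult.assoc[symmetric] ennreal_mult[symmetric])
    finally show ?thesis by simp
  qed
  then show ?thesis using a(2) b(2) by (intro exI[of _ "a / b"]) auto
qed

section \<open>Fubini and polar coordinates for orthonormal bases\<close>

abbreviation leb_on :: "'a set \<Rightarrow> 'a::{real_inner,second_countable_topology} measure" where
  "leb_on B \<equiv> frame_leb B (\<lambda>e. e)"

lemma orthonormal_frame: "orthonormal B \<Longrightarrow> frame B (\<lambda>e. e) (\<lambda>e. e)"
  by unfold_locales (auto simp: orthonormal_def)

lemma nn_integral_leb_on_Un:
  assumes B: "finite B" "finite B'" "B \<inter> B' = {}" and [measurable]: "H \<in> borel_measurable borel"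
  shows "(\<integral>\<^sup>+y. H y \<partial>leb_on (B \<union> B')) = (\<integral>\<^sup>+u. (\<integral>\<^sup>+w. H (u + w) \<partial>leb_on B') \<partial>leb_on B)"
proof -
  let ?s = "\<lambda>B x. \<Sum>e\<in>B. x e *\<^sub>R e"
  have eq: "?s (B \<union> B') (merge B B' (x, y)) = ?s B x + ?s B' y" for x y
  proof -
    have "?s (B \<union> B') (merge B B' (x, y)) = ?s B (merge B B' (x, y)) + ?s B' (merge B B' (x, y))"
      using B by (intro sum.union_disjoint) auto
    also have "?s B (merge B B' (x, y)) = ?s B x" by (intro sum.cong) (auto simp: merge_def)
    also have "?s B' (merge B B' (x, y)) = ?s B' y" using B by (intro sum.cong) (auto simp: merge_def)
    finally show ?thesis .
  qed
  interpret B': sigma_finite_measure "PL B'" by (rule PL.sigma_finite) fact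
  have "(\<integral>\<^sup>+y. H y \<partial>leb_on (B \<union> B')) = (\<integral>\<^sup>+x. H (?s (B \<union> B') x) \<partial>PL (B \<union> B'))"
    by (simp add: nn_integral_frame_leb)
  also have "\<dots> = (\<integral>\<^sup>+x. (\<integral>\<^sup>+y. H (?s B x + ?s B' y) \<partial>PL B') \<partial>PL B)"
    by (subst PL.product_nn_integral_fold[OF B(3,1,2)]) (simp_all only: eq, measurable)
  also have "\<dots> = (\<integral>\<^sup>+x. (\<integral>\<^sup>+w. H (?s B x + w) \<partial>leb_on B') \<partial>PL B)"
    by (simp add: nn_integral_frame_leb)
  also have "\<dots> = (\<integral>\<^sup>+u. (\<integral>\<^sup>+w. H (u + w) \<partial>leb_on B') \<partial>leb_on B)"
  proof (rule nn_integral_frame_leb[symmetric])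
    have "(\<lambda>u. \<integral>\<^sup>+w. H (u + w) \<partial>leb_on B') = (\<lambda>u. \<integral>\<^sup>+y. H (u + ?s B' y) \<partial>PL B')"
      by (simp add: nn_integral_frame_leb)
    moreover have "(\<lambda>u. \<integral>\<^sup>+y. H (u + ?s B' y) \<partial>PL B') \<in> borel_measurable borel" by measurable
    ultimately show "(\<lambda>u. \<integral>\<^sup>+w. H (u + w) \<partial>leb_on B') \<in> borel_measurable borel" by simp
  qed
  finally show ?thesis .
qed

text \<open>Scaling shows that a ball of radius \<open>R\<close> has measure
  \<open>a * R ^ card B\<close>, where \<open>a\<close> is that of the unit ball. These values
  determine the law of the norm, and differentiating them gives its density.\<close>

lemma nn_integral_leb_on_norm:
  assumes B: "orthonormal B" and ne: "B \<noteq> {}"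
  shows "\<exists>\<kappa>>0. \<forall>h\<in>borel_measurable borel. (\<integral>\<^sup>+w. h (norm w) \<partial>leb_on B) =
    (\<integral>\<^sup>+r. h r * ennreal (\<kappa> * r ^ (card B - 1)) * indicator {0..} r \<partial>lborel)"
proof -
  interpret frame B "\<lambda>e. e" "\<lambda>e. e" by (rule orthonormal_frame[OF B])
  have l: "card B > 0" using B ne by (simp add: orthonormal_def card_gt_0_iff)
  obtain a where a: "emeasure M (cball 0 1) = ennreal a" "a > 0"
    using emeasure_cball_finite[of 1] emeasure_cball_pos[of 1] by (cases "emeasure M (cball 0 1)") auto
  have scale: "emeasure M (cball 0 R) = ennreal (s ^ card B) * emeasure M (cball 0 (R / s))"
    if "s > 0" for s R
  proof -
    have "(\<integral>\<^sup>+y. indicator (cball 0 R) y \<partial>M) = ennreal (s ^ card B) * (\<integral>\<^sup>+y. indicator (cball 0 R) (s *\<^sub>R y + 0) \<partial>M)"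
      using that by (intro nn_integral_affine borel_measurable_indicator borel_closed) (auto simp: span_0)
    also have "(\<integral>\<^sup>+y. indicator (cball 0 R) (s *\<^sub>R y + 0) \<partial>M) = (\<integral>\<^sup>+y. indicator (cball 0 (R / s)) y \<partial>M)"
      using that by (intro nn_integral_cong) (auto simp: indicator_def field_simps)
    finally show ?thesis by simp
  qed
  have ball: "emeasure M (cball 0 R) = ennreal (a * R ^ card B)" if R: "R \<ge> 0" for R
  proof (cases "R = 0")
    case False
    then show ?thesis using scale[of R R] R a by (simp add: ennreal_mult[symmetric] mult.commute)
  next
    case True
    obtain x where x: "emeasure M {0} = ennreal x" "x \<ge> 0"
      using emeasure_cball_finite[of 0] by (cases "emeasure M {0}") auto
    \<comment> \<open>Doubling fixes the origin but multiplies measures by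
      \<open>2 ^ card B > 1\<close>, so the origin is a null set.\<close>
    have "ennreal x = ennreal (2 ^ card B * x)"
      using scale[of 2 0] x by (simp add: ennreal_mult)
    then have "x = 2 ^ card B * x" using x by simp
    moreover have "(2 :: real) ^ card B > 1" using l by simp
    ultimately have "x = 0" by auto
    then show ?thesis using True x l by (simp add: zero_power)
  qed
  \<comment> \<open>The area of the unit sphere: the derivative of \<open>a * R ^ card B\<close> at
    \<open>R = 1\<close>.\<close>
  define \<kappa> where "\<kappa> = a * card B"
  have \<kappa>: "\<kappa> > 0" using a l by (simp add: \<kappa>_def)
  let ?D = "density lborel (\<lambda>r. ennreal (\<kappa> * r ^ (card B - 1)) * indicator {0..} r)"
  have "distr M borel norm = ?D"
  proof (rule measure_eqI_generator_eq[where E = "range (\<lambda>a. {..a :: real})" and \<Omega> = UNIV and A = "\<lambda>i. {..real i}"])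
    show "Int_stable (range (\<lambda>a. {..a :: real}))"
    proof (rule Int_stableI)
      fix x y assume "x \<in> range (\<lambda>a. {..a :: real})" "y \<in> range (\<lambda>a. {..a :: real})"
      then obtain u v where "x = {..u}" "y = {..v}" by blast
      then have "x \<inter> y = {..min u v}" by auto
      then show "x \<inter> y \<in> range (\<lambda>a. {..a :: real})" by blast
    qed
    show "sets (distr M borel norm) = sigma_sets UNIV (range (\<lambda>a. {..a :: real}))"
      "sets ?D = sigma_sets UNIV (range (\<lambda>a. {..a :: real}))"
      by (simp_all add: borel_eq_atMost)
    have e1: "emeasure (distr M borel norm) {..R} = (if R < 0 then 0 else ennreal (a * R ^ card B))" for R
    proof -
      have "norm -` {..R} \<inter> space M = cball (0 :: 'a) R" by auto
      then show ?thesis using ball[of R] by (auto simp: emeasure_distr)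
    qed
    have e2: "emeasure ?D {..R} = (if R < 0 then 0 else ennreal (a * R ^ card B))" for R
    proof -
      have "emeasure ?D {..R} = (\<integral>\<^sup>+r. ennreal (\<kappa> * r ^ (card B - 1)) * indicator {0..R} r \<partial>lborel)"
        by (subst emeasure_density) (auto intro!: nn_integral_cong simp: indicator_def)
      also have "\<dots> = (if R < 0 then 0 else ennreal (a * R ^ card B))"
      proof (cases "R < 0")
        case False
        have "(\<integral>\<^sup>+r. ennreal (\<kappa> * r ^ (card B - 1)) * indicator {0..R} r \<partial>lborel)
            = ennreal (a * R ^ card B - a * 0 ^ card B)"
          using False a \<kappa>
          by (intro nn_integral_FTC_Icc) (auto intro!: derivative_eq_intros simp: \<kappa>_def)
        then show ?thesis using False l by (simp add: zero_power)
      qed simp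
      finally show ?thesis .
    qed
    show "emeasure (distr M borel norm) X = emeasure ?D X" if "X \<in> range (\<lambda>a. {..a :: real})" for X
      using that e1 e2 by auto
    show "range (\<lambda>i. {..real i}) \<subseteq> range (\<lambda>a. {..a})" by auto
    show "(\<Union>i. {..real i}) = UNIV" using real_arch_simple by (auto simp: set_eq_iff)
    show "emeasure (distr M borel norm) {..real i} \<noteq> \<infinity>" for i using e1[of "real i"] by simp
  qed simp
  then have "(\<integral>\<^sup>+w. h (norm w) \<partial>M) =
      (\<integral>\<^sup>+r. h r * ennreal (\<kappa> * r ^ (card B - 1)) * indicator {0..} r \<partial>lborel)"
    if "h \<in> borel_measurable borel" for h
    using that nn_integral_distr[of norm M borel h]
    by (simp add: nn_integral_density mult.commute mult.left_commute)
  then show ?thesis using \<kappa> by blast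
qed

section \<open>Projections of the uniform distribution on a sphere\<close>

text \<open>The substitution \<open>s = sqrt (a\<^sup>2 + r\<^sup>2)\<close>, for which
  \<open>r dr = s ds\<close>, uses up one of the \<open>l - 1\<close> factors \<open>r\<close>. The
  assumption \<open>l \<ge> 3\<close> keeps the remaining exponent \<open>l - 2\<close> positive, so
  that the truncated root annihilates the range \<open>s < a\<close>.\<close>

lemma nn_integral_radial_substitution:
  fixes h :: "real \<Rightarrow> ennreal"
  assumes h [measurable]: "h \<in> borel_measurable borel" and a: "a \<ge> 0" and l: "l \<ge> 3"
  shows "(\<integral>\<^sup>+r. h (sqrt (a\<^sup>2 + r\<^sup>2)) * indicator {..R} (sqrt (a\<^sup>2 + r\<^sup>2)) * ennreal (r ^ (l - 1)) * indicator {0..} r \<partial>lborel)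
    = (\<integral>\<^sup>+s. h s * ennreal (s * sqrt (max 0 (s\<^sup>2 - a\<^sup>2)) ^ (l - 2)) * indicator {0..R} s \<partial>lborel)"
    (is "(\<integral>\<^sup>+r. ?g r \<partial>lborel) = (\<integral>\<^sup>+s. ?F s \<partial>lborel)")
proof (cases "a < R")
  case False
  have "(\<integral>\<^sup>+r. ?g r \<partial>lborel)
      = (\<integral>\<^sup>+r. 0 \<partial>(lborel :: real measure))"
  proof (rule nn_integral_cong)
    fix r :: real
    show "?g r = 0"
    proof (cases "r > 0")
      case True
      have "sqrt (a\<^sup>2) < sqrt (a\<^sup>2 + r\<^sup>2)" using True by (subst real_sqrt_less_iff) simp
      then have "R < sqrt (a\<^sup>2 + r\<^sup>2)" using False a by simp
      then show ?thesis by simp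
    next
      case False
      then show ?thesis using l by (cases "r = 0") (auto simp: zero_power)
    qed
  qed
  also have "\<dots> = (\<integral>\<^sup>+s. ?F s \<partial>lborel)"
  proof (rule nn_integral_cong)
    fix s :: real
    show "0 = ?F s"
    proof (cases "s \<in> {0..R}")
      case True
      then have "s\<^sup>2 \<le> a\<^sup>2" using False by (intro power_mono) auto
      then show ?thesis using l by (simp add: max_absorb1 zero_power)
    qed simp
  qed
  finally show ?thesis .
next
  case True
  show ?thesis
  \<comment> \<open>For \<open>a = 0\<close> the integrands agree pointwise. This case is separate
    because the derivative \<open>r / g r\<close> of the substitution requires
    \<open>g 0 = a\<close> to be nonzero.\<close>
  proof (cases "a = 0")
    case True
    show ?thesis
    proof (rule nn_integral_cong)
      fix r :: real
      show "?g r
        = ?F r"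
        using True l power_Suc[of r "l - 2"] by (auto simp: indicator_def numeral_eq_Suc Suc_diff_Suc)
    qed
  next
    case False
    then have a0: "a > 0" using a by simp
    define b where "b = sqrt (R\<^sup>2 - a\<^sup>2)"
    have Ra: "R\<^sup>2 > a\<^sup>2" using \<open>a < R\<close> a by (intro power_strict_mono) auto
    then have b: "b > 0" "b\<^sup>2 = R\<^sup>2 - a\<^sup>2" by (auto simp: b_def)
    define g where "g = (\<lambda>r. sqrt (a\<^sup>2 + r\<^sup>2))"
    have gpos: "g r > 0" for r using a0 by (simp add: g_def add_pos_nonneg)
    have g0b: "g 0 = a" "g b = R" using a0 True b by (simp_all add: g_def)
    let ?f = "\<lambda>s. h s * ennreal (s * sqrt (max 0 (s\<^sup>2 - a\<^sup>2)) ^ (l - 2))"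
    have le_iff: "g r \<le> R \<longleftrightarrow> r \<le> b" if "r \<ge> 0" for r
    proof -
      have "g r \<le> R \<longleftrightarrow> sqrt (a\<^sup>2 + r\<^sup>2) \<le> sqrt (R\<^sup>2)" using True a by (simp add: g_def)
      also have "\<dots> \<longleftrightarrow> r\<^sup>2 \<le> b\<^sup>2" using b by (simp only: real_sqrt_le_iff) auto
      also have "\<dots> \<longleftrightarrow> r \<le> b" using that b(1) by (simp add: power2_le_iff_abs_le)
      finally show ?thesis .
    qed
    have "(\<integral>\<^sup>+s. ?f s * indicator {0..R} s \<partial>lborel) = (\<integral>\<^sup>+s. ?f s * indicator {g 0..g b} s \<partial>lborel)"
    proof (rule nn_integral_cong)
      fix s :: real
      have "?f s = 0" if "0 \<le> s" "s < a"
      proof -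
        have "s\<^sup>2 \<le> a\<^sup>2" using that by (intro power_mono) auto
        then show ?thesis using l by (simp add: max_absorb1 zero_power)
      qed
      then show "?f s * indicator {0..R} s = ?f s * indicator {g 0..g b} s"
        using a0 unfolding g0b by (auto simp: indicator_def)
    qed
    also have "\<dots> = (\<integral>\<^sup>+r. ?f (g r) * ennreal (r / g r) * indicator {0..b} r \<partial>lborel)"
    proof (rule nn_integral_substitution_aux[OF _ _ _ _ _ b(1)])
      show "?f \<in> borel_measurable borel" by measurable
      show "(g has_real_derivative r / g r) (at r)" for r
        unfolding g_def using gpos[of r, unfolded g_def]
        by (auto intro!: derivative_eq_intros simp: field_simps)
      show "continuous_on {0..b} (\<lambda>r. r / g r)"
      proof (intro continuous_intros ballI)
        show "continuous_on {0..b} g" unfolding g_def by (intro continuous_intros)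
        show "g r \<noteq> 0" for r using gpos[of r] by simp
      qed
      show "0 \<le> r / g r" if "r \<in> {0..b}" for r using gpos[of r] that by simp
    qed simp
    also have "\<dots> = (\<integral>\<^sup>+r. ?g r \<partial>lborel)"
    proof (rule nn_integral_cong)
      fix r :: real
      show "?f (g r) * ennreal (r / g r) * indicator {0..b} r =
        ?g r"
      proof (cases "r \<ge> 0")
        case True
        have "(g r)\<^sup>2 - a\<^sup>2 = r\<^sup>2" by (simp add: g_def)
        then have "g r * sqrt (max 0 ((g r)\<^sup>2 - a\<^sup>2)) ^ (l - 2) * (r / g r) = r * r ^ (l - 2)"
          using True gpos[of r] by (simp add: field_simps)
        also have "\<dots> = r ^ (l - 1)" using l by (simp add: power_Suc[symmetric] numeral_eq_Suc Suc_diff_Suc del: power_Suc)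
        finally have "ennreal (g r * sqrt (max 0 ((g r)\<^sup>2 - a\<^sup>2)) ^ (l - 2)) * ennreal (r / g r) = ennreal (r ^ (l - 1))"
          using True gpos[of r] by (subst ennreal_mult[symmetric]) auto
        then have "?f (g r) * ennreal (r / g r) = h (g r) * ennreal (r ^ (l - 1))"
          by (simp add: mult.assoc)
        moreover have "indicator {0..b} r = (indicator {..R} (g r) :: ennreal)"
          using le_iff[OF True] True by (simp add: indicator_def)
        ultimately show ?thesis using True by (simp add: g_def mult_ac)
      qed simp
    qed
    finally show ?thesis by simp
  qed
qed

text \<open>The generalization of Archimedes' theorem on the sphere and the cylinder, stated for
  cones. A point of the ball is split as \<open>u + w\<close> along \<open>B\<close> and
  \<open>B'\<close>, the part \<open>w\<close> is put in polar coordinates, and its radius is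
  replaced by the total norm \<open>s\<close>. After exchanging the integrals, the scaling
  \<open>u = (s / R) x\<close> separates \<open>s\<close> from \<open>x\<close>. Polar coordinates
  leave the exponent \<open>card B' - 1\<close>, and the change of radius lowers it by one
  more.\<close>

lemma nn_integral_sphere_projection:
  fixes B B' :: "'a::{real_inner,second_countable_topology} set"
  assumes on: "orthonormal (B \<union> B')" and disj: "B \<inter> B' = {}" and l: "card B' \<ge> 3" and R: "R > 0"
  shows "\<exists>c>0. \<forall>F\<in>borel_measurable borel.
    (\<integral>\<^sup>+y. F ((R / norm y) *\<^sub>R (\<Sum>e\<in>B. inner y e *\<^sub>R e)) * indicator (cball 0 R - {0}) y
        \<partial>leb_on (B \<union> B'))
    = ennreal c * (\<integral>\<^sup>+x. F x * ennreal (sqrt (max 0 (R\<^sup>2 - (norm x)\<^sup>2)) ^ (card B' - 2)) \<partial>leb_on B)"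
proof -
  define l where "l = card B'"
  let ?w = "\<lambda>x :: 'a. ennreal (sqrt (max 0 (R\<^sup>2 - (norm x)\<^sup>2)) ^ (l - 2))"
  let ?v = "\<lambda>(u :: 'a) s. ennreal (s * sqrt (max 0 (s\<^sup>2 - (norm u)\<^sup>2)) ^ (l - 2))"
  have l3: "l \<ge> 3" using l by (simp add: l_def)
  have B: "orthonormal B" "orthonormal B'" by (auto intro: orthonormal_subset[OF on])
  have fin: "finite B" "finite B'" using B by (auto simp: orthonormal_def)
  have "B' \<noteq> {}" using l by auto
  then obtain \<kappa> where \<kappa>: "\<kappa> > 0" "\<And>h. h \<in> borel_measurable borel \<Longrightarrow>
    (\<integral>\<^sup>+w. h (norm w) \<partial>leb_on B') = (\<integral>\<^sup>+r. h r * ennreal (\<kappa> * r ^ (l - 1)) * indicator {0..} r \<partial>lborel)"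
    using nn_integral_leb_on_norm[OF B(2)] unfolding l_def by blast
  interpret B: frame B "\<lambda>e. e" "\<lambda>e. e" by (rule orthonormal_frame[OF B(1)])
  interpret B': frame B' "\<lambda>e. e" "\<lambda>e. e" by (rule orthonormal_frame[OF B(2)])
  interpret P: pair_sigma_finite B.M lborel by standard
  \<comment> \<open>The total power of \<open>s / R\<close>: \<open>card B\<close> from scaling
    Lebesgue measure on \<open>span B\<close>, and \<open>l - 2\<close> from the homogeneity of the
    weight.\<close>
  define m where "m = card B + l - 2"
  have m: "m \<ge> 1" using l3 by (simp add: m_def)
  \<comment> \<open>The polar constant \<open>\<kappa>\<close> times the integral of
    \<open>s * (s / R) ^ m\<close> over \<open>{0..R}\<close>.\<close>
  define c where "c = \<kappa> * (R\<^sup>2 / (m + 2))"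
  have c: "c > 0" using \<kappa> R by (simp add: c_def)
  have orth: "inner u w = 0" if "u \<in> span B" "w \<in> span B'" for u w
  proof -
    have "orthogonal e' e" if "e \<in> B" "e' \<in> B'" for e e'
      using on disj that by (auto simp: orthonormal_def orthogonal_def)
    then have "orthogonal e' u" if "e' \<in> B'" for e'
      using orthogonal_to_span[OF \<open>u \<in> span B\<close>] that by blast
    then have "orthogonal u w"
      using orthogonal_to_span[OF \<open>w \<in> span B'\<close>] orthogonal_commute by blast
    then show ?thesis by (simp add: orthogonal_def)
  qed
  have main: "(\<integral>\<^sup>+y. F ((R / norm y) *\<^sub>R (\<Sum>e\<in>B. inner y e *\<^sub>R e)) * indicator (cball 0 R - {0}) y
        \<partial>leb_on (B \<union> B'))
    = ennreal c * (\<integral>\<^sup>+x. F x * ?w x \<partial>leb_on B)"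
    if [measurable]: "F \<in> borel_measurable borel" for F
  proof -
    \<comment> \<open>On the ball the integrand depends on \<open>u + w\<close> only through
      \<open>u\<close> and the norm \<open>s\<close>; the indicator removes the apex of the
      cones.\<close>
    define H where "H = (\<lambda>u s. F ((R / s) *\<^sub>R u) * indicator {0<..} s)"
    have [measurable]: "case_prod H \<in> borel_measurable (borel \<Otimes>\<^sub>M borel)"
      "H u \<in> borel_measurable borel" for u
      unfolding H_def by measurable
    have ind: "indicator (cball 0 R - {0}) y = (indicator {0<..} (norm y) * indicator {..R} (norm y) :: ennreal)" for y :: 'a
      by (auto simp: indicator_def)
    have split: "F ((R / norm (u + w)) *\<^sub>R (\<Sum>e\<in>B. inner (u + w) e *\<^sub>R e)) * indicator (cball 0 R - {0}) (u + w)
      = H u (sqrt ((norm u)\<^sup>2 + (norm w)\<^sup>2)) * indicator {..R} (sqrt ((norm u)\<^sup>2 + (norm w)\<^sup>2))"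
      if u: "u \<in> span B" and w: "w \<in> span B'" for u w
    proof -
      have "(\<Sum>e\<in>B. inner (u + w) e *\<^sub>R e) = (\<Sum>e\<in>B. inner u e *\<^sub>R e)"
        using orth[OF span_base w] by (intro sum.cong) (auto simp: inner_add_right inner_commute)
      also have "\<dots> = u" by (rule orthonormal_expand[OF B(1) u])
      finally have 1: "(\<Sum>e\<in>B. inner (u + w) e *\<^sub>R e) = u" .
      have "(norm (u + w))\<^sup>2 = (norm u)\<^sup>2 + (norm w)\<^sup>2"
        using orth[OF u w] by (simp add: power2_norm_eq_inner inner_add_left inner_add_right inner_commute)
      then have "norm (u + w) = sqrt ((norm u)\<^sup>2 + (norm w)\<^sup>2)" by (metis norm_ge_zero real_sqrt_unique)
      then show ?thesis unfolding 1 ind H_def by (simp add: mult_ac)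
    qed
    have "(\<integral>\<^sup>+y. F ((R / norm y) *\<^sub>R (\<Sum>e\<in>B. inner y e *\<^sub>R e)) * indicator (cball 0 R - {0}) y \<partial>leb_on (B \<union> B'))
      = (\<integral>\<^sup>+u. (\<integral>\<^sup>+w. F ((R / norm (u + w)) *\<^sub>R (\<Sum>e\<in>B. inner (u + w) e *\<^sub>R e)) * indicator (cball 0 R - {0}) (u + w)
          \<partial>leb_on B') \<partial>leb_on B)"
      unfolding ind by (rule nn_integral_leb_on_Un[OF fin disj]) measurable
    also have "\<dots> = (\<integral>\<^sup>+u. (\<integral>\<^sup>+w. H u (sqrt ((norm u)\<^sup>2 + (norm w)\<^sup>2)) * indicator {..R} (sqrt ((norm u)\<^sup>2 + (norm w)\<^sup>2))
          \<partial>leb_on B') \<partial>leb_on B)"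
      using B.AE_in_S B'.AE_in_S
      by (intro nn_integral_cong_AE; elim eventually_mono; intro nn_integral_cong_AE; elim eventually_mono)
         (auto intro: split)
    also have "\<dots> = (\<integral>\<^sup>+u. ennreal \<kappa> * (\<integral>\<^sup>+s. H u s * ?v u s * indicator {0..R} s \<partial>lborel) \<partial>leb_on B)"
    proof (rule nn_integral_cong)
      fix u
      let ?h = "\<lambda>r. H u (sqrt ((norm u)\<^sup>2 + r\<^sup>2)) * indicator {..R} (sqrt ((norm u)\<^sup>2 + r\<^sup>2))"
      have "(\<integral>\<^sup>+w. ?h (norm w) \<partial>leb_on B') = (\<integral>\<^sup>+r. ?h r * ennreal (\<kappa> * r ^ (l - 1)) * indicator {0..} r \<partial>lborel)"
        by (rule \<kappa>(2)) measurable
      also have "\<dots> = (\<integral>\<^sup>+r. ennreal \<kappa> * (?h r * ennreal (r ^ (l - 1)) * indicator {0..} r) \<partial>lborel)"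
        using \<kappa>(1) by (intro nn_integral_cong) (auto simp: ennreal_mult' mult_ac)
      also have "\<dots> = ennreal \<kappa> * (\<integral>\<^sup>+r. ?h r * ennreal (r ^ (l - 1)) * indicator {0..} r \<partial>lborel)"
        by (rule nn_integral_cmult) measurable
      finally show "(\<integral>\<^sup>+w. ?h (norm w) \<partial>leb_on B') =
        ennreal \<kappa> * (\<integral>\<^sup>+s. H u s * ?v u s * indicator {0..R} s \<partial>lborel)"
        by (subst (asm) nn_integral_radial_substitution[of "H u", OF _ _ l3]) simp_all
    qed
    also have "\<dots> = ennreal \<kappa> * (\<integral>\<^sup>+u. (\<integral>\<^sup>+s. H u s * ?v u s * indicator {0..R} s \<partial>lborel) \<partial>leb_on B)"
      by (rule nn_integral_cmult) measurable
    also have "(\<integral>\<^sup>+u. (\<integral>\<^sup>+s. H u s * ?v u s * indicator {0..R} s \<partial>lborel) \<partial>leb_on B)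
      = (\<integral>\<^sup>+s. (\<integral>\<^sup>+u. H u s * ?v u s * indicator {0..R} s \<partial>leb_on B) \<partial>lborel)"
      by (rule P.Fubini'[symmetric]) measurable
    also have "\<dots> = (\<integral>\<^sup>+s. ennreal (s * (s / R) ^ m) * indicator {0..R} s *
        (\<integral>\<^sup>+x. F x * ?w x \<partial>leb_on B) \<partial>lborel)"
    proof (rule nn_integral_cong)
      fix s :: real
      show "(\<integral>\<^sup>+u. H u s * ?v u s * indicator {0..R} s \<partial>leb_on B)
        = ennreal (s * (s / R) ^ m) * indicator {0..R} s *
          (\<integral>\<^sup>+x. F x * ?w x \<partial>leb_on B)"
      proof (cases "0 < s \<and> s \<le> R")
        case False
        then show ?thesis by (cases "s = 0") (auto simp: indicator_def)
      next
        case True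
        then have s: "s > 0" "s / R > 0" using R by auto
        have "(\<integral>\<^sup>+u. H u s * ?v u s * indicator {0..R} s \<partial>leb_on B)
          = (\<integral>\<^sup>+u. F ((R / s) *\<^sub>R u) * ?v u s \<partial>leb_on B)"
          using True by (intro nn_integral_cong) (simp add: H_def)
        \<comment> \<open>With \<open>u = (s / R) x\<close> the argument of \<open>F\<close> becomes
          \<open>x\<close>, and the weight becomes a power of \<open>s\<close> times a function of
          \<open>x\<close> alone.\<close>
        also have "\<dots> = ennreal ((s / R) ^ card B) * (\<integral>\<^sup>+x. F ((R / s) *\<^sub>R ((s / R) *\<^sub>R x + 0)) *
            ?v ((s / R) *\<^sub>R x + 0) s \<partial>leb_on B)"
          by (rule B.nn_integral_affine[OF _ s(2)]) (auto simp: span_0)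
        also have "(\<integral>\<^sup>+x. F ((R / s) *\<^sub>R ((s / R) *\<^sub>R x + 0)) *
            ?v ((s / R) *\<^sub>R x + 0) s \<partial>leb_on B)
          = (\<integral>\<^sup>+x. ennreal (s * (s / R) ^ (l - 2)) * (F x * ?w x) \<partial>leb_on B)"
        proof (rule nn_integral_cong)
          fix x :: 'a
          have "max 0 (s\<^sup>2 - (norm ((s / R) *\<^sub>R x))\<^sup>2) = (s / R)\<^sup>2 * max 0 (R\<^sup>2 - (norm x)\<^sup>2)"
          proof -
            have "s\<^sup>2 - (norm ((s / R) *\<^sub>R x))\<^sup>2 = (s / R)\<^sup>2 * (R\<^sup>2 - (norm x)\<^sup>2)"
              using R by (simp add: power_mult_distrib power_divide field_simps)
            then show ?thesis by (simp add: max_mult_distrib_left)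
          qed
          then have "sqrt (max 0 (s\<^sup>2 - (norm ((s / R) *\<^sub>R x))\<^sup>2)) = (s / R) * sqrt (max 0 (R\<^sup>2 - (norm x)\<^sup>2))"
            using s R by (simp add: real_sqrt_mult)
          then have "?v ((s / R) *\<^sub>R x + 0) s
            = ennreal (s * (s / R) ^ (l - 2)) * ?w x"
            using s R by (subst ennreal_mult[symmetric]) (auto simp: power_mult_distrib power_divide)
          moreover have "(R / s) *\<^sub>R ((s / R) *\<^sub>R x + 0) = x" using s R by simp
          ultimately show "F ((R / s) *\<^sub>R ((s / R) *\<^sub>R x + 0)) *
              ?v ((s / R) *\<^sub>R x + 0) s
            = ennreal (s * (s / R) ^ (l - 2)) * (F x * ?w x)"
            by (simp only:) (simp only: mult_ac)
        qed
        also have "\<dots> = ennreal (s * (s / R) ^ (l - 2)) * (\<integral>\<^sup>+x. F x * ?w x \<partial>leb_on B)"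
          by (rule nn_integral_cmult) measurable
        also have "ennreal ((s / R) ^ card B) * (ennreal (s * (s / R) ^ (l - 2)) * (\<integral>\<^sup>+x. F x * ?w x \<partial>leb_on B))
          = ennreal (s * (s / R) ^ m) * (\<integral>\<^sup>+x. F x * ?w x \<partial>leb_on B)"
        proof -
          have "m = card B + (l - 2)" using l3 by (simp add: m_def)
          then have "(s / R) ^ card B * (s * (s / R) ^ (l - 2)) = s * (s / R) ^ m" by (simp add: power_add)
          then have "ennreal ((s / R) ^ card B) * ennreal (s * (s / R) ^ (l - 2)) = ennreal (s * (s / R) ^ m)"
            using s by (subst ennreal_mult[symmetric]) auto
          then show ?thesis by (simp only: mult.assoc[symmetric])
        qed
        finally show ?thesis using True by simp
      qed
    qed
    also have "\<dots> = (\<integral>\<^sup>+s. ennreal (s * (s / R) ^ m) * indicator {0..R} s \<partial>lborel) *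
        (\<integral>\<^sup>+x. F x * ?w x \<partial>leb_on B)"
      by (rule nn_integral_multc) measurable
    also have "(\<integral>\<^sup>+s. ennreal (s * (s / R) ^ m) * indicator {0..R} s \<partial>lborel) = ennreal (R\<^sup>2 / (m + 2))"
    proof -
      let ?G = "\<lambda>s. s ^ (m + 2) / (R ^ m * (m + 2))"
      have "(\<integral>\<^sup>+s. ennreal (s * (s / R) ^ m) * indicator {0..R} s \<partial>lborel) = ennreal (?G R - ?G 0)"
      proof (rule nn_integral_FTC_Icc)
        show "(?G has_real_derivative s * (s / R) ^ m) (at s)" if "s \<in> {0..R}" for s
        proof -
          have "(?G has_real_derivative (real (m + 2) * s ^ (m + 1)) / (R ^ m * (m + 2))) (at s)"
            using DERIV_cdivide[OF DERIV_pow[of "m + 2" s UNIV], of "R ^ m * (m + 2)"]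
            by (simp del: of_nat_add of_nat_Suc)
          also have "(real (m + 2) * s ^ (m + 1)) / (R ^ m * (m + 2)) = s * (s / R) ^ m"
            using R by (simp add: power_divide field_simps del: of_nat_add of_nat_Suc)
          finally show ?thesis .
        qed
      qed (use R in auto)
      also have "?G R - ?G 0 = R\<^sup>2 / (m + 2)" using R by (simp add: power2_eq_square)
      finally show ?thesis .
    qed
    finally show ?thesis
      using \<kappa>(1) by (simp add: c_def ennreal_mult mult.assoc del: times_divide_eq_right)
  qed
  then show ?thesis using c unfolding l_def by blast
qed

text \<open>By \<open>fiber_frame\<close>, \<open>u \<mapsto> orth_proj V (foot A + u)\<close> is an
  affine isomorphism of \<open>span B\<close> onto \<open>V\<close>, so it carries Lebesgue measure
  to a multiple of Lebesgue measure, and it turns the squared norm of \<open>foot A + u\<close> into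
  \<open>minsq\<close>. The weight \<open>w\<close> is left free: a truncated power on the sphere,
  an exponential for the Gaussian. Measurability is stated after composing with
  \<open>orth_proj V\<close>, since \<open>minsq\<close> is controlled only on
  \<open>V\<close>.\<close>

lemma fiber_integral:
  fixes A V :: "'a::{real_inner,polish_space} set"
  assumes A: "affine A" "closed A" "A \<noteq> {}" and E: "orthonormal E" "span E = V"
    and onto: "orth_proj V ` A = V"
  obtains B c where "c > 0" "orthonormal B" "span B \<subseteq> direction A" "card B \<le> card E"
    "span B = orth_proj (direction A) ` V"
    "\<forall>w\<in>direction A. (\<forall>e\<in>B. inner w e = 0) \<longrightarrow> orth_proj V w = 0"
    "\<forall>F\<in>borel_measurable borel. \<forall>w\<in>borel_measurable borel.
      (\<integral>\<^sup>+u. F (orth_proj V (foot A + u)) * w ((norm (foot A))\<^sup>2 + (norm u)\<^sup>2) \<partial>leb_on B)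
      = ennreal c * (\<integral>\<^sup>+v. F v * w (minsq A V v) \<partial>leb_on E)"
    "(\<lambda>v. minsq A V (orth_proj V v)) \<in> borel_measurable borel"
proof -
  let ?P = "orth_proj V" and ?p = "foot A"
  obtain B t where B: "orthonormal B" "span B \<subseteq> direction A" "card B \<le> card E"
    and t: "\<forall>e\<in>B. t e \<in> V \<and> orth_proj (direction A) (t e) = e"
    and dual: "\<forall>e\<in>B. \<forall>e'\<in>B. inner (t e) (?P e') = (if e = e' then 1 else 0)"
    and sp: "span (?P ` B) = V"
    and ker: "\<forall>w\<in>direction A. (\<forall>e\<in>B. inner w e = 0) \<longrightarrow> ?P w = 0"
    and mn: "\<forall>u\<in>span B. minsq A V (?P (?p + u)) = (norm ?p)\<^sup>2 + (norm u)\<^sup>2"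
    and QV: "span B = orth_proj (direction A) ` V"
    by (rule fiber_frame[OF A E onto])
  have PV: "proj_subspace V" using orthonormal_proj_subspace[OF E(1)] E(2) by simp
  have V: "subspace V" using PV by (simp add: proj_subspace_def)
  note linP = linear_orth_proj[OF PV]
  have [measurable]: "?P \<in> borel_measurable borel"
    by (intro borel_measurable_continuous_onI continuous_orth_proj PV)
  interpret B: frame B "\<lambda>e. e" "\<lambda>e. e" by (rule orthonormal_frame[OF B(1)])
  interpret E: frame E "\<lambda>e. e" "\<lambda>e. e" by (rule orthonormal_frame[OF E(1)])
  interpret T: frame B ?P t by unfold_locales (use B(1) dual in \<open>auto simp: orthonormal_def\<close>)
  obtain c where c: "c > 0" "\<And>g. g \<in> borel_measurable borel \<Longrightarrow>
      (\<integral>\<^sup>+y. g y \<partial>frame_leb B ?P) = ennreal c * (\<integral>\<^sup>+y. g y \<partial>leb_on E)"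
    using frame_leb_proportional[OF T.frame_axioms E.frame_axioms] sp E(2) by auto
  define a where "a = ?P ?p"
  have aV: "a \<in> V" unfolding a_def by (rule orth_proj_mem[OF PV])
  \<comment> \<open>The squared norm of \<open>u\<close>, rewritten as a quadratic form in the image
    \<open>?P u\<close> by means of the dual vectors.\<close>
  define Q where "Q = (\<lambda>v. \<Sum>e\<in>B. (inner (t e) v)\<^sup>2)"
  have Q_meas [measurable]: "Q \<in> borel_measurable borel"
    unfolding Q_def by (intro borel_measurable_continuous_onI continuous_intros)
  have P_comb: "?P (\<Sum>e\<in>B. x e *\<^sub>R e) = T.comb x" for x
    by (simp add: linear_sum[OF linP] linear_scale[OF linP])
  have Q_comb: "Q (T.comb x) = (norm (\<Sum>e\<in>B. x e *\<^sub>R e))\<^sup>2" for x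
    by (simp add: Q_def T.inner_comb norm_sum_orthonormal[OF B(1)])
  have mQ: "minsq A V v = (norm ?p)\<^sup>2 + Q (v - a)" if "v \<in> V" for v
  proof -
    have "v - a \<in> span (?P ` B)" unfolding sp using that aV V by (intro subspace_diff)
    then have va: "T.comb (\<lambda>e. inner (t e) (v - a)) = v - a" by (rule T.comb_expand)
    define u where "u = (\<Sum>e\<in>B. inner (t e) (v - a) *\<^sub>R e)"
    have u: "u \<in> span B" unfolding u_def by (intro span_sum span_scale span_base)
    have "?P (?p + u) = v" using va by (simp add: linear_add[OF linP] a_def[symmetric] u_def P_comb)
    moreover have "Q (v - a) = (norm u)\<^sup>2" using Q_comb[of "\<lambda>e. inner (t e) (v - a)"] va by (simp add: u_def)
    ultimately show ?thesis using mn u by fastforce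
  qed
  have eq: "(\<integral>\<^sup>+u. F (?P (?p + u)) * w ((norm ?p)\<^sup>2 + (norm u)\<^sup>2) \<partial>leb_on B)
      = ennreal c * (\<integral>\<^sup>+v. F v * w (minsq A V v) \<partial>leb_on E)"
    if [measurable]: "F \<in> borel_measurable borel" "w \<in> borel_measurable borel"
    for F :: "'a \<Rightarrow> ennreal" and w :: "real \<Rightarrow> ennreal"
  proof -
    have "(\<integral>\<^sup>+u. F (?P (?p + u)) * w ((norm ?p)\<^sup>2 + (norm u)\<^sup>2) \<partial>leb_on B)
      = (\<integral>\<^sup>+x. F (?P (?p + (\<Sum>e\<in>B. x e *\<^sub>R e))) * w ((norm ?p)\<^sup>2 + (norm (\<Sum>e\<in>B. x e *\<^sub>R e))\<^sup>2) \<partial>PL B)"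
      by (rule nn_integral_frame_leb) measurable
    also have "\<dots> = (\<integral>\<^sup>+x. F (a + T.comb x) * w ((norm ?p)\<^sup>2 + Q (T.comb x)) \<partial>PL B)"
      unfolding Q_comb linear_add[OF linP] P_comb a_def ..
    also have "\<dots> = (\<integral>\<^sup>+y. F (a + y) * w ((norm ?p)\<^sup>2 + Q y) \<partial>frame_leb B ?P)"
      by (rule nn_integral_frame_leb[symmetric]) measurable
    also have "\<dots> = ennreal c * (\<integral>\<^sup>+y. F (a + y) * w ((norm ?p)\<^sup>2 + Q y) \<partial>leb_on E)"
      by (rule c(2)) measurable
    also have "(\<integral>\<^sup>+y. F (a + y) * w ((norm ?p)\<^sup>2 + Q y) \<partial>leb_on E)
      = (\<integral>\<^sup>+y. F (y + a) * w ((norm ?p)\<^sup>2 + Q (y + a - a)) \<partial>leb_on E)" by (simp add: add.commute)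
    also have "\<dots> = (\<integral>\<^sup>+v. F v * w ((norm ?p)\<^sup>2 + Q (v - a)) \<partial>leb_on E)"
      using aV E(2) by (intro E.nn_integral_translate[where g = "\<lambda>v. F v * w ((norm ?p)\<^sup>2 + Q (v - a))"]) simp_all
    also have "\<dots> = (\<integral>\<^sup>+v. F v * w (minsq A V v) \<partial>leb_on E)"
    proof (rule nn_integral_cong_AE, rule eventually_mono[OF E.AE_in_S])
      fix v assume "v \<in> E.S"
      then have "v \<in> V" using E(2) by simp
      then show "F v * w ((norm ?p)\<^sup>2 + Q (v - a)) = F v * w (minsq A V v)" by (simp add: mQ)
    qed
    finally show ?thesis .
  qed
  have "(\<lambda>v. minsq A V (?P v)) = (\<lambda>v. (norm ?p)\<^sup>2 + Q (?P v - a))"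
    using mQ orth_proj_mem[OF PV] by auto
  then have meas: "(\<lambda>v. minsq A V (?P v)) \<in> borel_measurable borel" by simp
  show ?thesis by (rule that[OF c(1) B QV ker _ meas]) (intro ballI eq)
qed

section \<open>The normalized surface measure in coordinates\<close>

lemma lebesgue_subspace_eq: "lebesgue_subspace S = leb_on (SOME E. orthonormal_basis S E)"
  by (simp add: lebesgue_subspace_def frame_leb_def Let_def)

lemma leb_on_singleton_0:
  fixes B :: "'a::{real_inner,second_countable_topology} set"
  assumes B: "orthonormal B" "B \<noteq> {}"
  shows "emeasure (leb_on B) {0} = 0"
proof -
  obtain \<kappa> where \<kappa>: "\<And>h. h \<in> borel_measurable borel \<Longrightarrow>
    (\<integral>\<^sup>+w. h (norm w) \<partial>leb_on B) = (\<integral>\<^sup>+r. h r * ennreal (\<kappa> * r ^ (card B - 1)) * indicator {0..} r \<partial>lborel)"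
    using nn_integral_leb_on_norm[OF B] by blast
  have "emeasure (leb_on B) {0} = (\<integral>\<^sup>+w. indicator {0} w \<partial>leb_on B)" by simp
  also have "\<dots> = (\<integral>\<^sup>+w. indicator {0} (norm w) \<partial>leb_on B)"
    by (intro nn_integral_cong) (auto simp: indicator_def)
  also have "\<dots> = (\<integral>\<^sup>+r. indicator {0} r * ennreal (\<kappa> * r ^ (card B - 1)) * indicator {0..} r \<partial>lborel)"
    by (rule \<kappa>) simp
  also have "\<dots> = (\<integral>\<^sup>+r. 0 \<partial>(lborel :: real measure))"
    using AE_lborel_singleton[of "0 :: real"]
    by (intro nn_integral_cong_AE) (auto elim!: eventually_mono)
  finally show ?thesis by simp
qed

text \<open>By Pythagoras the radial map sends almost all of the punctured ball into
  \<open>L \<inter> big_sphere Z\<close>, so conditioning on that set only divides by the total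
  mass. The factor \<open>dim W / R\<close> of \<open>sphere_area\<close> cancels, and
  \<open>c\<close> is the reciprocal of the volume of the ball. A nonzero direction is needed for
  the area to be positive. The basis is existential because \<open>lebesgue_subspace\<close> selects
  one arbitrarily.\<close>

lemma
  fixes L Z :: "'a::{real_inner,polish_space} set"
  assumes A: "affine (L \<inter> Z)" "closed (L \<inter> Z)" "L \<inter> Z \<noteq> {}" and Z: "fin_dim_subspace Z"
    and p: "(norm (foot (L \<inter> Z)))\<^sup>2 < dim Z" and ne: "direction (L \<inter> Z) \<noteq> {0}"
  shows prob_space_sigma_bar: "prob_space (sigma_bar L Z)"
    and sigma_bar_integral: "\<exists>c>0. \<exists>B. orthonormal B \<and> span B = direction (L \<inter> Z) \<and> (\<forall>g\<in>borel_measurable borel.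
    (\<integral>\<^sup>+z. g z \<partial>sigma_bar L Z) = ennreal c *
      (\<integral>\<^sup>+y. g (foot (L \<inter> Z) + (sqrt (real (dim Z) - (norm (foot (L \<inter> Z)))\<^sup>2) / norm y) *\<^sub>R y)
        * indicator (cball 0 (sqrt (real (dim Z) - (norm (foot (L \<inter> Z)))\<^sup>2)) - {0}) y \<partial>leb_on B))"
proof -
  let ?A = "L \<inter> Z"
  define p where "p = foot ?A"
  define W where "W = direction ?A"
  define R where "R = sqrt (real (dim Z) - (norm p)\<^sup>2)"
  have R: "R > 0" "R\<^sup>2 = dim Z - (norm p)\<^sup>2" using p by (simp_all add: R_def p_def)
  have pA: "p \<in> ?A" unfolding p_def using A by (intro foot_in affine_imp_convex)
  have sZ: "subspace Z" using Z subspace_span unfolding fin_dim_subspace_def by metis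
  have W: "subspace W" unfolding W_def using A pA by (intro subspace_direction) (auto simp: p_def)
  have "W \<subseteq> Z" using pA sZ by (auto simp: W_def direction_def p_def intro: subspace_diff)
  then have "fin_dim_subspace W" using fin_dim_subset[OF W _ Z] by blast
  then have "\<exists>B. orthonormal_basis W B"
    using fin_dim_basis[of W] by (auto simp: orthonormal_basis_iff)
  define B where "B = (SOME B. orthonormal_basis W B)"
  have B: "orthonormal B" "span B = W"
    using someI_ex[OF \<open>\<exists>B. orthonormal_basis W B\<close>] by (auto simp: B_def orthonormal_basis_iff)
  have neB: "B \<noteq> {}"
  proof
    assume "B = {}"
    then have "W = {0}" using B(2) by (simp add: span_empty)
    then show False using ne by (simp add: W_def)
  qed
  interpret frame B "\<lambda>e. e" "\<lambda>e. e" by (rule orthonormal_frame[OF B(1)])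
  let ?C = "cball 0 R - {0} :: 'a set"
  let ?\<phi> = "\<lambda>y. p + (R / norm y) *\<^sub>R y"
  let ?X = "L \<inter> big_sphere Z"
  let ?S = "sphere_area W p R"
  have C: "?C \<in> sets borel" by (intro sets.Diff borel_closed) auto
  have X: "?X \<in> sets borel"
  proof -
    have "?X = ?A \<inter> {z. norm z = sqrt (real (dim Z))}" by (auto simp: big_sphere_def)
    also have "closed \<dots>" by (intro closed_Int[OF A(2)] closed_Collect_eq continuous_intros)
    finally show ?thesis by (rule borel_closed)
  qed
  have W_eq: "lebesgue_subspace W = M" by (simp add: lebesgue_subspace_eq B_def)
  have SI: "(\<integral>\<^sup>+z. g z \<partial>?S) = ennreal (dim W / R) * (\<integral>\<^sup>+y. g (?\<phi> y) * indicator ?C y \<partial>M)"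
    if [measurable]: "g \<in> borel_measurable borel" for g
  proof -
    have m: "?\<phi> \<in> borel_measurable (restrict_space M ?C)"
      by (intro measurable_restrict_space1) simp
    have "(\<integral>\<^sup>+z. g z \<partial>?S) = ennreal (dim W / R) * (\<integral>\<^sup>+y. g (?\<phi> y) \<partial>restrict_space M ?C)"
      unfolding sphere_area_def W_eq
      by (subst nn_integral_scale_measure) (use m in \<open>simp_all add: nn_integral_distr\<close>)
    then show ?thesis using C by (simp add: nn_integral_restrict_space)
  qed
  have inX: "?\<phi> y \<in> ?X" if "y \<in> W" "y \<noteq> 0" for y
  proof -
    let ?w = "(R / norm y) *\<^sub>R y"
    have w: "?w \<in> W" using W that by (intro subspace_scale)
    then have "p + ?w \<in> ?A" by (auto simp: W_def direction_def p_def)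
    moreover have "(norm (p + ?w))\<^sup>2 = (norm p)\<^sup>2 + (norm ?w)\<^sup>2"
    proof -
      have "inner p ?w = 0" using foot_orthogonal[OF A] w by (simp only: W_def p_def)
      then show ?thesis
        unfolding power2_norm_eq_inner inner_add_left inner_add_right inner_commute[of ?w p] by linarith
    qed
    then have "(norm (p + ?w))\<^sup>2 = dim Z" using that R by simp
    then have "norm (p + ?w) = sqrt (dim Z)" by (metis norm_ge_zero real_sqrt_unique)
    ultimately show ?thesis by (auto simp: big_sphere_def)
  qed
  have AEX: "AE y in M. indicator ?X (?\<phi> y) * indicator ?C y = (indicator ?C y :: ennreal)"
    using AE_in_S by (rule eventually_mono) (use inX B(2) in \<open>auto simp: indicator_def\<close>)
  have dW: "dim W > 0" using orthonormal_dim[OF B(1)] B(2) neB B(1) by (simp add: orthonormal_def card_gt_0_iff)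
  \<comment> \<open>Removing the origin costs nothing in positive dimension, so the punctured ball
    inherits finite positive mass from the ball.\<close>
  have "emeasure M ?C = emeasure M (cball 0 R) - emeasure M {0}"
    using leb_on_singleton_0[OF B(1) neB] R(1)
    by (intro emeasure_Diff) auto
  then have eC: "emeasure M ?C = emeasure M (cball 0 R)" by (simp add: leb_on_singleton_0[OF B(1) neB])
  obtain m0 where m0: "emeasure M ?C = ennreal m0" "m0 > 0"
    using emeasure_cball_finite[of R] emeasure_cball_pos[OF R(1)] eC
    by (cases "emeasure M (cball 0 R)") auto
  have "emeasure ?S ?X = (\<integral>\<^sup>+z. indicator ?X z \<partial>?S)"
    using X by (subst nn_integral_indicator) (auto simp: sphere_area_def)
  also have "\<dots> = ennreal (dim W / R) * (\<integral>\<^sup>+y. indicator ?X (?\<phi> y) * indicator ?C y \<partial>M)"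
    by (rule SI) (use X in measurable)
  also have "(\<integral>\<^sup>+y. indicator ?X (?\<phi> y) * indicator ?C y \<partial>M) = (\<integral>\<^sup>+y. indicator ?C y \<partial>M)"
    by (rule nn_integral_cong_AE[OF AEX])
  also have "ennreal (dim W / R) * (\<integral>\<^sup>+y. indicator ?C y \<partial>M) = ennreal (dim W / R * m0)"
    using C m0 R dW by (simp add: ennreal_mult[symmetric])
  finally have eX: "emeasure ?S ?X = ennreal (dim W / R * m0)" .
  have "(\<integral>\<^sup>+z. g z \<partial>sigma_bar L Z) = ennreal (1 / m0) * (\<integral>\<^sup>+y. g (?\<phi> y) * indicator ?C y \<partial>M)"
    if [measurable]: "g \<in> borel_measurable borel" for g
  proof -
    have [measurable]: "?X \<in> sets borel" by (rule X)
    have "(\<integral>\<^sup>+z. g z \<partial>sigma_bar L Z) = (\<integral>\<^sup>+z. g z * indicator ?X z \<partial>?S) / emeasure ?S ?X"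
      unfolding sigma_bar_def p_def[symmetric] W_def[symmetric] R_def[symmetric]
      using X by (intro nn_integral_uniform_measure) (auto simp: sphere_area_def)
    also have "(\<integral>\<^sup>+z. g z * indicator ?X z \<partial>?S)
        = ennreal (dim W / R) * (\<integral>\<^sup>+y. g (?\<phi> y) * indicator ?X (?\<phi> y) * indicator ?C y \<partial>M)"
      by (rule SI) measurable
    also have "(\<integral>\<^sup>+y. g (?\<phi> y) * indicator ?X (?\<phi> y) * indicator ?C y \<partial>M) = (\<integral>\<^sup>+y. g (?\<phi> y) * indicator ?C y \<partial>M)"
      using AEX by (intro nn_integral_cong_AE) (auto elim!: eventually_mono simp: mult.assoc)
    also have "ennreal (dim W / R) * (\<integral>\<^sup>+y. g (?\<phi> y) * indicator ?C y \<partial>M) / emeasure ?S ?X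
      = (ennreal (dim W / R) / emeasure ?S ?X) * (\<integral>\<^sup>+y. g (?\<phi> y) * indicator ?C y \<partial>M)"
      by (simp add: divide_ennreal_def mult_ac)
    also have "ennreal (dim W / R) / emeasure ?S ?X = ennreal (1 / m0)"
      unfolding eX using m0 R dW by (subst divide_ennreal) auto
    finally show ?thesis .
  qed
  then show "\<exists>c>0. \<exists>B. orthonormal B \<and> span B = direction (L \<inter> Z) \<and> (\<forall>g\<in>borel_measurable borel.
    (\<integral>\<^sup>+z. g z \<partial>sigma_bar L Z) = ennreal c *
      (\<integral>\<^sup>+y. g (foot (L \<inter> Z) + (sqrt (real (dim Z) - (norm (foot (L \<inter> Z)))\<^sup>2) / norm y) *\<^sub>R y)
        * indicator (cball 0 (sqrt (real (dim Z) - (norm (foot (L \<inter> Z)))\<^sup>2)) - {0}) y \<partial>leb_on B))"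
    using m0(2) B unfolding p_def[symmetric] W_def[symmetric] R_def[symmetric]
    by (intro exI[of _ "1 / m0"]) auto
  show "prob_space (sigma_bar L Z)"
    unfolding sigma_bar_def p_def[symmetric] W_def[symmetric] R_def[symmetric]
    using eX m0(2) dW R(1) by (intro prob_space_uniform_measure) (auto simp: sphere_area_def)
qed

text \<open>The direction of \<open>L \<inter> Z\<close> is split into \<open>span B\<close>, which
  is mapped isomorphically onto \<open>V\<close>, and \<open>span B'\<close>, on which the
  projection to \<open>V\<close> vanishes. The sphere is projected to \<open>span B\<close> and the
  result transported to \<open>V\<close>; the radius identity \<open>R\<^sup>2 - (norm x)\<^sup>2 =
  dim Z - ((norm p)\<^sup>2 + (norm x)\<^sup>2)\<close> then produces \<open>minsq\<close>. Since
  \<open>card B \<le> card E\<close>, the summand 3 in the dimension hypothesis leaves at least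
  three vectors in \<open>B'\<close>.\<close>

lemma sigma_bar_projection_density:
  fixes L Z V :: "'a::{real_inner,polish_space} set"
  assumes A: "affine (L \<inter> Z)" "closed (L \<inter> Z)" "L \<inter> Z \<noteq> {}" and Z: "fin_dim_subspace Z"
    and E: "orthonormal E" "span E = V" and onto: "orth_proj V ` (L \<inter> Z) = V"
    and p: "(norm (foot (L \<inter> Z)))\<^sup>2 < dim Z" and d: "dim (direction (L \<inter> Z)) \<ge> card E + 3"
  obtains c m where "c > 0" "m \<le> dim Z" "dim (direction (L \<inter> Z)) \<le> m + card E + 2"
    "\<forall>F\<in>borel_measurable borel. (\<integral>\<^sup>+z. F (orth_proj V z) \<partial>sigma_bar L Z)
      = ennreal c * (\<integral>\<^sup>+v. F v * ennreal (sqrt (max 0 (real (dim Z) - minsq (L \<inter> Z) V v)) ^ m) \<partial>leb_on E)"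
proof -
  let ?A = "L \<inter> Z" and ?P = "orth_proj V"
  define p where "p = foot ?A"
  define W where "W = direction ?A"
  define R where "R = sqrt (real (dim Z) - (norm p)\<^sup>2)"
  have R: "R > 0" "R\<^sup>2 = dim Z - (norm p)\<^sup>2" using p by (simp_all add: R_def p_def)
  have dW: "dim W \<ge> card E + 3" using d by (simp add: W_def)
  have "W \<noteq> {0}"
  proof
    assume "W = {0}"
    then show False using dW dim_singleton_0[where 'a = 'a] by simp
  qed
  then obtain c1 B0 where c1: "c1 > 0" and B0: "orthonormal B0" "span B0 = W"
    and I1: "\<And>g. g \<in> borel_measurable borel \<Longrightarrow> (\<integral>\<^sup>+z. g z \<partial>sigma_bar L Z) = ennreal c1 *
      (\<integral>\<^sup>+y. g (p + (R / norm y) *\<^sub>R y) * indicator (cball 0 R - {0}) y \<partial>leb_on B0)"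
    using sigma_bar_integral[OF A Z p] unfolding p_def[symmetric] W_def[symmetric] R_def[symmetric] by blast
  obtain B c2 where c2: "c2 > 0" and B: "orthonormal B" "span B \<subseteq> W" "card B \<le> card E"
    and "span B = orth_proj W ` V"
    and ker: "\<forall>w\<in>W. (\<forall>e\<in>B. inner w e = 0) \<longrightarrow> ?P w = 0"
    and I2: "\<forall>F\<in>borel_measurable borel. \<forall>w\<in>borel_measurable borel.
      (\<integral>\<^sup>+u. F (?P (p + u)) * w ((norm p)\<^sup>2 + (norm u)\<^sup>2) \<partial>leb_on B)
      = ennreal c2 * (\<integral>\<^sup>+v. F v * w (minsq ?A V v) \<partial>leb_on E)"
    and "(\<lambda>v. minsq ?A V (?P v)) \<in> borel_measurable borel"
    by (rule fiber_integral[OF A E onto, folded p_def W_def])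
  have finW: "fin_dim_subspace W"
    unfolding fin_dim_subspace_def using B0 by (auto simp: orthonormal_def)
  obtain B' where B': "orthonormal (B \<union> B')" "B \<inter> B' = {}" "span (B \<union> B') = W"
    by (rule orthonormal_extend[OF B(1,2) finW])
  have fin: "finite B" "finite B'" using B'(1) by (auto simp: orthonormal_def)
  have "dim W = card (B \<union> B')" using orthonormal_dim[OF B'(1)] B'(3) by simp
  also have "\<dots> = card B + card B'" using fin B'(2) by (rule card_Un_disjoint)
  finally have cd: "dim W = card B + card B'" .
  then have l: "card B' \<ge> 3" using dW B(3) by simp
  obtain c3 where c3: "c3 > 0" and I3: "\<And>F. F \<in> borel_measurable borel \<Longrightarrow>
    (\<integral>\<^sup>+y. F ((R / norm y) *\<^sub>R (\<Sum>e\<in>B. inner y e *\<^sub>R e)) * indicator (cball 0 R - {0}) y \<partial>leb_on (B \<union> B'))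
    = ennreal c3 * (\<integral>\<^sup>+x. F x * ennreal (sqrt (max 0 (R\<^sup>2 - (norm x)\<^sup>2)) ^ (card B' - 2)) \<partial>leb_on B)"
    using nn_integral_sphere_projection[OF B'(1,2) l R(1)] by blast
  interpret B0: frame B0 "\<lambda>e. e" "\<lambda>e. e" by (rule orthonormal_frame[OF B0(1)])
  interpret BB: frame "B \<union> B'" "\<lambda>e. e" "\<lambda>e. e" by (rule orthonormal_frame[OF B'(1)])
  \<comment> \<open>The basis \<open>B0\<close> behind \<open>sigma_bar\<close> need not be adapted
    to the splitting; proportionality of Lebesgue measures replaces it by
    \<open>B \<union> B'\<close>.\<close>
  obtain c4 where c4: "c4 > 0" and I4: "\<And>g. g \<in> borel_measurable borel \<Longrightarrow>
    (\<integral>\<^sup>+y. g y \<partial>leb_on B0) = ennreal c4 * (\<integral>\<^sup>+y. g y \<partial>leb_on (B \<union> B'))"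
    using frame_leb_proportional[OF B0.frame_axioms BB.frame_axioms] B0(2) B'(3) by auto
  have PV: "proj_subspace V" using orthonormal_proj_subspace[OF E(1)] E(2) by simp
  note linP = linear_orth_proj[OF PV]
  have P_meas [measurable]: "?P \<in> borel_measurable borel"
    by (intro borel_measurable_continuous_onI continuous_orth_proj PV)
  have C [measurable]: "cball 0 R - {0 :: 'a} \<in> sets borel" by (intro sets.Diff borel_closed) auto
  have Pproj: "?P y = ?P (\<Sum>e\<in>B. inner y e *\<^sub>R e)" if "y \<in> W" for y
  proof -
    let ?u = "\<Sum>e\<in>B. inner y e *\<^sub>R e"
    have "?u \<in> span B" by (intro span_sum span_scale span_base)
    then have "?u \<in> W" using B(2) by blast
    moreover have "subspace W" using B0(2) subspace_span by metis
    ultimately have "y - ?u \<in> W" using that by (intro subspace_diff)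
    then have "?P (y - ?u) = 0"
      by (intro ker[rule_format]) (auto simp: inner_diff_left inner_sum_orthonormal[OF B(1)])
    then show ?thesis by (simp add: linear_diff[OF linP])
  qed
  define m where "m = card B' - 2"
  have W_sub: "dim W \<le> dim Z"
  proof -
    obtain BZ where BZ: "orthonormal BZ" "span BZ = Z" using Z by (rule fin_dim_basis)
    have sZ: "subspace Z" using BZ(2) subspace_span by metis
    have "foot ?A \<in> ?A" using A by (intro foot_in affine_imp_convex)
    then have "W \<subseteq> span BZ" using sZ BZ(2) by (auto simp: W_def direction_def intro: subspace_diff)
    then have "dim W \<le> card BZ" using BZ(1) by (intro dim_le_card) (auto simp: orthonormal_def)
    then show ?thesis using orthonormal_dim[OF BZ(1)] BZ(2) by simp
  qed
  have I: "(\<integral>\<^sup>+z. F (?P z) \<partial>sigma_bar L Z)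
      = ennreal (c1 * c4 * c3 * c2) * (\<integral>\<^sup>+v. F v * ennreal (sqrt (max 0 (real (dim Z) - minsq ?A V v)) ^ m) \<partial>leb_on E)"
    if [measurable]: "F \<in> borel_measurable borel" for F
  proof -
    have "(\<integral>\<^sup>+z. F (?P z) \<partial>sigma_bar L Z) = ennreal c1 *
      (\<integral>\<^sup>+y. F (?P (p + (R / norm y) *\<^sub>R y)) * indicator (cball 0 R - {0}) y \<partial>leb_on B0)"
      by (rule I1) measurable
    also have "(\<integral>\<^sup>+y. F (?P (p + (R / norm y) *\<^sub>R y)) * indicator (cball 0 R - {0}) y \<partial>leb_on B0)
      = ennreal c4 * (\<integral>\<^sup>+y. F (?P (p + (R / norm y) *\<^sub>R y)) * indicator (cball 0 R - {0}) y \<partial>leb_on (B \<union> B'))"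
      by (rule I4) measurable
    also have "(\<integral>\<^sup>+y. F (?P (p + (R / norm y) *\<^sub>R y)) * indicator (cball 0 R - {0}) y \<partial>leb_on (B \<union> B'))
      = (\<integral>\<^sup>+y. F (?P (p + (R / norm y) *\<^sub>R (\<Sum>e\<in>B. inner y e *\<^sub>R e))) * indicator (cball 0 R - {0}) y \<partial>leb_on (B \<union> B'))"
    proof (rule nn_integral_cong_AE, rule eventually_mono[OF BB.AE_in_S])
      fix y assume "y \<in> BB.S"
      then have "y \<in> W" using B'(3) by simp
      then show "F (?P (p + (R / norm y) *\<^sub>R y)) * indicator (cball 0 R - {0}) y =
        F (?P (p + (R / norm y) *\<^sub>R (\<Sum>e\<in>B. inner y e *\<^sub>R e))) * indicator (cball 0 R - {0}) y"
        unfolding linear_add[OF linP] linear_scale[OF linP] by (simp only: Pproj[of y])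
    qed
    also have "\<dots> = ennreal c3 * (\<integral>\<^sup>+x. F (?P (p + x)) * ennreal (sqrt (max 0 (R\<^sup>2 - (norm x)\<^sup>2)) ^ m) \<partial>leb_on B)"
      unfolding m_def by (rule I3) measurable
    also have "(\<integral>\<^sup>+x. F (?P (p + x)) * ennreal (sqrt (max 0 (R\<^sup>2 - (norm x)\<^sup>2)) ^ m) \<partial>leb_on B)
      = (\<integral>\<^sup>+x. F (?P (p + x)) * ennreal (sqrt (max 0 (real (dim Z) - ((norm p)\<^sup>2 + (norm x)\<^sup>2))) ^ m) \<partial>leb_on B)"
      unfolding R(2) by (simp add: diff_diff_eq)
    also have "\<dots> = ennreal c2 * (\<integral>\<^sup>+v. F v * ennreal (sqrt (max 0 (real (dim Z) - minsq ?A V v)) ^ m) \<partial>leb_on E)"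
      by (rule I2[rule_format]) measurable
    finally show ?thesis using c1 c2 c3 c4 by (simp add: ennreal_mult mult.assoc)
  qed
  show ?thesis
  \<comment> \<open>The factors come from the normalization, the change of basis, the projection of
    the sphere and the transport to \<open>V\<close>, in this order.\<close>
  proof (rule that[of "c1 * c4 * c3 * c2" m])
    show "0 < c1 * c4 * c3 * c2" using c1 c2 c3 c4 by simp
    show "m \<le> dim Z" using W_sub cd by (simp add: m_def)
    show "dim (direction ?A) \<le> m + card E + 2"
      using cd B(3) l unfolding W_def[symmetric] m_def by linarith
  qed (intro ballI I)
qed

section \<open>Uniqueness of characteristic functions\<close>

lemma (in finite_measure) emeasure_distr_density:
  fixes X u :: "'a \<Rightarrow> real"
  assumes [measurable]: "X \<in> borel_measurable M" "u \<in> borel_measurable M" "B \<in> sets borel"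
    and u: "\<And>x. 0 \<le> u x" "\<And>x. u x \<le> C"
  shows "emeasure (distr (density M (\<lambda>x. ennreal (u x))) borel X) B = ennreal (LINT x|M. u x * indicator B (X x))"
proof -
  have iu: "integrable M u" by (rule integrable_const_bound[where B = C]) (use u in auto)
  have "emeasure (distr (density M (\<lambda>x. ennreal (u x))) borel X) B
      = emeasure (density M (\<lambda>x. ennreal (u x))) (X -` B \<inter> space M)"
    by (simp add: emeasure_distr)
  also have "\<dots> = (\<integral>\<^sup>+x. ennreal (u x) * indicator (X -` B \<inter> space M) x \<partial>M)"
    by (subst emeasure_density) auto
  also have "\<dots> = (\<integral>\<^sup>+x. ennreal (u x * indicator B (X x)) \<partial>M)"
    by (intro nn_integral_cong) (auto simp: indicator_def)
  also have "\<dots> = ennreal (LINT x|M. u x * indicator B (X x))"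
    using u by (intro nn_integral_eq_integral Bochner_Integration.integrable_bound[OF iu])
      (auto simp: indicator_def)
  finally show ?thesis .
qed

text \<open>The weighted laws of \<open>X\<close> and \<open>Y\<close> are divided by their common
  mass, which is the value of the transform at frequency 0, and Levy's uniqueness theorem is
  applied. Mass zero cannot be normalized and is trivial. The bound \<open>C\<close> makes the
  weights integrable.\<close>

lemma char_unique_weighted:
  fixes X u :: "'a \<Rightarrow> real" and Y v :: "'b \<Rightarrow> real"
  assumes "finite_measure M" "finite_measure N"
    and [measurable]: "X \<in> borel_measurable M" "u \<in> borel_measurable M"
      "Y \<in> borel_measurable N" "v \<in> borel_measurable N"
    and u: "\<And>x. 0 \<le> u x" "\<And>x. u x \<le> C" and v: "\<And>x. 0 \<le> v x" "\<And>x. v x \<le> C"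
    and eq: "\<And>s. (LINT x|M. u x *\<^sub>R iexp (s * X x))
      = (LINT x|N. v x *\<^sub>R iexp (s * Y x))"
    and A [measurable]: "A \<in> sets borel"
  shows "(LINT x|M. u x * indicator A (X x)) = (LINT x|N. v x * indicator A (Y x))"
proof -
  interpret M: finite_measure M by fact
  interpret N: finite_measure N by fact
  define D1 where "D1 = distr (density M (\<lambda>x. ennreal (u x))) borel X"
  define D2 where "D2 = distr (density N (\<lambda>x. ennreal (v x))) borel Y"
  have e1: "emeasure D1 B = ennreal (LINT x|M. u x * indicator B (X x))" if "B \<in> sets borel" for B
    unfolding D1_def using that u by (intro M.emeasure_distr_density) auto
  have e2: "emeasure D2 B = ennreal (LINT x|N. v x * indicator B (Y x))" if "B \<in> sets borel" for B
    unfolding D2_def using that v by (intro N.emeasure_distr_density) auto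
  have nn: "0 \<le> (LINT x|M. u x * indicator B (X x))" "0 \<le> (LINT x|N. v x * indicator B (Y x))" for B
    using u v by (auto intro!: integral_nonneg_AE)
  have "complex_of_real (LINT x|M. u x) = complex_of_real (LINT x|N. v x)"
    using eq[of 0] by (simp add: scaleR_conv_of_real)
  then obtain m where m: "m = (LINT x|M. u x)" "m = (LINT x|N. v x)" by auto
  have m0: "m \<ge> 0" unfolding m(1) using u by (intro integral_nonneg_AE) auto
  have UNIVs: "emeasure D1 UNIV = ennreal m" "emeasure D2 UNIV = ennreal m"
    using e1[of UNIV] e2[of UNIV] m by auto
  have "emeasure D1 A = emeasure D2 A"
  proof (cases "m = 0")
    case True
    then have "emeasure D1 A = 0" "emeasure D2 A = 0"
      using emeasure_space[of D1 A] emeasure_space[of D2 A] UNIVs by (auto simp: D1_def D2_def)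
    then show ?thesis by simp
  next
    case False
    with m0 have mp: "m > 0" by simp
    define D1' where "D1' = density D1 (\<lambda>_. ennreal (1 / m))"
    define D2' where "D2' = density D2 (\<lambda>_. ennreal (1 / m))"
    have sets [simp]: "sets D1 = sets borel" "sets D2 = sets borel" by (auto simp: D1_def D2_def)
    have sp [simp]: "space D1 = UNIV" "space D2 = UNIV" by (auto simp: D1_def D2_def)
    have eD: "emeasure D1' B = ennreal (1 / m) * emeasure D1 B" "emeasure D2' B = ennreal (1 / m) * emeasure D2 B"
      if "B \<in> sets borel" for B
      using that by (auto simp: D1'_def D2'_def emeasure_density_const)
    have "real_distribution D1'" "real_distribution D2'"
      using eD[of UNIV] UNIVs mp
      by (auto simp: real_distribution_def real_distribution_axioms_def D1'_def D2'_def
          ennreal_mult[symmetric] intro!: prob_spaceI)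
    moreover have "char D1' = char D2'"
    proof
      fix s
      have m1: "(\<lambda>x. iexp (s * x)) \<in> borel_measurable borel" by measurable
      have "char D1' s = (1 / m) *\<^sub>R (LINT x|M. u x *\<^sub>R iexp (s * X x))"
        unfolding char_def D1'_def using mp m1 u
        by (subst integral_density) (auto simp: D1_def integral_distr integral_density)
      moreover have "char D2' s = (1 / m) *\<^sub>R (LINT x|N. v x *\<^sub>R iexp (s * Y x))"
        unfolding char_def D2'_def using mp m1 v
        by (subst integral_density) (auto simp: D2_def integral_distr integral_density)
      ultimately show "char D1' s = char D2' s" using eq by simp
    qed
    ultimately have "D1' = D2'" by (rule Levy_uniqueness)
    then have "ennreal (1 / m) * emeasure D1 A = ennreal (1 / m) * emeasure D2 A"
      using eD[OF A] by simp
    then show ?thesis using mp by (simp add: ennreal_mult_cancel_left)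
  qed
  then show ?thesis using e1[OF A] e2[OF A] nn[of A] by simp
qed

text \<open>Reduction to dimension one: for fixed frequencies in the remaining coordinates, the weight
  \<open>1 + cos (S + a)\<close> is nonnegative, and its Fourier transform in one coordinate is a
  combination of values of the joint characteristic function.\<close>

lemma joint_char_unique:
  fixes X :: "'i \<Rightarrow> 'a \<Rightarrow> real" and Y :: "'i \<Rightarrow> 'b \<Rightarrow> real"
  assumes "finite E" "finite_measure M" "finite_measure N"
    "\<And>e. e \<in> E \<Longrightarrow> X e \<in> borel_measurable M" "\<And>e. e \<in> E \<Longrightarrow> Y e \<in> borel_measurable N"
    "\<And>t. (LINT x|M. iexp (\<Sum>e\<in>E. t e * X e x))
      = (LINT x|N. iexp (\<Sum>e\<in>E. t e * Y e x))"
    "\<And>e. e \<in> E \<Longrightarrow> A e \<in> sets borel"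
  shows "measure M {x \<in> space M. \<forall>e\<in>E. X e x \<in> A e} = measure N {x \<in> space N. \<forall>e\<in>E. Y e x \<in> A e}"
  using assms
proof (induction E arbitrary: M N)
  case empty
  have "complex_of_real (measure M (space M)) = complex_of_real (measure N (space N))"
    using empty.prems(5)[of "\<lambda>_. 0"] by (simp add: scaleR_conv_of_real)
  then show ?case by simp
next
  case (insert e F)
  interpret M: finite_measure M by fact
  interpret N: finite_measure N by fact
  have X [measurable]: "X e \<in> borel_measurable M" "\<And>f. f \<in> F \<Longrightarrow> X f \<in> borel_measurable M"
    and Y [measurable]: "Y e \<in> borel_measurable N" "\<And>f. f \<in> F \<Longrightarrow> Y f \<in> borel_measurable N"
    and A [measurable]: "A e \<in> sets borel" using insert.prems by auto
  note ch = insert.prems(5)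
  define SX where "SX = (\<lambda>t x. \<Sum>f\<in>F. t f * X f x)"
  define SY where "SY = (\<lambda>t x. \<Sum>f\<in>F. t f * Y f x)"
  have SXm [measurable]: "SX t \<in> borel_measurable M" for t
    unfolding SX_def by (intro borel_measurable_sum borel_measurable_times X borel_measurable_const)
  have SYm [measurable]: "SY t \<in> borel_measurable N" for t
    unfolding SY_def by (intro borel_measurable_sum borel_measurable_times Y borel_measurable_const)
  have intM: "integrable M (\<lambda>x. iexp (g x))" if [measurable]: "g \<in> borel_measurable M" for g
    by (rule M.integrable_const_bound[where B = 1]) auto
  have intN: "integrable N (\<lambda>x. iexp (g x))" if [measurable]: "g \<in> borel_measurable N" for g
    by (rule N.integrable_const_bound[where B = 1]) auto
  have joint: "(LINT x|M. iexp (s * X e x + c * SX t x))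
      = (LINT x|N. iexp (s * Y e x + c * SY t x))" for s t c
  proof -
    have *: "(\<Sum>f\<in>insert e F. (if f = e then s else c * t f) * X f x) = s * X e x + c * SX t x"
      "(\<Sum>f\<in>insert e F. (if f = e then s else c * t f) * Y f y) = s * Y e y + c * SY t y" for x y
    proof -
      have "(\<Sum>f\<in>F. (if f = e then s else c * t f) * X f x) = (\<Sum>f\<in>F. c * (t f * X f x))"
        "(\<Sum>f\<in>F. (if f = e then s else c * t f) * Y f y) = (\<Sum>f\<in>F. c * (t f * Y f y))"
        using insert.hyps(2) by (auto intro!: sum.cong)
      then show "(\<Sum>f\<in>insert e F. (if f = e then s else c * t f) * X f x) = s * X e x + c * SX t x"
        "(\<Sum>f\<in>insert e F. (if f = e then s else c * t f) * Y f y) = s * Y e y + c * SY t y"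
        using insert.hyps by (simp_all add: SX_def SY_def sum_distrib_left)
    qed
    show ?thesis using ch[of "\<lambda>f. if f = e then s else c * t f"] unfolding * .
  qed
  \<comment> \<open>Euler's formula splits the cosine into frequencies 1 and -1 of \<open>S\<close>,
    so three values of the joint transform suffice. The free phase \<open>a\<close> is what later
    also gives the sine.\<close>
  have cosexp: "(1 + cos (S + a)) *\<^sub>R iexp (s * z) =
      iexp (s * z + 0 * S)
      + (iexp a / 2) * iexp (s * z + 1 * S)
      + (exp (- \<i> * complex_of_real a) / 2) * iexp (s * z + (-1) * S)" for S a s z :: real
  proof -
    have "complex_of_real (cos (S + a)) = (iexp (S + a) + exp (- (\<i> * complex_of_real (S + a)))) / 2"
      by (simp add: cos_of_real[symmetric] cos_exp_eq del: cos_of_real of_real_add)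
    then show ?thesis
      by (simp add: scaleR_conv_of_real distrib_left distrib_right add_divide_distrib exp_add[symmetric] algebra_simps)
  qed
  have wt: "(LINT x|M. (1 + cos (SX t x + a)) * indicator (A e) (X e x))
      = (LINT x|N. (1 + cos (SY t x + a)) * indicator (A e) (Y e x))" for t a
  proof (rule char_unique_weighted[OF insert.prems(1,2) _ _ _ _ _ _ _ _ _ A, where C = 2])
    fix s
    have "(LINT x|M. (1 + cos (SX t x + a)) *\<^sub>R iexp (s * X e x))
      = (LINT x|M. iexp (s * X e x + 0 * SX t x))
      + (iexp a / 2) * (LINT x|M. iexp (s * X e x + 1 * SX t x))
      + (exp (- \<i> * complex_of_real a) / 2) * (LINT x|M. iexp (s * X e x + (-1) * SX t x))"
      unfolding cosexp
      by (subst Bochner_Integration.integral_add Bochner_Integration.integral_mult_right_zero,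
          (intro Bochner_Integration.integrable_add integrable_mult_right intM; measurable)+)+ simp
    moreover have "(LINT x|N. (1 + cos (SY t x + a)) *\<^sub>R iexp (s * Y e x))
      = (LINT x|N. iexp (s * Y e x + 0 * SY t x))
      + (iexp a / 2) * (LINT x|N. iexp (s * Y e x + 1 * SY t x))
      + (exp (- \<i> * complex_of_real a) / 2) * (LINT x|N. iexp (s * Y e x + (-1) * SY t x))"
      unfolding cosexp
      by (subst Bochner_Integration.integral_add Bochner_Integration.integral_mult_right_zero,
          (intro Bochner_Integration.integrable_add integrable_mult_right intN; measurable)+)+ simp
    ultimately show "(LINT x|M. (1 + cos (SX t x + a)) *\<^sub>R iexp (s * X e x))
      = (LINT x|N. (1 + cos (SY t x + a)) *\<^sub>R iexp (s * Y e x))"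
      by (simp only: joint)
  qed (use cos_le_one cos_ge_minus_one in \<open>auto simp: add_increasing2 minus_le_iff add.commute[of 1] le_diff_eq[symmetric] diff_le_eq[symmetric]\<close>)
  have one: "(LINT x|M. indicator (A e) (X e x) :: real) = (LINT x|N. indicator (A e) (Y e x))"
  proof -
    \<comment> \<open>The coefficient of the remaining sum is set to 0 here, so the frequencies
      \<open>t\<close> inside it are immaterial.\<close>
    have "(LINT x|M. 1 * indicator (A e) (X e x)) = (LINT x|N. 1 * indicator (A e) (Y e x) :: real)"
      using joint[of _ 0 undefined]
      by (intro char_unique_weighted[OF insert.prems(1,2) _ _ _ _ _ _ _ _ _ A, where C = 1]) auto
    then show ?thesis by simp
  qed
  have iM: "integrable M (\<lambda>x. g x * indicator (A e) (X e x))"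
    if [measurable]: "g \<in> borel_measurable M" and b: "\<And>x. \<bar>g x\<bar> \<le> 1" for g :: "'a \<Rightarrow> real"
    using b by (intro M.integrable_const_bound[where B = 1]) (auto simp: indicator_def)
  have iN: "integrable N (\<lambda>x. g x * indicator (A e) (Y e x))"
    if [measurable]: "g \<in> borel_measurable N" and b: "\<And>x. \<bar>g x\<bar> \<le> 1" for g :: "'b \<Rightarrow> real"
    using b by (intro N.integrable_const_bound[where B = 1]) (auto simp: indicator_def)
  have cs: "(LINT x|M. cos (SX t x + a) * indicator (A e) (X e x))
      = (LINT x|N. cos (SY t x + a) * indicator (A e) (Y e x))" for t a
  proof -
    have "(LINT x|M. (1 + cos (SX t x + a)) * indicator (A e) (X e x))
      = (LINT x|M. 1 * indicator (A e) (X e x)) + (LINT x|M. cos (SX t x + a) * indicator (A e) (X e x))"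
      unfolding distrib_right by (intro Bochner_Integration.integral_add iM) auto
    moreover have "(LINT x|N. (1 + cos (SY t x + a)) * indicator (A e) (Y e x))
      = (LINT x|N. 1 * indicator (A e) (Y e x)) + (LINT x|N. cos (SY t x + a) * indicator (A e) (Y e x))"
      unfolding distrib_right by (intro Bochner_Integration.integral_add iN) auto
    ultimately show ?thesis using wt[of t a] one by simp
  qed
  \<comment> \<open>The event for the new coordinate is absorbed into the measure. This is why the
    induction runs over arbitrary finite measures instead of probability measures.\<close>
  define M' where "M' = density M (\<lambda>x. indicator (A e) (X e x))"
  define N' where "N' = density N (\<lambda>x. indicator (A e) (Y e x))"
  have M'_eq: "M' = density M (indicator (X e -` A e \<inter> space M))"
    unfolding M'_def by (intro density_cong) (auto simp: indicator_def)
  have N'_eq: "N' = density N (indicator (Y e -` A e \<inter> space N))"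
    unfolding N'_def by (intro density_cong) (auto simp: indicator_def)
  have fin': "finite_measure M'" "finite_measure N'"
    unfolding M'_eq N'_eq by (auto intro!: M.finite_measure_restricted N.finite_measure_restricted)
  \<comment> \<open>The phase \<open>- pi / 2\<close> turns the cosine into the sine, so the cosine
    identities recover the full transform under the restricted measures.\<close>
  have expcs: "iexp S = complex_of_real (cos (S + 0)) + \<i> * complex_of_real (cos (S + (- pi / 2)))" for S
    by (simp add: exp_Euler cos_of_real sin_of_real cos_diff)
  have "measure M' {x \<in> space M'. \<forall>f\<in>F. X f x \<in> A f} = measure N' {x \<in> space N'. \<forall>f\<in>F. Y f x \<in> A f}"
  proof (rule insert.IH[OF fin'])
    fix t
    have "(LINT x|M'. iexp (SX t x))
      = (LINT x|M. complex_of_real (cos (SX t x + 0) * indicator (A e) (X e x)) + \<i> * complex_of_real (cos (SX t x + (- pi / 2)) * indicator (A e) (X e x)))"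
      unfolding M'_def ennreal_indicator[symmetric]
      by (subst integral_density) (auto simp: expcs scaleR_conv_of_real distrib_left mult_ac intro!: Bochner_Integration.integral_cong)
    also have "\<dots> = complex_of_real (LINT x|M. cos (SX t x + 0) * indicator (A e) (X e x)) + \<i> * complex_of_real (LINT x|M. cos (SX t x + (- pi / 2)) * indicator (A e) (X e x))"
      by (subst Bochner_Integration.integral_add)
         (auto intro!: integrable_mult_right integrable_of_real iM simp del: of_real_mult)
    also have "\<dots> = complex_of_real (LINT x|N. cos (SY t x + 0) * indicator (A e) (Y e x)) + \<i> * complex_of_real (LINT x|N. cos (SY t x + (- pi / 2)) * indicator (A e) (Y e x))"
      unfolding cs ..
    also have "\<dots> = (LINT x|N. complex_of_real (cos (SY t x + 0) * indicator (A e) (Y e x)) + \<i> * complex_of_real (cos (SY t x + (- pi / 2)) * indicator (A e) (Y e x)))"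
      by (subst Bochner_Integration.integral_add)
         (auto intro!: integrable_mult_right integrable_of_real iN simp del: of_real_mult)
    also have "\<dots> = (LINT x|N'. iexp (SY t x))"
      unfolding N'_def ennreal_indicator[symmetric]
      by (subst integral_density) (auto simp: expcs scaleR_conv_of_real distrib_left mult_ac intro!: Bochner_Integration.integral_cong)
    finally show "(LINT x|M'. iexp (\<Sum>e\<in>F. t e * X e x))
      = (LINT x|N'. iexp (\<Sum>e\<in>F. t e * Y e x))"
      by (simp add: SX_def SY_def)
  qed (use X Y insert.prems(6) in \<open>auto simp: M'_def N'_def\<close>)
  moreover have "measure M' {x \<in> space M'. \<forall>f\<in>F. X f x \<in> A f} = measure M {x \<in> space M. \<forall>f\<in>insert e F. X f x \<in> A f}"
  proof -
    have "{x \<in> space M. \<forall>f\<in>F. X f x \<in> A f} \<in> sets M"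
      using insert.hyps(1) insert.prems(6) X by (intro sets.sets_Collect_finite_All) auto
    then show ?thesis
      unfolding M'_eq by (subst measure_restricted) (auto intro!: arg_cong[where f = "measure M"])
  qed
  moreover have "measure N' {x \<in> space N'. \<forall>f\<in>F. Y f x \<in> A f} = measure N {x \<in> space N. \<forall>f\<in>insert e F. Y f x \<in> A f}"
  proof -
    have "{x \<in> space N. \<forall>f\<in>F. Y f x \<in> A f} \<in> sets N"
      using insert.hyps(1) insert.prems(6) Y by (intro sets.sets_Collect_finite_All) auto
    then show ?thesis
      unfolding N'_eq by (subst measure_restricted) (auto intro!: arg_cong[where f = "measure N"])
  qed
  ultimately show ?case by simp
qed

text \<open>In coordinates with respect to \<open>E\<close>, equality on rectangles is
  \<open>joint_char_unique\<close>, and rectangles determine a finite measure on the product space.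
  Both measures are carried by \<open>span E\<close>, where the coordinates recover the point, so
  the equality can be pulled back.\<close>

lemma measure_eqI_char:
  fixes M N :: "'a::{real_inner,second_countable_topology} measure"
  assumes fM: "finite_measure M" and fN: "finite_measure N"
    and s: "sets M = sets borel" "sets N = sets borel"
    and E: "orthonormal E"
    and AE: "AE y in M. y \<in> span E" "AE y in N. y \<in> span E"
    and ch: "\<And>\<tau>. \<tau> \<in> span E \<Longrightarrow> (LINT y|M. iexp (inner y \<tau>))
      = (LINT y|N. iexp (inner y \<tau>))"
  shows "M = N"
proof (rule measure_eqI)
  interpret M: finite_measure M by fact
  interpret N: finite_measure N by fact
  have fin: "finite E" using E by (simp add: orthonormal_def)
  have sp: "space M = UNIV" "space N = UNIV" using s sets_eq_imp_space_eq[of _ borel] by auto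
  note s[measurable_cong]
  let ?c = "\<lambda>y. \<lambda>e\<in>E. inner y e"
  let ?P = "Pi\<^sub>M E (\<lambda>_. borel :: real measure)"
  have c [measurable]: "?c \<in> M \<rightarrow>\<^sub>M ?P" "?c \<in> N \<rightarrow>\<^sub>M ?P" by measurable
  have eq: "(\<Sum>e\<in>E. t e * inner y e) = inner y (\<Sum>e\<in>E. t e *\<^sub>R e)" for t y
    by (simp add: inner_sum_right)
  have sum_in: "(\<Sum>e\<in>E. t e *\<^sub>R e) \<in> span E" for t :: "'a \<Rightarrow> real"
    by (intro span_sum span_scale span_base)
  have rect: "measure M {y \<in> space M. \<forall>e\<in>E. inner y e \<in> A e} = measure N {y \<in> space N. \<forall>e\<in>E. inner y e \<in> A e}"
    if "\<And>e. e \<in> E \<Longrightarrow> A e \<in> sets borel" for A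
    by (rule joint_char_unique[OF fin fM fN]) (use that in \<open>auto simp: eq ch sum_in\<close>)
  have dd: "distr M ?P ?c = distr N ?P ?c"
  proof (rule measure_eqI_PiM_finite[OF fin, where A = "\<lambda>_. space ?P"])
    fix A :: "'a \<Rightarrow> real set" assume A: "\<And>i. i \<in> E \<Longrightarrow> A i \<in> sets borel"
    have R: "Pi\<^sub>E E A \<in> sets ?P" using A fin by (intro sets_PiM_I_finite) auto
    have "?c -` Pi\<^sub>E E A \<inter> space M = {y \<in> space M. \<forall>e\<in>E. inner y e \<in> A e}"
      "?c -` Pi\<^sub>E E A \<inter> space N = {y \<in> space N. \<forall>e\<in>E. inner y e \<in> A e}"
      by (auto simp: PiE_def Pi_def)
    then show "emeasure (distr M ?P ?c) (Pi\<^sub>E E A) = emeasure (distr N ?P ?c) (Pi\<^sub>E E A)"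
      using R rect[OF A] by (simp add: emeasure_distr M.emeasure_eq_measure N.emeasure_eq_measure)
  next
    show "emeasure (distr M ?P ?c) (space ?P) \<noteq> \<infinity>"
      by (subst emeasure_distr) (auto simp: M.emeasure_eq_measure)
    show "range (\<lambda>_ :: nat. space ?P) \<subseteq> prod_algebra E (\<lambda>_. borel)"
      using prod_algebraI_finite[OF fin, of "\<lambda>_. UNIV" "\<lambda>_. borel :: real measure"] by (auto simp: space_PiM)
  qed auto
  show "sets M = sets N" using s by simp
  fix B assume "B \<in> sets M"
  then have B [measurable]: "B \<in> sets borel" using s by simp
  let ?g = "\<lambda>x. \<Sum>e\<in>E. x e *\<^sub>R e"
  have g [measurable]: "?g \<in> borel_measurable ?P"
    by (intro borel_measurable_sum borel_measurable_scaleR borel_measurable_const) simp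
  have gc: "?g (?c y) = y" if "y \<in> span E" for y
    using orthonormal_expand[OF E that] by (simp cong: sum.cong)
  have "emeasure M B = (\<integral>\<^sup>+y. indicator B (?g (?c y)) \<partial>M)"
  proof -
    have "emeasure M B = (\<integral>\<^sup>+y. indicator B y \<partial>M)" using B s by simp
    also have "\<dots> = (\<integral>\<^sup>+y. indicator B (?g (?c y)) \<partial>M)"
      using AE(1) by (intro nn_integral_cong_AE) (auto elim!: eventually_mono simp only: gc)
    finally show ?thesis .
  qed
  also have "\<dots> = (\<integral>\<^sup>+x. indicator B (?g x) \<partial>distr M ?P ?c)"
    by (rule nn_integral_distr[symmetric]) measurable
  also have "\<dots> = (\<integral>\<^sup>+y. indicator B (?g (?c y)) \<partial>N)"
    unfolding dd by (rule nn_integral_distr) measurable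
  also have "\<dots> = emeasure N B"
  proof -
    have "emeasure N B = (\<integral>\<^sup>+y. indicator B y \<partial>N)" using B s by simp
    also have "\<dots> = (\<integral>\<^sup>+y. indicator B (?g (?c y)) \<partial>N)"
      using AE(2) by (intro nn_integral_cong_AE) (auto elim!: eventually_mono simp only: gc)
    finally show ?thesis by simp
  qed
  finally show "emeasure M B = emeasure N B" .
qed

section \<open>The injection of \<open>H\<close> into \<open>B\<close>\<close>

lemma nn_integral_leb_on_singleton:
  fixes e :: "'a::{real_inner,second_countable_topology}"
  assumes "g \<in> borel_measurable borel"
  shows "(\<integral>\<^sup>+y. g y \<partial>leb_on {e}) = (\<integral>\<^sup>+t. g (t *\<^sub>R e) \<partial>lborel)"
proof -
  have "(\<integral>\<^sup>+y. g y \<partial>leb_on {e}) = (\<integral>\<^sup>+x. g (x e *\<^sub>R e) \<partial>PL {e})"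
    using assms by (simp add: nn_integral_frame_leb)
  also have "\<dots> = (\<integral>\<^sup>+t. g (t *\<^sub>R e) \<partial>lborel)"
    by (rule PL.product_nn_integral_singleton[where f = "\<lambda>t. g (t *\<^sub>R e)"])
      (use assms in \<open>measurable\<close>)
  finally show ?thesis .
qed

text \<open>For \<open>t\<close> between 1 and 2 the point \<open>t *\<^sub>R e\<close> of the line
  has \<open>nrm\<close> above \<open>\<epsilon>\<close>, and the normal density there is at least
  \<open>exp (- 2) / sqrt (2 * pi)\<close>. The interval has length 1.\<close>

lemma measure_std_gaussian_line:
  fixes x :: "'a::{real_inner,polish_space}" and nrm :: "'a \<Rightarrow> real"
  assumes x: "norm x = 1" and scale: "\<And>c y. nrm (c *\<^sub>R y) = \<bar>c\<bar> * nrm y"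
    and big: "nrm x \<ge> \<epsilon>" and \<epsilon>: "\<epsilon> > 0"
  shows "measure (std_gaussian (span {x})) {y \<in> span {x}. nrm y > \<epsilon>} \<ge> exp (- 2) / sqrt (2 * pi)"
proof -
  have onx: "orthonormal {x}" using x by (simp add: orthonormal_def norm_eq_1)
  define E where "E = (SOME E. orthonormal_basis (span {x}) E)"
  have "\<exists>E. orthonormal_basis (span {x}) E" using onx by (auto simp: orthonormal_basis_iff)
  then have E: "orthonormal E" "span E = span {x}"
    using someI_ex[of "orthonormal_basis (span {x})"] by (auto simp: E_def orthonormal_basis_iff)
  have d: "dim (span {x}) = 1" using orthonormal_dim[OF onx] by simp
  then have "card E = 1" using orthonormal_dim[OF E(1)] E(2) by simp
  then obtain e where e: "E = {e}" by (auto simp: card_1_singleton_iff)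
  have e1: "norm e = 1" using E(1) by (simp add: e orthonormal_def norm_eq_1)
  have "e \<in> span {x}" using E(2) span_base[of e E] e by simp
  then obtain c where c: "e = c *\<^sub>R x" by (auto simp: span_singleton)
  then have "\<bar>c\<bar> = 1" using e1 x by simp
  then have ne: "nrm e \<ge> \<epsilon>" using c scale big by simp
  define \<rho> where "\<rho> = (\<lambda>y :: 'a. ennreal (exp (- (norm y)\<^sup>2 / 2) / sqrt (2 * pi)))"
  have \<rho>: "\<rho> \<in> borel_measurable borel" unfolding \<rho>_def by measurable
  let ?A = "{y \<in> span {x}. nrm y > \<epsilon>}"
  have G: "std_gaussian (span {x}) = density (leb_on {e}) \<rho>"
    unfolding std_gaussian_def lebesgue_subspace_eq E_def[symmetric] e d \<rho>_def by simp
  have te: "t *\<^sub>R e \<in> span {x}" for t using \<open>e \<in> span {x}\<close> by (rule span_scale)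
  have A_eq: "?A = span {x} \<inter> {y. \<bar>inner y e\<bar> * nrm e > \<epsilon>}"
  proof -
    have "nrm y = \<bar>inner y e\<bar> * nrm e" if "y \<in> span {x}" for y
    proof -
      have "y \<in> span {e}" using that E(2) e by simp
      then obtain t where t: "y = t *\<^sub>R e" by (auto simp: span_singleton)
      have "inner y e = t" using e1 t by (simp add: norm_eq_1)
      then show ?thesis by (simp only: scale t)
    qed
    then show ?thesis by auto
  qed
  have A: "?A \<in> sets borel"
    unfolding A_eq
    by (intro sets.Int borel_closed closed_span_orthonormal[OF onx] borel_open open_Collect_less continuous_intros)
  have em: "emeasure (std_gaussian (span {x})) ?A = (\<integral>\<^sup>+t. \<rho> (t *\<^sub>R e) * indicator ?A (t *\<^sub>R e) \<partial>lborel)"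
    unfolding G using A \<rho>
    by (subst emeasure_density) (auto simp: nn_integral_leb_on_singleton)
  \<comment> \<open>The lower bound for \<open>measure\<close> also needs finiteness, since
    \<open>measure\<close> is 0 by convention on sets of infinite mass.\<close>
  have "emeasure (std_gaussian (span {x})) ?A \<le> (\<integral>\<^sup>+t. ennreal (std_normal_density t) \<partial>lborel)"
    unfolding em
    by (intro nn_integral_mono) (auto simp: \<rho>_def e1 std_normal_density_def indicator_def)
  also have "\<dots> = 1"
  proof -
    interpret prob_space "density lborel std_normal_density" by (rule prob_space_normal_density) simp
    show ?thesis using emeasure_space_1 by (simp add: emeasure_density)
  qed
  finally have "emeasure (std_gaussian (span {x})) ?A \<le> 1" .
  then have fin: "emeasure (std_gaussian (span {x})) ?A < \<infinity>" by (rule order_le_less_trans) simp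
  \<comment> \<open>The interval is open at 1 because \<open>nrm y > \<epsilon>\<close> is strict
    while \<open>nrm x\<close> may equal \<open>\<epsilon>\<close>.\<close>
  have "ennreal (exp (- 2) / sqrt (2 * pi)) = (\<integral>\<^sup>+t. ennreal (exp (- 2) / sqrt (2 * pi)) * indicator {1<..2} t \<partial>(lborel :: real measure))"
    by (subst nn_integral_cmult_indicator) simp_all
  also have "\<dots> \<le> emeasure (std_gaussian (span {x})) ?A"
    unfolding em
  proof (rule nn_integral_mono)
    fix t :: real
    show "ennreal (exp (- 2) / sqrt (2 * pi)) * indicator {1<..2} t \<le> \<rho> (t *\<^sub>R e) * indicator ?A (t *\<^sub>R e)"
    proof (cases "t \<in> {1<..2}")
      case True
      have "1 * \<epsilon> < t * nrm e" using True ne \<epsilon> by (intro mult_less_le_imp_less) auto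
      then have "t *\<^sub>R e \<in> ?A" using te scale True by auto
      moreover have "t\<^sup>2 \<le> 2\<^sup>2" using True by (intro power_mono) auto
      ultimately show ?thesis
        using True by (auto simp: \<rho>_def e1 intro!: ennreal_leI divide_right_mono)
    qed simp
  qed
  finally show ?thesis
    using fin by (subst (asm) emeasure_eq_ennreal_measure) (auto simp: less_top)
qed

text \<open>The definition of a measurable norm is applied to lines orthogonal to \<open>F\<close>:
  a unit vector there with \<open>nrm\<close> above \<open>\<epsilon>\<close> would give its line
  Gaussian mass at least \<open>\<epsilon>\<close>. On the finite-dimensional \<open>F\<close> a
  basis bounds the norm, and the two parts are added.\<close>

lemma measurable_norm_bounded:
  fixes nrm :: "'a::{real_inner,polish_space} \<Rightarrow> real"
  assumes "measurable_norm nrm"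
  obtains C where "C \<ge> 0" "\<And>x. nrm x \<le> C * norm x"
proof -
  have nn: "\<And>x. 0 \<le> nrm x" and tri: "\<And>x y. nrm (x + y) \<le> nrm x + nrm y"
    and scale: "\<And>c x. nrm (c *\<^sub>R x) = \<bar>c\<bar> * nrm x" and z: "\<And>x. nrm x = 0 \<longleftrightarrow> x = 0"
    using assms by (auto simp: measurable_norm_def)
  \<comment> \<open>Chosen equal to the lower bound for lines, so that this bound contradicts the
    strict inequality of the definition.\<close>
  define \<epsilon> where "\<epsilon> = exp (- 2 :: real) / sqrt (2 * pi)"
  have \<epsilon>: "\<epsilon> > 0" by (simp add: \<epsilon>_def)
  obtain F where F: "fin_dim_subspace F"
    "\<And>F'. fin_dim_subspace F' \<Longrightarrow> (\<forall>x\<in>F'. \<forall>y\<in>F. inner x y = 0) \<Longrightarrow>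
           measure (std_gaussian F') {x \<in> F'. nrm x > \<epsilon>} < \<epsilon>"
    using assms \<epsilon> unfolding measurable_norm_def by meson
  obtain B where B: "orthonormal B" "span B = F" using F(1) by (rule fin_dim_basis)
  then have PF: "proj_subspace F" using orthonormal_proj_subspace by blast
  have unit: "nrm x \<le> \<epsilon>" if x: "norm x = 1" "\<forall>y\<in>F. inner x y = 0" for x
  proof (rule ccontr)
    assume "\<not> nrm x \<le> \<epsilon>"
    then have "\<epsilon> \<le> measure (std_gaussian (span {x})) {y \<in> span {x}. nrm y > \<epsilon>}"
      using measure_std_gaussian_line[OF x(1) scale _ \<epsilon>] by (simp add: \<epsilon>_def)
    moreover have "fin_dim_subspace (span {x})" unfolding fin_dim_subspace_def by (intro exI[of _ "{x}"]) simp
    moreover have "\<forall>u\<in>span {x}. \<forall>y\<in>F. inner u y = 0" using x(2) by (auto simp: span_singleton)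
    ultimately show False using F(2) by fastforce
  qed
  have perp: "nrm x \<le> \<epsilon> * norm x" if "\<forall>y\<in>F. inner x y = 0" for x
  proof (cases "x = 0")
    case True
    then have "nrm x = 0" using z by blast
    then show ?thesis using True by simp
  next
    case False
    have "nrm (x /\<^sub>R norm x) \<le> \<epsilon>" using False that by (intro unit) auto
    then show ?thesis using False by (simp add: scale field_simps)
  qed
  have sum_le: "nrm (\<Sum>e\<in>S. f e) \<le> (\<Sum>e\<in>S. nrm (f e))" if "finite S" for S and f :: "'a \<Rightarrow> 'a"
    using that
  proof (induction S)
    case empty
    then show ?case using z[of 0] by simp
  next
    case (insert x S)
    then have "nrm (sum f (insert x S)) \<le> nrm (f x) + nrm (sum f S)" using tri by simp
    then show ?case using insert by simp
  qed
  show ?thesis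
  proof (rule that[of "\<epsilon> + (\<Sum>e\<in>B. nrm e)"])
    show "\<epsilon> + (\<Sum>e\<in>B. nrm e) \<ge> 0" using \<epsilon> nn by (simp add: sum_nonneg add_nonneg_nonneg)
    fix x
    have "nrm x \<le> nrm (x - orth_proj F x) + nrm (orth_proj F x)"
      using tri[of "x - orth_proj F x" "orth_proj F x"] by simp
    also have "nrm (x - orth_proj F x) \<le> \<epsilon> * norm (x - orth_proj F x)"
      by (intro perp) (auto intro: orth_proj_orth[OF PF])
    also have "\<dots> \<le> \<epsilon> * norm x"
    proof -
      have "(norm (x - orth_proj F x))\<^sup>2 \<le> (norm x)\<^sup>2" using norm_orth_proj_pythagoras[OF PF, of x] by simp
      then have "norm (x - orth_proj F x) \<le> norm x" by (rule power2_le_imp_le) simp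
      then show ?thesis using \<epsilon> by simp
    qed
    also have "nrm (orth_proj F x) \<le> norm x * (\<Sum>e\<in>B. nrm e)"
    proof -
      have "nrm (orth_proj F x) = nrm (\<Sum>e\<in>B. inner x e *\<^sub>R e)"
        using orth_proj_orthonormal[OF B(1)] B(2) by simp
      also have "\<dots> \<le> (\<Sum>e\<in>B. nrm (inner x e *\<^sub>R e))" using B(1) by (intro sum_le) (simp add: orthonormal_def)
      also have "\<dots> \<le> (\<Sum>e\<in>B. norm x * nrm e)"
      proof (rule sum_mono)
        fix e assume "e \<in> B"
        then have "norm e = 1" using B(1) by (simp add: orthonormal_def norm_eq_1)
        then have "\<bar>inner x e\<bar> \<le> norm x" using Cauchy_Schwarz_ineq2[of x e] by simp
        then show "nrm (inner x e *\<^sub>R e) \<le> norm x * nrm e"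
          unfolding scale using nn by (intro mult_right_mono)
      qed
      finally show ?thesis by (simp add: sum_distrib_left)
    qed
    finally show "nrm x \<le> (\<epsilon> + (\<Sum>e\<in>B. nrm e)) * norm x" by (simp add: algebra_simps)
  qed
qed

text \<open>The bound makes \<open>\<psi>\<close> depend only on \<open>j x\<close> and be Lipschitz
  as a function on the range of \<open>j\<close>. It therefore extends to the closure, and linearity
  passes to limits.\<close>

lemma extend_functional_dense:
  fixes j :: "'a::real_vector \<Rightarrow> 'b::banach" and \<psi> :: "'a \<Rightarrow> real"
  assumes j: "linear j" "closure (range j) = UNIV" and \<psi>: "linear \<psi>" "\<And>x. \<bar>\<psi> x\<bar> \<le> C * norm (j x)"
  obtains \<phi> :: "'b \<Rightarrow>\<^sub>L real" where "\<And>x. blinfun_apply \<phi> (j x) = \<psi> x"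
proof -
  have \<psi>_cong: "\<psi> x = \<psi> y" if "j x = j y" for x y
    using \<psi>(2)[of "x - y"] that by (simp add: linear_diff[OF j(1)] linear_diff[OF \<psi>(1)])
  define f where "f = (\<lambda>u. \<psi> (inv j u))"
  have f: "f (j x) = \<psi> x" for x unfolding f_def by (rule \<psi>_cong) (simp add: f_inv_into_f)
  have "\<bar>C\<bar>-lipschitz_on (range j) f"
  proof (rule lipschitz_onI)
    fix u v assume "u \<in> range j" "v \<in> range j"
    then obtain x y where xy: "u = j x" "v = j y" by blast
    have "dist (f u) (f v) = \<bar>\<psi> (x - y)\<bar>" by (simp add: xy f dist_real_def linear_diff[OF \<psi>(1)])
    also have "\<dots> \<le> C * dist u v"
      using \<psi>(2)[of "x - y"] by (simp add: xy dist_norm linear_diff[OF j(1)])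
    also have "\<dots> \<le> \<bar>C\<bar> * dist u v" by (intro mult_right_mono) auto
    finally show "dist (f u) (f v) \<le> \<bar>C\<bar> * dist u v" .
  qed simp
  from lipschitz_extend_closure[OF this] j(2)
  obtain g where g: "\<bar>C\<bar>-lipschitz_on UNIV g" "\<And>u. u \<in> range j \<Longrightarrow> g u = f u" by auto
  have gj: "g (j x) = \<psi> x" for x using g(2) f by simp
  have cont: "isCont g u" for u
    using lipschitz_on_continuous_on[OF g(1)] by (simp add: continuous_on_eq_continuous_at)
  have dense: "\<exists>x. (\<lambda>n. j (x n)) \<longlonglongrightarrow> u" for u
  proof -
    have "u \<in> closure (range j)" using j(2) by simp
    then obtain s where s: "\<forall>n. s n \<in> range j" "s \<longlonglongrightarrow> u" unfolding closure_sequential by blast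
    have "j (inv j (s n)) = s n" for n using s(1) by (simp add: f_inv_into_f)
    then show ?thesis using s(2) by (intro exI[of _ "\<lambda>n. inv j (s n)"]) simp
  qed
  have lim: "(\<lambda>n. \<psi> (x n)) \<longlonglongrightarrow> g u" if "(\<lambda>n. j (x n)) \<longlonglongrightarrow> u" for x u
    using isCont_tendsto_compose[OF cont that] by (simp add: gj)
  have "linear g"
  proof (rule linearI)
    fix u v
    obtain x y where x: "(\<lambda>n. j (x n)) \<longlonglongrightarrow> u" and y: "(\<lambda>n. j (y n)) \<longlonglongrightarrow> v" using dense by metis
    have "(\<lambda>n. j (x n + y n)) \<longlonglongrightarrow> u + v" using tendsto_add[OF x y] by (simp add: linear_add[OF j(1)])
    then have "(\<lambda>n. \<psi> (x n + y n)) \<longlonglongrightarrow> g (u + v)" by (rule lim)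
    moreover have "(\<lambda>n. \<psi> (x n + y n)) \<longlonglongrightarrow> g u + g v"
      using tendsto_add[OF lim[OF x] lim[OF y]] by (simp add: linear_add[OF \<psi>(1)])
    ultimately show "g (u + v) = g u + g v" by (rule LIMSEQ_unique)
  next
    fix c u
    obtain x where x: "(\<lambda>n. j (x n)) \<longlonglongrightarrow> u" using dense by metis
    have "(\<lambda>n. j (c *\<^sub>R x n)) \<longlonglongrightarrow> c *\<^sub>R u"
      using tendsto_scaleR[OF tendsto_const x] by (simp add: linear_scale[OF j(1)])
    then have "(\<lambda>n. \<psi> (c *\<^sub>R x n)) \<longlonglongrightarrow> g (c *\<^sub>R u)" by (rule lim)
    moreover have "(\<lambda>n. \<psi> (c *\<^sub>R x n)) \<longlonglongrightarrow> c *\<^sub>R g u"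
      using tendsto_scaleR[OF tendsto_const lim[OF x]] by (simp add: linear_scale[OF \<psi>(1)])
    ultimately show "g (c *\<^sub>R u) = c *\<^sub>R g u" by (rule LIMSEQ_unique)
  qed
  moreover have "norm (g u) \<le> norm u * \<bar>C\<bar>" for u
    using lipschitz_onD[OF g(1), of u 0] linear_0[OF \<open>linear g\<close>] by (simp add: mult.commute)
  ultimately have "bounded_linear g"
    by (intro bounded_linear_intro[where K = "\<bar>C\<bar>"]) (auto simp: linear_add linear_scale)
  then show ?thesis using gj by (intro that[of "Blinfun g"]) (simp add: bounded_linear_Blinfun_apply)
qed

section \<open>Density of the range of \<open>jstar\<close>\<close>

lemma subspace_closure:
  fixes S :: "'a::real_normed_vector set"
  assumes "subspace S"
  shows "subspace (closure S)"
proof (rule subspaceI)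
  show "0 \<in> closure S" using subspace_0[OF assms] closure_subset by blast
  show "x + y \<in> closure S" if xy: "x \<in> closure S" "y \<in> closure S" for x y
  proof -
    obtain f g where "\<forall>n. f n \<in> S" "f \<longlonglongrightarrow> x" "\<forall>n. g n \<in> S" "g \<longlonglongrightarrow> y"
      using xy unfolding closure_sequential by blast
    then show ?thesis
      unfolding closure_sequential using subspace_add[OF assms] tendsto_add[of f x sequentially g y]
      by (intro exI[of _ "\<lambda>n. f n + g n"]) simp
  qed
  show "c *\<^sub>R x \<in> closure S" if x: "x \<in> closure S" for c x
  proof -
    obtain f where "\<forall>n. f n \<in> S" "f \<longlonglongrightarrow> x" using x unfolding closure_sequential by blast
    then show ?thesis
      unfolding closure_sequential using subspace_scale[OF assms] tendsto_scaleR[OF tendsto_const[of c] \<open>f \<longlonglongrightarrow> x\<close>]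
      by (intro exI[of _ "\<lambda>n. c *\<^sub>R f n"]) simp
  qed
qed

text \<open>The setting of an abstract Wiener space in the sense of Gross, before any measure on
  \<open>B\<close> is fixed. The sort \<open>polish_space\<close> supplies completeness and
  separability of \<open>H\<close>.\<close>

locale wiener_space =
  fixes nrm :: "'h::{real_inner,polish_space} \<Rightarrow> real" and j :: "'h \<Rightarrow> 'b::banach"
  assumes norm: "measurable_norm nrm" and completion: "is_completion nrm j"
begin

lemma nrm: "0 \<le> nrm x" "nrm x = 0 \<longleftrightarrow> x = 0" "nrm (x + y) \<le> nrm x + nrm y" "nrm (c *\<^sub>R x) = \<bar>c\<bar> * nrm x"
  using norm by (auto simp: measurable_norm_def)

lemma j: "linear j" "norm (j x) = nrm x" "closure (range j) = UNIV"
  using completion by (auto simp: is_completion_def)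

lemma bounded_linear_j: "bounded_linear j"
proof -
  obtain C where "C \<ge> 0" "\<And>x. nrm x \<le> C * norm x" using norm by (rule measurable_norm_bounded) blast
  then show ?thesis
    using j by (intro bounded_linear_intro[where K = C]) (auto simp: linear_add linear_scale mult.commute)
qed

text \<open>Continuity of \<open>j\<close> makes \<open>\<phi>\<close> composed with
  \<open>j\<close> bounded on \<open>H\<close>, so Riesz representation gives meaning to the
  definite description in \<open>jstar\<close>.\<close>

lemma jstar_inner: "blinfun_apply \<phi> (j x) = inner (jstar j \<phi>) x"
proof -
  have "bounded_linear (\<lambda>x. blinfun_apply \<phi> (j x))"
    using bounded_linear_compose[OF blinfun.bounded_linear_right bounded_linear_j] .
  then obtain h where h: "\<forall>x. blinfun_apply \<phi> (j x) = inner h x" using riesz_representation by blast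
  have "jstar j \<phi> = h"
    unfolding jstar_def
  proof (rule the_equality)
    show "\<forall>x. blinfun_apply \<phi> (j x) = inner h x" by (rule h)
    fix h' assume "\<forall>x. blinfun_apply \<phi> (j x) = inner h' x"
    then have "inner h' x = inner h x" for x using h by metis
    then have "inner (h' - h) (h' - h) = 0" by (simp add: inner_diff_left)
    then show "h' = h" by simp
  qed
  then show ?thesis using h by simp
qed

text \<open>Instead of the Hahn--Banach theorem: the metric projection in \<open>H\<close> onto the closed unit ball of
  \<open>nrm\<close> gives a functional on \<open>H\<close> that is bounded with respect to \<open>nrm\<close>.\<close>

lemma functional_separates:
  assumes "h \<noteq> 0"
  shows "\<exists>\<phi> :: 'b \<Rightarrow>\<^sub>L real. blinfun_apply \<phi> (j h) \<noteq> 0"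
proof -
  define K where "K = {x. nrm x \<le> 1}"
  \<comment> \<open>Rescaled to have \<open>nrm\<close> equal to 2, hence outside the unit ball
    \<open>K\<close>, so that its distance vector \<open>g\<close> from \<open>K\<close> is
    nonzero.\<close>
  define h' where "h' = (2 / nrm h) *\<^sub>R h"
  have h: "nrm h > 0" using assms nrm(1,2)[of h] by (metis order_le_less)
  have h': "nrm h' = 2" using h by (simp add: h'_def nrm(4))
  have "continuous_on UNIV (\<lambda>x. norm (j x))"
    using bounded_linear_j by (intro continuous_on_norm linear_continuous_on)
  then have nc: "continuous_on UNIV nrm" by (simp add: j)
  have K: "closed K" "convex K" "0 \<in> K"
  proof -
    show "closed K" unfolding K_def by (intro closed_Collect_le nc continuous_intros)
    show "0 \<in> K" using nrm(2)[of 0] by (simp add: K_def)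
    show "convex K"
    proof (rule convexI)
      fix x y and u v :: real assume *: "x \<in> K" "y \<in> K" "0 \<le> u" "0 \<le> v" "u + v = 1"
      have "nrm (u *\<^sub>R x + v *\<^sub>R y) \<le> u * nrm x + v * nrm y"
        using nrm(3)[of "u *\<^sub>R x" "v *\<^sub>R y"] * by (simp add: nrm(4))
      also have "\<dots> \<le> u * 1 + v * 1" using * by (intro add_mono mult_left_mono) (auto simp: K_def)
      finally show "u *\<^sub>R x + v *\<^sub>R y \<in> K" using * by (simp add: K_def)
    qed
  qed
  let ?K' = "(\<lambda>k. h' - k) ` K"
  have "?K' = (\<lambda>k. h' + k) ` (uminus ` K)" by (auto simp: image_image)
  then have K': "closed ?K'" "convex ?K'" "?K' \<noteq> {}"
    using K closed_negations[OF K(1)] convex_negations[OF K(2)]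
    by (auto simp: closed_translation convex_translation)
  define g where "g = foot ?K'"
  have "g \<in> ?K'" unfolding g_def using K' by (rule foot_in)
  then obtain k0 where k0: "k0 \<in> K" "g = h' - k0" by blast
  have gmin: "norm g \<le> norm (h' - k)" if "k \<in> K" for k
    unfolding g_def using K' that by (intro norm_foot_le) auto
  have var: "inner g (k - k0) \<le> 0" if "k \<in> K" for k
    unfolding k0(2)
    by (rule any_closest_point_dot[OF K(2,1) k0(1) that]) (use gmin k0(2) in \<open>auto simp: dist_norm\<close>)
  define c where "c = inner g k0"
  have c0: "c \<ge> 0" using var[OF K(3)] by (simp add: c_def)
  \<comment> \<open>By the variational inequality, \<open>inner g\<close> attains its maximum over
    \<open>K\<close> at \<open>k0\<close>, with value \<open>c\<close>; homogeneity extends the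
    bound to every \<open>x\<close>. This is the continuity that lets \<open>inner g\<close> descend
    to \<open>B\<close>.\<close>
  have le: "inner g x \<le> c * nrm x" for x
  proof (cases "x = 0")
    case True
    then show ?thesis using nrm(2)[of 0] by simp
  next
    case False
    then have nx: "nrm x > 0" using nrm(1,2)[of x] by (metis order_le_less)
    have "x /\<^sub>R nrm x \<in> K" using nx by (simp add: K_def nrm(4))
    from var[OF this] have "inner g (x /\<^sub>R nrm x) \<le> c" by (simp add: c_def inner_diff_right)
    then show ?thesis using nx by (simp add: field_simps)
  qed
  have bd: "\<bar>inner g x\<bar> \<le> c * norm (j x)" for x
    using le[of x] le[of "- x"] nrm(4)[of "-1" x] by (simp add: j abs_le_iff)
  have "linear (inner g)" by (intro linearI) (auto simp: inner_add_right)
  from extend_functional_dense[OF j(1,3) this bd]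
  obtain \<phi> :: "'b \<Rightarrow>\<^sub>L real" where \<phi>: "\<And>x. blinfun_apply \<phi> (j x) = inner g x" by blast
  have "g \<noteq> 0" using k0 h' by (auto simp: K_def)
  have "inner g h' = inner g g + c" by (simp add: c_def k0(2) inner_diff_right)
  then have "inner g h' > 0" using c0 \<open>g \<noteq> 0\<close> by (simp add: add_pos_nonneg)
  then have "inner g h \<noteq> 0" by (auto simp: h'_def)
  then show ?thesis using \<phi> by metis
qed

lemma jstar_add: "jstar j (\<phi> + \<psi>) = jstar j \<phi> + jstar j \<psi>"
proof -
  have "inner (jstar j (\<phi> + \<psi>) - (jstar j \<phi> + jstar j \<psi>)) x = 0" for x
    by (simp add: inner_diff_left inner_add_left jstar_inner[symmetric] blinfun.add_left)
  from this[of "jstar j (\<phi> + \<psi>) - (jstar j \<phi> + jstar j \<psi>)"] show ?thesis by simp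
qed

lemma jstar_scale: "jstar j (c *\<^sub>R \<phi>) = c *\<^sub>R jstar j \<phi>"
proof -
  have "inner (jstar j (c *\<^sub>R \<phi>) - c *\<^sub>R jstar j \<phi>) x = 0" for x
    by (simp add: inner_diff_left jstar_inner[symmetric] blinfun.scaleR_left)
  from this[of "jstar j (c *\<^sub>R \<phi>) - c *\<^sub>R jstar j \<phi>"] show ?thesis by simp
qed

text \<open>A vector orthogonal to every \<open>jstar j \<phi>\<close> has an image under
  \<open>j\<close> that all functionals annihilate, so it is zero by
  \<open>functional_separates\<close>. This is applied to the residual of a projection onto the
  closure.\<close>

lemma closure_range_jstar: "closure (range (jstar j)) = (UNIV :: 'h set)"
proof -
  have "subspace (range (jstar j))"
  proof (rule subspaceI)
    show "0 \<in> range (jstar j)" using jstar_scale[of 0 0] by (auto intro: image_eqI[of _ _ 0])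
    show "x + y \<in> range (jstar j)" if "x \<in> range (jstar j)" "y \<in> range (jstar j)" for x y
      using that by (auto simp: jstar_add[symmetric])
    show "c *\<^sub>R x \<in> range (jstar j)" if "x \<in> range (jstar j)" for c x
      using that by (auto simp: jstar_scale[symmetric])
  qed
  then have P: "proj_subspace (closure (range (jstar j)))"
    by (intro closed_proj_subspace subspace_closure closed_closure)
  let ?Q = "orth_proj (closure (range (jstar j)))"
  have "x = ?Q x" for x
  proof (rule ccontr)
    assume "x \<noteq> ?Q x"
    then have "x - ?Q x \<noteq> 0" by simp
    then obtain \<phi> :: "'b \<Rightarrow>\<^sub>L real" where \<phi>: "blinfun_apply \<phi> (j (x - ?Q x)) \<noteq> 0"
      using functional_separates by blast
    have "jstar j \<phi> \<in> closure (range (jstar j))" by (intro subsetD[OF closure_subset]) simp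
    then have "inner (x - ?Q x) (jstar j \<phi>) = 0" by (rule orth_proj_orth[OF P])
    then show False using \<phi> by (simp add: jstar_inner inner_commute)
  qed
  then show ?thesis using orth_proj_mem[OF P] by (metis UNIV_eq_I)
qed

end

section \<open>The law of \<open>P\<^sup>B\<^sub>V\<close>\<close>

lemma norm_iexp_diff_le: "norm (iexp a - iexp b) \<le> \<bar>a - b\<bar>"
proof -
  have "iexp a - iexp b
      = iexp b * (iexp (a - b) - 1)"
    by (simp add: algebra_simps exp_add[symmetric])
  then show ?thesis using iexp_approx1[of "a - b" 0] by (simp add: norm_mult)
qed

lemma (in prob_space) expectation_abs_le_sqrt:
  fixes X :: "'a \<Rightarrow> real"
  assumes [measurable]: "X \<in> borel_measurable M" and i: "integrable M (\<lambda>x. (X x)\<^sup>2)"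
  shows "integrable M X" "expectation (\<lambda>x. \<bar>X x\<bar>) \<le> sqrt (expectation (\<lambda>x. (X x)\<^sup>2))"
proof -
  show iX: "integrable M X"
  proof (rule Bochner_Integration.integrable_bound)
    show "integrable M (\<lambda>x. 1 + (X x)\<^sup>2)" using i by simp
    show "AE x in M. norm (X x) \<le> norm (1 + (X x)\<^sup>2)"
    proof (intro AE_I2)
      fix x
      have "0 \<le> (\<bar>X x\<bar> - 1)\<^sup>2" by simp
      also have "\<dots> = (X x)\<^sup>2 - 2 * \<bar>X x\<bar> + 1" by (simp add: power2_eq_square algebra_simps)
      finally show "norm (X x) \<le> norm (1 + (X x)\<^sup>2)" by simp
    qed
  qed simp
  have "0 \<le> expectation (\<lambda>x. \<bar>X x\<bar>\<^sup>2) - (expectation (\<lambda>x. \<bar>X x\<bar>))\<^sup>2"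
    using variance_eq[of "\<lambda>x. \<bar>X x\<bar>"] variance_positive[of "\<lambda>x. \<bar>X x\<bar>"] iX i by simp
  then show "expectation (\<lambda>x. \<bar>X x\<bar>) \<le> sqrt (expectation (\<lambda>x. (X x)\<^sup>2))"
    by (intro real_le_rsqrt) simp
qed

context wiener_space
begin

text \<open>On the range of \<open>jstar j\<close> this is the defining formula of
  \<open>\<mu>\<close> at \<open>t = 1\<close>. Both sides are continuous in \<open>h\<close>, the
  left one Lipschitz because the operator bound of \<open>I\<close> controls first moments, so
  density gives the rest.\<close>

lemma char_I_L:
  fixes L :: "'h set"
  assumes L: "affine L" "closed L" "L \<noteq> {}" and mu: "is_mu_L j L \<mu>" and I: "is_I_L j \<mu> I"
  shows "(LINT x|\<mu>. iexp (I h x)) =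
    exp (\<i> * complex_of_real (inner (foot L) h) - complex_of_real ((norm (orth_proj (direction L) h))\<^sup>2 / 2))"
proof -
  interpret prob_space \<mu> using mu by (simp add: is_mu_L_def)
  have ft: "foot L \<in> L" using L by (intro foot_in affine_imp_convex)
  have PD: "proj_subspace (direction L)"
    using L ft by (intro closed_proj_subspace subspace_direction closed_direction)
  have [measurable]: "I h \<in> borel_measurable \<mu>" and I2: "integrable \<mu> (\<lambda>x. (I h x)\<^sup>2)" for h
    using I by (auto simp: is_I_L_def)
  have add: "AE x in \<mu>. I (h + k) x = I h x + I k x" for h k using I by (auto simp: is_I_L_def)
  have scale: "AE x in \<mu>. I (c *\<^sub>R h) x = c * I h x" for c h using I by (auto simp: is_I_L_def)
  obtain K where K: "\<And>h. sqrt (LINT x|\<mu>. (I h x)\<^sup>2) \<le> K * norm h" using I unfolding is_I_L_def by blast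
  have ext: "AE x in \<mu>. I (jstar j \<phi>) x = blinfun_apply \<phi> x" for \<phi> using I by (auto simp: is_I_L_def)
  define ch where "ch = (\<lambda>h. LINT x|\<mu>. iexp (I h x))"
  define ga where "ga = (\<lambda>h. exp (\<i> * complex_of_real (inner (foot L) h)
      - complex_of_real ((norm (orth_proj (direction L) h))\<^sup>2 / 2)))"
  have iexp_int: "integrable \<mu> (\<lambda>x. iexp (I h x))" for h
    by (rule integrable_const_bound[where B = 1]) auto
  have base: "ch (jstar j \<phi>) = ga (jstar j \<phi>)" for \<phi>
  proof -
    have s: "sets \<mu> = sets borel" using mu by (simp add: is_mu_L_def)
    have m: "blinfun_apply \<phi> \<in> borel_measurable \<mu>"
      unfolding measurable_cong_sets[OF s refl]
      by (intro borel_measurable_continuous_onI linear_continuous_on blinfun.bounded_linear_right)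
    have "ch (jstar j \<phi>) = (LINT x|\<mu>. iexp (1 * blinfun_apply \<phi> x))"
      unfolding ch_def using ext[of \<phi>] m by (intro integral_cong_AE) (auto elim!: eventually_mono)
    also have "\<dots> = exp (\<i> * complex_of_real (1 * inner (foot L) (jstar j \<phi>))
             - complex_of_real (1\<^sup>2 / 2 * (norm (orth_proj (direction L) (jstar j \<phi>)))\<^sup>2))"
      using mu unfolding is_mu_L_def by blast
    finally show ?thesis by (simp add: ga_def)
  qed
  have lip: "norm (ch h - ch k) \<le> K * norm (h - k)" for h k
  proof -
    have eq: "AE x in \<mu>. I h x - I k x = I (h - k) x"
      using add[of "h - k" k] by (rule eventually_mono) simp
    have "norm (ch h - ch k) = norm (LINT x|\<mu>. iexp (I h x) - iexp (I k x))"
      unfolding ch_def by (subst Bochner_Integration.integral_diff[OF iexp_int iexp_int]) simp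
    also have "\<dots> \<le> (LINT x|\<mu>. norm (iexp (I h x) - iexp (I k x)))"
      by (rule integral_norm_bound)
    also have "\<dots> \<le> (LINT x|\<mu>. \<bar>I (h - k) x\<bar>)"
    proof (rule integral_mono_AE)
      show "AE x in \<mu>. norm (iexp (I h x) - iexp (I k x)) \<le> \<bar>I (h - k) x\<bar>"
        using eq by (rule eventually_mono) (metis norm_iexp_diff_le)
      show "integrable \<mu> (\<lambda>x. \<bar>I (h - k) x\<bar>)" using expectation_abs_le_sqrt(1)[OF _ I2] by auto
      show "integrable \<mu> (\<lambda>x. norm (iexp (I h x) - iexp (I k x)))"
        using iexp_int by (intro integrable_norm Bochner_Integration.integrable_diff)
    qed
    also have "\<dots> \<le> sqrt (LINT x|\<mu>. (I (h - k) x)\<^sup>2)" using expectation_abs_le_sqrt(2)[OF _ I2] by auto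
    also have "\<dots> \<le> K * norm (h - k)" by (rule K)
    finally show ?thesis .
  qed
  have "h \<in> closure (range (jstar j))" using closure_range_jstar by simp
  then obtain s where s: "\<forall>n. s n \<in> range (jstar j)" "s \<longlonglongrightarrow> h" unfolding closure_sequential by blast
  have "(\<lambda>n. ch (s n)) \<longlonglongrightarrow> ch h"
  proof (rule LIM_zero_cancel, rule Lim_null_comparison)
    show "\<forall>\<^sub>F n in sequentially. norm (ch (s n) - ch h) \<le> K * norm (s n - h)" using lip by simp
    have "(\<lambda>n. K * norm (s n - h)) \<longlonglongrightarrow> K * norm (h - h)" by (intro tendsto_intros s)
    then show "(\<lambda>n. K * norm (s n - h)) \<longlonglongrightarrow> 0" by simp
  qed
  moreover have "ch (s n) = ga (s n)" for n
  proof -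
    obtain \<phi> where "s n = jstar j \<phi>" using s(1) by blast
    then show ?thesis using base[of \<phi>] by (simp only:)
  qed
  moreover have "(\<lambda>n. ga (s n)) \<longlonglongrightarrow> ga h"
    unfolding ga_def
    by (intro tendsto_intros s bounded_linear.tendsto[OF bounded_linear_orth_proj[OF PD]]) simp
  ultimately have "ch h = ga h" using LIMSEQ_unique by auto
  then show ?thesis by (simp add: ch_def ga_def)
qed

lemma I_L_sum:
  assumes I: "is_I_L j \<mu> I" and fin: "finite F"
  shows "AE x in \<mu>. I (\<Sum>h\<in>F. c h *\<^sub>R h) x = (\<Sum>h\<in>F. c h * I h x)"
  using fin
proof (induction F)
  have add: "AE x in \<mu>. I (h + k) x = I h x + I k x" for h k using I by (auto simp: is_I_L_def)
  have scale: "AE x in \<mu>. I (c *\<^sub>R h) x = c * I h x" for c h using I by (auto simp: is_I_L_def)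
  {
    case empty
    show ?case using scale[of 0 0] by (rule eventually_mono) simp
  next
    case (insert e F)
    show ?case using insert.IH add[of "c e *\<^sub>R e" "\<Sum>h\<in>F. c h *\<^sub>R h"] scale[of "c e" e]
    proof eventually_elim
      case (elim x)
      then show ?case using insert.hyps by simp
    qed
  }
qed

text \<open>The law is identified with that of \<open>?P (?p + ?s x)\<close>, where the coordinates
  \<open>x\<close> are independent standard normals indexed by \<open>B\<close>. The characteristic
  functions agree because \<open>span B\<close> is the projection of \<open>V\<close> to
  \<open>direction L\<close>. The explicit Gaussian is then moved to \<open>V\<close> by
  \<open>fiber_integral\<close>.\<close>

lemma proj_B_density:
  fixes L V :: "'h set"
  assumes L: "affine L" "closed L" "L \<noteq> {}" and mu: "is_mu_L j L \<mu>" and I: "is_I_L j \<mu> I"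
    and E: "orthonormal E" "span E = V" and onto: "orth_proj V ` L = V"
  obtains c where "c > 0" "(\<lambda>v. minsq L V (orth_proj V v)) \<in> borel_measurable borel"
    "proj_B I E \<in> borel_measurable \<mu>"
    "\<forall>F\<in>borel_measurable borel. (\<integral>\<^sup>+x. F (proj_B I E x) \<partial>\<mu>)
      = ennreal c * (\<integral>\<^sup>+v. F v * ennreal (exp (- minsq L V v / 2)) \<partial>leb_on E)"
proof -
  interpret prob_space \<mu> using mu by (simp add: is_mu_L_def)
  have Im [measurable]: "I h \<in> borel_measurable \<mu>" for h using I by (auto simp: is_I_L_def)
  let ?P = "orth_proj V" and ?p = "foot L" and ?D = "direction L"
  have ft: "?p \<in> L" using L by (intro foot_in affine_imp_convex)
  have PD: "proj_subspace ?D"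
    using L ft by (intro closed_proj_subspace subspace_direction closed_direction)
  have PV: "proj_subspace V" using orthonormal_proj_subspace[OF E(1)] E(2) by simp
  note linP = linear_orth_proj[OF PV]
  have finE: "finite E" using E(1) by (simp add: orthonormal_def)
  have P_meas [measurable]: "?P \<in> borel_measurable borel"
    by (intro borel_measurable_continuous_onI continuous_orth_proj PV)
  obtain B c0 where c0: "c0 > 0" and B: "orthonormal B" "span B \<subseteq> ?D" "card B \<le> card E"
    and QV: "span B = orth_proj ?D ` V"
    and "\<forall>w\<in>?D. (\<forall>e\<in>B. inner w e = 0) \<longrightarrow> ?P w = 0"
    and FI: "\<forall>F\<in>borel_measurable borel. \<forall>w\<in>borel_measurable borel.
      (\<integral>\<^sup>+u. F (?P (?p + u)) * w ((norm ?p)\<^sup>2 + (norm u)\<^sup>2) \<partial>leb_on B)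
      = ennreal c0 * (\<integral>\<^sup>+v. F v * w (minsq L V v) \<partial>leb_on E)"
    and mm: "(\<lambda>v. minsq L V (?P v)) \<in> borel_measurable borel"
    by (rule fiber_integral[OF L E onto])
  have finB: "finite B" using B(1) by (simp add: orthonormal_def)
  have pB [measurable]: "proj_B I E \<in> borel_measurable \<mu>"
    unfolding proj_B_def by (intro borel_measurable_sum borel_measurable_scaleR Im borel_measurable_const)
  let ?\<rho> = "\<lambda>x. \<Prod>e\<in>B. std_normal_density (x e)"
  have \<rho>_meas [measurable]: "?\<rho> \<in> borel_measurable (PL B)" by measurable
  have \<rho>_nn: "0 \<le> ?\<rho> x" for x by (intro prod_nonneg) simp
  let ?G = "density (PL B) (\<lambda>x. ennreal (?\<rho> x))"
  let ?s = "\<lambda>x. \<Sum>e\<in>B. x e *\<^sub>R e"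
  let ?N = "distr ?G borel (\<lambda>x. ?P (?p + ?s x))"
  let ?M = "distr \<mu> borel (proj_B I E)"
  have s_meas [measurable]: "(\<lambda>x. ?P (?p + ?s x)) \<in> borel_measurable (PL B)" by measurable
  have "emeasure ?G (space ?G) = (\<integral>\<^sup>+x. (\<Prod>e\<in>B. ennreal (std_normal_density (x e))) \<partial>PL B)"
    by (subst emeasure_density) (auto simp: prod_ennreal intro!: nn_integral_cong)
  also have "\<dots> = (\<Prod>e\<in>B. \<integral>\<^sup>+t. ennreal (std_normal_density t) \<partial>lborel)"
    by (rule PL.product_nn_integral_prod[OF finB]) simp
  also have "(\<integral>\<^sup>+t. ennreal (std_normal_density t) \<partial>lborel) = 1"
  proof -
    interpret n: prob_space "density lborel std_normal_density" by (rule prob_space_normal_density) simp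
    show ?thesis using n.emeasure_space_1 by (simp add: emeasure_density)
  qed
  finally have G1: "prob_space ?G" by (intro prob_spaceI) simp
  interpret G: prob_space ?G by (rule G1)
  have "prob_space ?N" by (rule G.prob_space_distr) simp
  then have fN: "finite_measure ?N" by (simp add: prob_space_def)
  have "prob_space ?M" by (rule prob_space_distr) simp
  then have fM: "finite_measure ?M" by (simp add: prob_space_def)
  have "?M = ?N"
  proof (rule measure_eqI_char[OF fM fN _ _ E(1)])
    have clV: "{y. y \<in> span E} \<in> sets borel"
      using closed_span_orthonormal[OF E(1)] by (simp add: borel_closed)
    have "proj_B I E x \<in> span E" for x unfolding proj_B_def by (intro span_sum span_scale span_base)
    then show "AE y in ?M. y \<in> span E" using clV by (subst AE_distr_iff) auto
    show "AE y in ?N. y \<in> span E"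
      using clV orth_proj_mem[OF PV] E(2) by (subst AE_distr_iff) auto
    fix \<tau> assume "\<tau> \<in> span E"
    then have \<tau>: "\<tau> \<in> V" using E(2) by simp
    have ip: "inner (proj_B I E x) \<tau> = (\<Sum>h\<in>E. inner \<tau> h * I h x)" for x
      by (simp add: proj_B_def inner_sum_left inner_commute[of \<tau>] mult.commute)
    have "(LINT y|?M. iexp (inner y \<tau>))
        = (LINT x|\<mu>. iexp (inner (proj_B I E x) \<tau>))"
      by (subst integral_distr) auto
    also have "\<dots> = (LINT x|\<mu>. iexp (I \<tau> x))"
      using I_L_sum[OF I finE, of "inner \<tau>"] orthonormal_expand[OF E(1)] \<tau> E(2)
      by (intro integral_cong_AE) (auto simp: ip elim!: eventually_mono)
    also have "\<dots> = exp (\<i> * complex_of_real (inner ?p \<tau>) - complex_of_real ((norm (orth_proj ?D \<tau>))\<^sup>2 / 2))"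
      by (rule char_I_L[OF L mu I])
    also have "\<dots> = (LINT y|?N. iexp (inner y \<tau>))"
    proof -
      have ip2: "inner (?P (?p + ?s x)) \<tau> = inner ?p \<tau> + (\<Sum>e\<in>B. x e * inner e \<tau>)" for x
        using orth_proj_inner[OF PV \<tau>] by (simp add: inner_add_left inner_sum_left)
      have "(LINT y|?N. iexp (inner y \<tau>))
        = (LINT x|?G. iexp (inner (?P (?p + ?s x)) \<tau>))"
        by (subst integral_distr) auto
      also have "\<dots> = (LINT x|PL B. ?\<rho> x *\<^sub>R iexp (inner (?P (?p + ?s x)) \<tau>))"
        using \<rho>_nn by (subst integral_density) auto
      also have "\<dots> = (LINT x|PL B. iexp (inner ?p \<tau>) *
          (\<Prod>e\<in>B. std_normal_density (x e) *\<^sub>R iexp (inner e \<tau> * x e)))"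
      proof (rule Bochner_Integration.integral_cong[OF refl])
        fix x
        have "iexp (inner (?P (?p + ?s x)) \<tau>)
          = iexp (inner ?p \<tau>) * (\<Prod>e\<in>B. iexp (inner e \<tau> * x e))"
          unfolding ip2 using finB
          by (simp add: distrib_left exp_add exp_sum[symmetric] sum_distrib_left mult_ac)
        then show "?\<rho> x *\<^sub>R iexp (inner (?P (?p + ?s x)) \<tau>) = iexp (inner ?p \<tau>) *
          (\<Prod>e\<in>B. std_normal_density (x e) *\<^sub>R iexp (inner e \<tau> * x e))"
          by (simp add: scaleR_conv_of_real prod.distrib)
      qed
      also have "\<dots> = iexp (inner ?p \<tau>) *
          (LINT x|PL B. (\<Prod>e\<in>B. std_normal_density (x e) *\<^sub>R iexp (inner e \<tau> * x e)))"
        by simp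
      also have "(LINT x|PL B. (\<Prod>e\<in>B. std_normal_density (x e) *\<^sub>R iexp (inner e \<tau> * x e)))
        = (\<Prod>e\<in>B. (LINT t|lborel. std_normal_density t *\<^sub>R iexp (inner e \<tau> * t)))"
      proof (rule PL.product_integral_prod[OF finB])
        fix e
        show "integrable lborel (\<lambda>t. std_normal_density t *\<^sub>R iexp (inner e \<tau> * t))"
        proof (rule Bochner_Integration.integrable_bound[of _ std_normal_density])
          show "integrable lborel std_normal_density" by simp
        qed auto
      qed
      also have "\<dots> = (\<Prod>e\<in>B. char std_normal_distribution (inner e \<tau>))"
        by (intro prod.cong refl) (simp add: char_def integral_density)
      also have "\<dots> = (\<Prod>e\<in>B. exp (complex_of_real (- (inner e \<tau>)\<^sup>2 / 2)))"
        by (simp only: char_std_normal_distribution exp_of_real)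
      also have "\<dots> = exp (complex_of_real (- (\<Sum>e\<in>B. (inner e \<tau>)\<^sup>2) / 2))"
        using finB by (simp add: exp_sum[symmetric] sum_negf sum_divide_distrib)
      also have "(\<Sum>e\<in>B. (inner e \<tau>)\<^sup>2) = (norm (orth_proj ?D \<tau>))\<^sup>2"
      proof -
        \<comment> \<open>Here it matters that \<open>B\<close> spans the entire projection of
          \<open>V\<close>: otherwise the coordinates along \<open>B\<close> would miss part of the
          variance.\<close>
        have Q: "orth_proj ?D \<tau> \<in> span B" using QV \<tau> by auto
        have "inner e \<tau> = inner (orth_proj ?D \<tau>) e" if "e \<in> B" for e
          using orth_proj_inner[OF PD, of e \<tau>] B(2) span_base[OF that] by (auto simp: inner_commute)
        then have "(\<Sum>e\<in>B. (inner e \<tau>)\<^sup>2) = (\<Sum>e\<in>B. (inner (orth_proj ?D \<tau>) e)\<^sup>2)" by simp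
        also have "\<dots> = (norm (\<Sum>e\<in>B. inner (orth_proj ?D \<tau>) e *\<^sub>R e))\<^sup>2"
          by (simp add: norm_sum_orthonormal[OF B(1)])
        finally show ?thesis by (simp add: orthonormal_expand[OF B(1) Q])
      qed
      also have "iexp (inner ?p \<tau>) * exp (complex_of_real (- (norm (orth_proj ?D \<tau>))\<^sup>2 / 2))
        = exp (\<i> * complex_of_real (inner ?p \<tau>) - complex_of_real ((norm (orth_proj ?D \<tau>))\<^sup>2 / 2))"
        unfolding exp_add[symmetric] by (rule arg_cong[where f = exp]) simp
      finally show ?thesis by simp
    qed
    finally show "(LINT y|?M. iexp (inner y \<tau>)) = (LINT y|?N. iexp (inner y \<tau>))" .
  qed simp_all
  \<comment> \<open>The second factor compensates for the weight in \<open>fiber_integral\<close>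
    being a function of \<open>(norm ?p)\<^sup>2 + (norm u)\<^sup>2\<close>, whereas the Gaussian
    density involves only \<open>(norm u)\<^sup>2\<close>.\<close>
  define \<kappa> where "\<kappa> = (1 / sqrt (2 * pi)) ^ card B * exp ((norm ?p)\<^sup>2 / 2)"
  have \<kappa>: "\<kappa> > 0" by (simp add: \<kappa>_def)
  have main: "(\<integral>\<^sup>+x. F (proj_B I E x) \<partial>\<mu>)
      = ennreal (\<kappa> * c0) * (\<integral>\<^sup>+v. F v * ennreal (exp (- minsq L V v / 2)) \<partial>leb_on E)"
    if F [measurable]: "F \<in> borel_measurable borel" for F :: "'h \<Rightarrow> ennreal"
  proof -
    have "(\<integral>\<^sup>+x. F (proj_B I E x) \<partial>\<mu>) = (\<integral>\<^sup>+y. F y \<partial>?M)" by (subst nn_integral_distr) auto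
    also have "\<dots> = (\<integral>\<^sup>+x. F (?P (?p + ?s x)) \<partial>?G)" unfolding \<open>?M = ?N\<close> by (subst nn_integral_distr) auto
    also have "\<dots> = (\<integral>\<^sup>+x. F (?P (?p + ?s x)) * ennreal (?\<rho> x) \<partial>PL B)"
      by (subst nn_integral_density) (auto simp: mult.commute)
    also have "\<dots> = (\<integral>\<^sup>+x. F (?P (?p + ?s x)) * ennreal (\<kappa> * exp (- ((norm ?p)\<^sup>2 + (norm (?s x))\<^sup>2) / 2)) \<partial>PL B)"
    proof (rule nn_integral_cong)
      fix x
      have "?\<rho> x = (1 / sqrt (2 * pi)) ^ card B * exp (\<Sum>e\<in>B. - (x e)\<^sup>2 / 2)"
        using finB by (simp only: std_normal_density_def prod.distrib prod_constant exp_sum)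
      also have "(\<Sum>e\<in>B. - (x e)\<^sup>2 / 2) = (norm ?p)\<^sup>2 / 2 + - ((norm ?p)\<^sup>2 + (norm (?s x))\<^sup>2) / 2"
        unfolding norm_sum_orthonormal[OF B(1)] by (simp add: sum_negf sum_divide_distrib[symmetric] field_simps)
      finally have "?\<rho> x = \<kappa> * exp (- ((norm ?p)\<^sup>2 + (norm (?s x))\<^sup>2) / 2)"
        unfolding exp_add by (simp only: \<kappa>_def mult.assoc)
      then show "F (?P (?p + ?s x)) * ennreal (?\<rho> x) = F (?P (?p + ?s x)) * ennreal (\<kappa> * exp (- ((norm ?p)\<^sup>2 + (norm (?s x))\<^sup>2) / 2))"
        by simp
    qed
    also have "\<dots> = (\<integral>\<^sup>+u. F (?P (?p + u)) * ennreal (\<kappa> * exp (- ((norm ?p)\<^sup>2 + (norm u)\<^sup>2) / 2)) \<partial>leb_on B)"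
      by (rule nn_integral_frame_leb[symmetric]) measurable
    also have "\<dots> = ennreal c0 * (\<integral>\<^sup>+v. F v * ennreal (\<kappa> * exp (- minsq L V v / 2)) \<partial>leb_on E)"
      by (rule FI[rule_format, where w = "\<lambda>q. ennreal (\<kappa> * exp (- q / 2))"]) measurable
    also have "(\<integral>\<^sup>+v. F v * ennreal (\<kappa> * exp (- minsq L V v / 2)) \<partial>leb_on E)
      = (\<integral>\<^sup>+v. ennreal \<kappa> * (F v * ennreal (exp (- minsq L V (?P v) / 2))) \<partial>leb_on E)"
    proof -
      interpret E: frame E "\<lambda>e. e" "\<lambda>e. e" by (rule orthonormal_frame[OF E(1)])
      show ?thesis
      proof (rule nn_integral_cong_AE, rule eventually_mono[OF E.AE_in_S])
        fix v assume "v \<in> E.S"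
        then have "?P v = v" using E(2) orth_proj_id[OF PV] by simp
        then show "F v * ennreal (\<kappa> * exp (- minsq L V v / 2)) = ennreal \<kappa> * (F v * ennreal (exp (- minsq L V (?P v) / 2)))"
          using \<kappa> by (simp add: ennreal_mult mult_ac)
      qed
    qed
    also have "\<dots> = ennreal \<kappa> * (\<integral>\<^sup>+v. F v * ennreal (exp (- minsq L V (?P v) / 2)) \<partial>leb_on E)"
    proof -
      \<comment> \<open>Only the composition of \<open>minsq L V\<close> with \<open>?P\<close> is
        known to be Borel, hence the passage to it before the constant is pulled out and the return
        afterwards.\<close>
      note mm [measurable]
      show ?thesis by (rule nn_integral_cmult) measurable
    qed
    also have "(\<integral>\<^sup>+v. F v * ennreal (exp (- minsq L V (?P v) / 2)) \<partial>leb_on E)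
      = (\<integral>\<^sup>+v. F v * ennreal (exp (- minsq L V v / 2)) \<partial>leb_on E)"
    proof -
      interpret E: frame E "\<lambda>e. e" "\<lambda>e. e" by (rule orthonormal_frame[OF E(1)])
      show ?thesis
        using E.AE_in_S E(2) orth_proj_id[OF PV] by (intro nn_integral_cong_AE) (auto elim!: eventually_mono)
    qed
    finally show ?thesis using \<kappa> c0 by (simp add: ennreal_mult mult_ac)
  qed
  show ?thesis
    by (rule that[of "\<kappa> * c0"]) (use \<kappa> c0 mm pB main in auto)
qed

end

section \<open>Convergence\<close>

text \<open>From \<open>1 - x \<le> exp (- x)\<close> comes the bound
  \<open>exp (- (m / d) * q / 2)\<close>. Replacing \<open>m\<close> by \<open>d\<close> costs
  \<open>q / d * (d - m) / 2\<close>, at most \<open>c / 2\<close> as long as \<open>q < d\<close>;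
  beyond that the left side vanishes, since \<open>m > 0\<close>.\<close>

lemma sqrt_power_le_exp:
  assumes q: "0 \<le> q" and m: "0 < m" "m \<le> d" "d \<le> m + c"
  shows "sqrt (max 0 (1 - q / real d)) ^ m \<le> exp (real c / 2) * exp (- q / 2)"
proof (cases "q < d")
  case False
  have "d > 0" using m by simp
  then have "1 - q / real d \<le> 0" using False by (simp add: field_simps)
  then have "max 0 (1 - q / real d) = 0" by (rule max_absorb1)
  then show ?thesis using m(1) by (simp add: zero_power)
next
  case True
  have d: "real d > 0" using m by simp
  have "1 - q / d \<le> exp (- (q / d))" using exp_ge_add_one_self[of "- (q / d)"] by simp
  then have "sqrt (max 0 (1 - q / d)) \<le> sqrt (exp (- (q / d)))" by (intro real_sqrt_le_mono) simp
  also have "\<dots> = exp (- (q / d) / 2)"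
    by (rule real_sqrt_unique) (simp_all add: power2_eq_square exp_add[symmetric])
  finally have "sqrt (max 0 (1 - q / d)) ^ m \<le> exp (- (q / d) / 2) ^ m" by (intro power_mono) auto
  also have "\<dots> = exp (real m * (- (q / d) / 2))" by (simp only: exp_of_nat_mult)
  also have "\<dots> \<le> exp (real c / 2 + - q / 2)"
  proof -
    have "q / d * (real d - real m) \<le> 1 * real c"
      using True q d m by (intro mult_mono) (auto simp: field_simps)
    moreover have "q / d * (real d - real m) = q - real m * (q / d)" using d by (simp add: field_simps)
    ultimately show ?thesis by simp
  qed
  finally show ?thesis by (simp only: exp_add)
qed

text \<open>Logarithms reduce the claim to \<open>m * ln (1 - x)\<close> with
  \<open>x = q / d\<close>. Bounded \<open>d - m\<close> gives
  \<open>m * x \<longlonglongrightarrow> q0\<close>, and the error of the linear approximation is at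
  most \<open>2 * m * x * x\<close> in absolute value, which tends to 0 with
  \<open>x\<close>.\<close>

lemma tendsto_sqrt_power_exp:
  fixes d m :: "nat \<Rightarrow> nat" and q :: "nat \<Rightarrow> real"
  assumes q: "q \<longlonglongrightarrow> q0" and d: "filterlim d at_top sequentially"
    and m: "\<forall>\<^sub>F N in sequentially. m N \<le> d N \<and> d N \<le> m N + c"
  shows "(\<lambda>N. sqrt (max 0 (1 - q N / real (d N))) ^ m N) \<longlonglongrightarrow> exp (- q0 / 2)"
proof -
  have dr: "filterlim (\<lambda>N. real (d N)) at_top sequentially"
    using filterlim_compose[OF filterlim_real_sequentially d] .
  define x where "x = (\<lambda>N. q N / real (d N))"
  have x0: "x \<longlonglongrightarrow> 0" unfolding x_def by (rule real_tendsto_divide_at_top[OF q dr])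
  have dpos: "\<forall>\<^sub>F N in sequentially. real (d N) > 0"
    using dr unfolding filterlim_at_top_dense by blast
  have "(\<lambda>N. (real (d N) - real (m N)) / real (d N)) \<longlonglongrightarrow> 0"
  proof (rule tendsto_sandwich[OF _ _ tendsto_const])
    show "\<forall>\<^sub>F N in sequentially. 0 \<le> (real (d N) - real (m N)) / real (d N)"
      using m by (rule eventually_mono) auto
    show "\<forall>\<^sub>F N in sequentially. (real (d N) - real (m N)) / real (d N) \<le> real c / real (d N)"
      using m by (rule eventually_mono) (auto intro!: divide_right_mono)
    show "(\<lambda>N. real c / real (d N)) \<longlonglongrightarrow> 0" by (rule real_tendsto_divide_at_top[OF tendsto_const dr])
  qed
  then have "(\<lambda>N. q N * (1 - (real (d N) - real (m N)) / real (d N))) \<longlonglongrightarrow> q0 * (1 - 0)"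
    by (intro tendsto_intros q)
  moreover have "\<forall>\<^sub>F N in sequentially. q N * (1 - (real (d N) - real (m N)) / real (d N)) = real (m N) * x N"
    using dpos by (rule eventually_mono) (simp add: x_def field_simps)
  ultimately have mx: "(\<lambda>N. real (m N) * x N) \<longlonglongrightarrow> q0"
    by (simp add: tendsto_cong)
  have xs: "\<forall>\<^sub>F N in sequentially. \<bar>x N\<bar> < 1 / 2"
    using tendstoD[OF x0, of "1/2"] by (simp add: dist_real_def)
  have "(\<lambda>N. real (m N) * (ln (1 - x N) + x N)) \<longlonglongrightarrow> 0"
  proof (rule Lim_null_comparison)
    show "\<forall>\<^sub>F N in sequentially. norm (real (m N) * (ln (1 - x N) + x N)) \<le> 2 * \<bar>real (m N) * x N\<bar> * \<bar>x N\<bar>"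
      using xs
    proof (rule eventually_mono)
      fix N assume "\<bar>x N\<bar> < 1 / 2"
      then have "\<bar>ln (1 + - x N) - - x N\<bar> \<le> 2 * (- x N)\<^sup>2"
        by (intro abs_ln_one_plus_x_minus_x_bound) simp
      then have "\<bar>ln (1 - x N) + x N\<bar> \<le> 2 * \<bar>x N\<bar> * \<bar>x N\<bar>" by (simp add: power2_eq_square)
      then have "real (m N) * \<bar>ln (1 - x N) + x N\<bar> \<le> real (m N) * (2 * \<bar>x N\<bar> * \<bar>x N\<bar>)"
        by (intro mult_left_mono) auto
      then show "norm (real (m N) * (ln (1 - x N) + x N)) \<le> 2 * \<bar>real (m N) * x N\<bar> * \<bar>x N\<bar>"
        by (simp add: abs_mult mult_ac)
    qed
    have "(\<lambda>N. 2 * \<bar>real (m N) * x N\<bar> * \<bar>x N\<bar>) \<longlonglongrightarrow> 2 * \<bar>q0\<bar> * \<bar>0\<bar>"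
      by (intro tendsto_intros mx x0)
    then show "(\<lambda>N. 2 * \<bar>real (m N) * x N\<bar> * \<bar>x N\<bar>) \<longlonglongrightarrow> 0" by simp
  qed
  from tendsto_diff[OF this mx] have "(\<lambda>N. real (m N) * ln (1 - x N)) \<longlonglongrightarrow> - q0"
    by (simp add: algebra_simps)
  then have "(\<lambda>N. exp (real (m N) * ln (1 - x N) / 2)) \<longlonglongrightarrow> exp (- q0 / 2)"
    by (intro tendsto_intros) simp_all
  moreover have "\<forall>\<^sub>F N in sequentially. exp (real (m N) * ln (1 - x N) / 2) = sqrt (max 0 (1 - q N / real (d N))) ^ m N"
    using xs
  proof (rule eventually_mono)
    fix N assume "\<bar>x N\<bar> < 1 / 2"
    then have pos: "1 - x N > 0" by simp
    have "sqrt (max 0 (1 - x N)) = exp (ln (1 - x N) / 2)"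
      using pos by (intro real_sqrt_unique) (simp_all add: power2_eq_square exp_add[symmetric])
    then have "sqrt (max 0 (1 - x N)) ^ m N = exp (real (m N) * (ln (1 - x N) / 2))"
      by (simp only: exp_of_nat_mult)
    then show "exp (real (m N) * ln (1 - x N) / 2) = sqrt (max 0 (1 - q N / real (d N))) ^ m N"
      by (simp add: x_def)
  qed
  ultimately show ?thesis by (rule Lim_transform_eventually)
qed

text \<open>When the limit integral is infinite, Fatou's lemma takes the place of dominated convergence.\<close>

lemma nn_integral_density_tendsto:
  fixes w :: "nat \<Rightarrow> 'a \<Rightarrow> ennreal" and g w0 :: "'a \<Rightarrow> ennreal"
  assumes [measurable]: "\<And>N. w N \<in> borel_measurable M" "w0 \<in> borel_measurable M" "g \<in> borel_measurable M"
    and g: "\<And>x. g x < \<infinity>" and C: "C < \<infinity>"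
    and dom: "\<And>N. AE x in M. w N x \<le> C * w0 x"
    and lim: "AE x in M. (\<lambda>N. w N x) \<longlonglongrightarrow> w0 x"
  shows "(\<lambda>N. \<integral>\<^sup>+x. g x * w N x \<partial>M) \<longlonglongrightarrow> (\<integral>\<^sup>+x. g x * w0 x \<partial>M)"
proof (cases "(\<integral>\<^sup>+x. g x * w0 x \<partial>M) < \<infinity>")
  case True
  show ?thesis
  proof (rule nn_integral_dominated_convergence[where w = "\<lambda>x. C * (g x * w0 x)"])
    show "AE x in M. g x * w N x \<le> C * (g x * w0 x)" for N
      using dom[of N]
    proof (rule eventually_mono)
      fix x assume "w N x \<le> C * w0 x"
      then have "g x * w N x \<le> g x * (C * w0 x)" by (intro mult_left_mono) auto
      then show "g x * w N x \<le> C * (g x * w0 x)" by (simp add: mult_ac)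
    qed
    show "(\<integral>\<^sup>+x. C * (g x * w0 x) \<partial>M) < \<infinity>"
      using True C by (simp add: nn_integral_cmult ennreal_mult_less_top)
    show "AE x in M. (\<lambda>N. g x * w N x) \<longlonglongrightarrow> g x * w0 x"
      using lim g by (auto elim!: eventually_mono intro!: ennreal_tendsto_cmult)
  qed auto
next
  case False
  then have top: "(\<integral>\<^sup>+x. g x * w0 x \<partial>M) = \<infinity>" by (simp add: less_top[symmetric])
  have "(\<integral>\<^sup>+x. g x * w0 x \<partial>M) = (\<integral>\<^sup>+x. liminf (\<lambda>N. g x * w N x) \<partial>M)"
  proof (rule nn_integral_cong_AE)
    show "AE x in M. g x * w0 x = liminf (\<lambda>N. g x * w N x)"
      using lim
    proof (rule eventually_mono)
      fix x assume "(\<lambda>N. w N x) \<longlonglongrightarrow> w0 x"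
      then have "(\<lambda>N. g x * w N x) \<longlonglongrightarrow> g x * w0 x" using g by (intro ennreal_tendsto_cmult) auto
      then show "g x * w0 x = liminf (\<lambda>N. g x * w N x)"
        by (intro lim_imp_Liminf[symmetric]) auto
    qed
  qed
  also have "\<dots> \<le> liminf (\<lambda>N. \<integral>\<^sup>+x. g x * w N x \<partial>M)" by (intro nn_integral_liminf) measurable
  finally have L: "liminf (\<lambda>N. \<integral>\<^sup>+x. g x * w N x \<partial>M) = \<infinity>" using top by (simp add: top_unique)
  then have "limsup (\<lambda>N. \<integral>\<^sup>+x. g x * w N x \<partial>M) = \<infinity>"
    using Liminf_le_Limsup[of sequentially "\<lambda>N. \<integral>\<^sup>+x. g x * w N x \<partial>M"] by (simp add: top_unique)
  then show ?thesis using L unfolding top by (intro Liminf_eq_Limsup) auto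
qed

context exhausting
begin

text \<open>Adding the vectors of \<open>E\<close> as constraints describes a fibre of
  \<open>L\<close>, so the approximation results for constrained affine sets apply to it with
  \<open>G \<union> E\<close> in place of \<open>G\<close>. Surjectivity for large \<open>N\<close>
  reduces to finitely many fibres, those over 0 and over the basis vectors.\<close>

lemma
  assumes G: "finite G" and L: "L = {y. \<forall>g\<in>G. inner g y = b g}"
    and E: "orthonormal E" "span E = V" and onto: "orth_proj V ` L = V"
  shows eventually_surjective: "\<forall>\<^sub>F N in sequentially. orth_proj V ` (L \<inter> Z N) = V"
    and tendsto_minsq: "v \<in> V \<Longrightarrow> (\<lambda>N. minsq (L \<inter> Z N) V v) \<longlonglongrightarrow> minsq L V v"
    and minsq_le_Int: "v \<in> V \<Longrightarrow> v \<in> orth_proj V ` (L \<inter> Z N) \<Longrightarrow> minsq L V v \<le> minsq (L \<inter> Z N) V v"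
proof -
  have PV: "proj_subspace V" using orthonormal_proj_subspace[OF E(1)] E(2) by simp
  note linP = linear_orth_proj[OF PV]
  have finE: "finite E" using E(1) by (simp add: orthonormal_def)
  have P_iff: "orth_proj V y = v \<longleftrightarrow> (\<forall>e\<in>E. inner e y = inner e v)" if v: "v \<in> V" for y v
  proof
    assume "orth_proj V y = v"
    then show "\<forall>e\<in>E. inner e y = inner e v"
      using orth_proj_inner[OF PV, of _ y] E(2) span_base[of _ E] by (auto simp: inner_commute)
  next
    assume *: "\<forall>e\<in>E. inner e y = inner e v"
    have "orth_proj V y = (\<Sum>e\<in>E. inner y e *\<^sub>R e)" using orth_proj_orthonormal[OF E(1)] E(2) by simp
    also have "\<dots> = (\<Sum>e\<in>E. inner v e *\<^sub>R e)" using * by (intro sum.cong) (auto simp: inner_commute)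
    also have "\<dots> = v" using orthonormal_expand[OF E(1)] v E(2) by simp
    finally show "orth_proj V y = v" .
  qed
  have fib: "\<exists>b'. fiber L V v = {y. \<forall>g\<in>G \<union> E. inner g y = b' g} \<and> fiber L V v \<noteq> {}" if v: "v \<in> V" for v
  proof -
    obtain y0 where y0: "y0 \<in> L" "orth_proj V y0 = v" using onto v by (metis imageE)
    have "fiber L V v = {y. \<forall>g\<in>G \<union> E. inner g y = inner g y0}"
      using y0 P_iff[OF v] by (auto simp: fiber_def L)
    moreover have "y0 \<in> fiber L V v" using y0 by (simp add: fiber_def)
    ultimately show ?thesis by (intro exI[of _ "\<lambda>g. inner g y0"]) blast
  qed
  have fin: "finite (G \<union> E)" using G finE by simp
  have fibZ: "fiber (L \<inter> Z N) V v = fiber L V v \<inter> Z N" for N v by (auto simp: fiber_def)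
  have ne: "\<forall>\<^sub>F N in sequentially. fiber L V v \<inter> Z N \<noteq> {}" if v: "v \<in> V" for v
  proof -
    obtain b' where b': "fiber L V v = {y. \<forall>g\<in>G \<union> E. inner g y = b' g}" "fiber L V v \<noteq> {}"
      using fib[OF v] by blast
    then show ?thesis by (intro eventually_Int_nonempty[OF fin])
  qed
  have sV: "subspace V" using PV by (simp add: proj_subspace_def)
  have "\<forall>\<^sub>F N in sequentially. \<forall>v\<in>insert 0 E. fiber L V v \<inter> Z N \<noteq> {}"
    using finE E(2) span_base[of _ E] subspace_0[OF sV] by (intro eventually_ball_finite ballI ne) auto
  then show "\<forall>\<^sub>F N in sequentially. orth_proj V ` (L \<inter> Z N) = V"
  proof (rule eventually_mono)
    fix N assume *: "\<forall>v\<in>insert 0 E. fiber L V v \<inter> Z N \<noteq> {}"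
    then have "\<forall>v\<in>insert 0 E. \<exists>y. y \<in> fiber L V v \<inter> Z N" by blast
    from bchoice[OF this] obtain y where y: "\<And>v. v \<in> insert 0 E \<Longrightarrow> y v \<in> fiber L V v \<inter> Z N" by blast
    have "V \<subseteq> orth_proj V ` (L \<inter> Z N)"
    proof
      fix v assume v: "v \<in> V"
      \<comment> \<open>An affine combination of the chosen points: the coefficient of
        \<open>y 0\<close> makes the sum of coefficients 1, so \<open>x\<close> stays in
        \<open>L\<close>, and its projection is the basis expansion of \<open>v\<close>.\<close>
      define x where "x = y 0 + (\<Sum>e\<in>E. inner v e *\<^sub>R (y e - y 0))"
      have yL: "inner g (y v) = b g" if "g \<in> G" "v \<in> insert 0 E" for g v
        using y[OF that(2)] that(1) by (auto simp: fiber_def L)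
      have Py: "orth_proj V (y v) = v" if "v \<in> insert 0 E" for v using y[OF that] by (auto simp: fiber_def)
      have yZ: "y v \<in> Z N" if "v \<in> insert 0 E" for v using y[OF that] by blast
      have "inner g x = b g" if "g \<in> G" for g
        using that by (simp add: x_def inner_add_right inner_sum_right inner_diff_right yL)
      then have "x \<in> L" by (simp add: L)
      moreover have "x \<in> Z N"
        unfolding x_def using yZ by (intro subspace_add subspace_sum subspace_scale subspace_diff subspace_Z) auto
      moreover have "orth_proj V x = v"
        using Py orthonormal_expand[OF E(1)] v E(2)
        by (simp add: x_def linear_add[OF linP] linear_sum[OF linP] linear_scale[OF linP] linear_diff[OF linP])
      ultimately show "v \<in> orth_proj V ` (L \<inter> Z N)" by blast
    qed
    then show "orth_proj V ` (L \<inter> Z N) = V" using orth_proj_mem[OF PV] by auto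
  qed
  {
    assume v: "v \<in> V"
    obtain b' where b': "fiber L V v = {y. \<forall>g\<in>G \<union> E. inner g y = b' g}" "fiber L V v \<noteq> {}"
      using fib[OF v] by blast
    show "(\<lambda>N. minsq (L \<inter> Z N) V v) \<longlonglongrightarrow> minsq L V v"
      unfolding minsq_def fibZ by (intro tendsto_power tendsto_norm_foot[OF fin b'])
    assume "v \<in> orth_proj V ` (L \<inter> Z N)"
    then have "fiber L V v \<inter> Z N \<noteq> {}" by (auto simp: fiber_def)
    then show "minsq L V v \<le> minsq (L \<inter> Z N) V v"
      unfolding minsq_def fibZ by (intro power_mono norm_foot_le_Int[OF fin b']) auto
  }
qed

end

text \<open>The spherical density without its factor \<open>sqrt d ^ m\<close>; unlike the original
  it has a limit as the dimension grows.\<close>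

definition sphere_weight :: "nat \<Rightarrow> nat \<Rightarrow> real \<Rightarrow> ennreal" where
  "sphere_weight d m q = ennreal (sqrt (max 0 (1 - q / d)) ^ m)"

text \<open>All that is needed for one large \<open>N\<close>, bundled so that the constants and
  exponents can be chosen as sequences from a single eventual existence statement.\<close>

definition sphere_law :: "'a::{real_inner,polish_space} set \<Rightarrow> 'a set \<Rightarrow> 'a set \<Rightarrow> 'a set \<Rightarrow> real \<Rightarrow> nat \<Rightarrow> bool" where
  "sphere_law L Z V E c m \<longleftrightarrow> prob_space (sigma_bar L Z) \<and> 0 < c \<and> 0 < m \<and> m \<le> dim Z \<and>
    orth_proj V ` (L \<inter> Z) = V \<and> (\<lambda>v. minsq (L \<inter> Z) V (orth_proj V v)) \<in> borel_measurable borel \<and>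
    (\<forall>F\<in>borel_measurable borel. (\<integral>\<^sup>+z. F (orth_proj V z) \<partial>sigma_bar L Z) = ennreal c *
      (\<integral>\<^sup>+v. F v * sphere_weight (dim Z) m (minsq (L \<inter> Z) V (orth_proj V v)) \<partial>leb_on E))"

text \<open>The defect \<open>card G + card E + 2\<close> counts the constraints defining
  \<open>L\<close>, the dimension of \<open>V\<close>, and the two exponents lost in projecting the
  sphere.\<close>

lemma sigma_bar_density_eventually:
  fixes L V E :: "'h::{real_inner,polish_space} set" and Z :: "nat \<Rightarrow> 'h set"
  assumes infinite_dim: "\<not> fin_dim_subspace (UNIV :: 'h set)"
    and Z: "exhausting Z"
    and G: "finite G" and L: "L = {y. \<forall>g\<in>G. inner g y = b g}" "L \<noteq> {}"
    and E: "orthonormal E" "span E = V" and onto: "orth_proj V ` L = V"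
  shows "\<exists>c m. \<forall>\<^sub>F N in sequentially. sphere_law L (Z N) V E (c N) (m N) \<and>
    dim (Z N) \<le> m N + (card G + card E + 2)"
proof -
  interpret exhausting Z by fact
  have PV: "proj_subspace V" using orthonormal_proj_subspace[OF E(1)] E(2) by simp
  have dimZ: "filterlim (\<lambda>N. dim (Z N)) at_top sequentially" by (rule filterlim_dim_Z[OF infinite_dim])
  have ev_dim: "\<forall>\<^sub>F N in sequentially. dim (Z N) \<ge> K" for K
    using dimZ by (simp add: filterlim_at_top)
  have "(\<lambda>N. (norm (foot (L \<inter> Z N)))\<^sup>2) \<longlonglongrightarrow> (norm (foot L))\<^sup>2"
    by (intro tendsto_power tendsto_norm_foot[OF G L])
  then have ev_p: "\<forall>\<^sub>F N in sequentially. (norm (foot (L \<inter> Z N)))\<^sup>2 < (norm (foot L))\<^sup>2 + 1"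
    by (rule order_tendstoD) simp
  \<comment> \<open>The feet have bounded norm while the dimension tends to infinity, so from some
    \<open>N\<close> on the squared radius of the sphere is positive.\<close>
  obtain K :: nat where K: "(norm (foot L))\<^sup>2 + 1 \<le> real K" using real_arch_simple by blast
  have "\<forall>\<^sub>F N in sequentially. \<exists>c m. sphere_law L (Z N) V E c m \<and> dim (Z N) \<le> m + (card G + card E + 2)"
    using eventually_surjective[OF G L(1) E onto] eventually_Int_nonempty[OF G L] ev_p
      ev_dim[of K] ev_dim[of "card G + card E + 3"]
  proof eventually_elim
    case (elim N)
    let ?A = "L \<inter> Z N"
    have A: "affine ?A" "closed ?A" using Int_Z_properties[OF G L] by auto
    have pd: "(norm (foot ?A))\<^sup>2 < dim (Z N)" using elim(3,4) K by linarith
    have "foot ?A \<in> ?A" using A elim(2) by (intro foot_in affine_imp_convex)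
    then have D: "direction ?A = {z \<in> Z N. \<forall>g\<in>G. inner g z = 0}"
      unfolding L(1) using subspace_Z by (intro direction_Int_constraints)
    have dG: "dim (Z N) \<le> dim (direction ?A) + card G"
      unfolding D by (rule dim_constraints[OF fin G])
    then have dd: "dim (direction ?A) \<ge> card E + 3" using elim(5) by simp
    obtain c m where c: "c > 0" and m: "m \<le> dim (Z N)" "dim (direction ?A) \<le> m + card E + 2"
      and I: "\<forall>F\<in>borel_measurable borel. (\<integral>\<^sup>+z. F (orth_proj V z) \<partial>sigma_bar L (Z N))
      = ennreal c * (\<integral>\<^sup>+v. F v * ennreal (sqrt (max 0 (real (dim (Z N)) - minsq ?A V v)) ^ m) \<partial>leb_on E)"
      by (rule sigma_bar_projection_density[OF A elim(2) fin E elim(1) pd dd])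
    have "direction ?A \<noteq> {0}"
    proof
      assume "direction ?A = {0}"
      then show False using dd dim_singleton_0[where 'a = 'h] by simp
    qed
    then have "prob_space (sigma_bar L (Z N))" by (rule prob_space_sigma_bar[OF A elim(2) fin pd])
    moreover have "(\<lambda>v. minsq ?A V (orth_proj V v)) \<in> borel_measurable borel"
      by (rule fiber_integral[OF A elim(2) E elim(1)])
    note mm [measurable] = this
    have d: "real (dim (Z N)) > 0" using elim(5) by simp
    let ?w = "\<lambda>v. sphere_weight (dim (Z N)) m (minsq ?A V (orth_proj V v))"
    have [measurable]: "?w \<in> borel_measurable borel" unfolding sphere_weight_def by measurable
    \<comment> \<open>The factor removed in \<open>sphere_weight\<close>; it goes into the
      normalizing constant.\<close>
    define K where "K = sqrt (dim (Z N)) ^ m"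
    have "K > 0" using d by (simp add: K_def)
    interpret E: frame E "\<lambda>e. e" "\<lambda>e. e" by (rule orthonormal_frame[OF E(1)])
    have "\<forall>F\<in>borel_measurable borel. (\<integral>\<^sup>+z. F (orth_proj V z) \<partial>sigma_bar L (Z N)) = ennreal (c * K) *
      (\<integral>\<^sup>+v. F v * ?w v \<partial>leb_on E)"
    proof
      fix F :: "'h \<Rightarrow> ennreal" assume F [measurable]: "F \<in> borel_measurable borel"
      have "(\<integral>\<^sup>+v. F v * ennreal (sqrt (max 0 (real (dim (Z N)) - minsq ?A V v)) ^ m) \<partial>leb_on E)
        = (\<integral>\<^sup>+v. ennreal K * (F v * ?w v) \<partial>leb_on E)"
      proof (rule nn_integral_cong_AE, rule eventually_mono[OF E.AE_in_S])
        fix v assume "v \<in> E.S"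
        then have Pv: "orth_proj V v = v" using E(2) orth_proj_id[OF PV] by simp
        have "max 0 (real (dim (Z N)) - minsq ?A V v) = dim (Z N) * max 0 (1 - minsq ?A V v / dim (Z N))"
          using d by (simp add: max_mult_distrib_left right_diff_distrib)
        then have "sqrt (max 0 (real (dim (Z N)) - minsq ?A V v)) ^ m = K * sqrt (max 0 (1 - minsq ?A V v / dim (Z N))) ^ m"
          by (simp only: real_sqrt_mult power_mult_distrib K_def)
        then show "F v * ennreal (sqrt (max 0 (real (dim (Z N)) - minsq ?A V v)) ^ m)
          = ennreal K * (F v * ?w v)"
          using \<open>K > 0\<close> by (simp add: Pv sphere_weight_def ennreal_mult mult_ac)
      qed
      also have "\<dots> = ennreal K * (\<integral>\<^sup>+v. F v * ?w v \<partial>leb_on E)"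
        by (rule nn_integral_cmult) measurable
      finally show "(\<integral>\<^sup>+z. F (orth_proj V z) \<partial>sigma_bar L (Z N)) = ennreal (c * K) *
        (\<integral>\<^sup>+v. F v * ?w v \<partial>leb_on E)"
        using I F c \<open>K > 0\<close> by (simp add: ennreal_mult mult.assoc)
    qed
    moreover have "c * K > 0" using c \<open>K > 0\<close> by simp
    moreover have "0 < m" using m(2) dd by simp
    moreover have "dim (Z N) \<le> m + (card G + card E + 2)" using dG m(2) by simp
    ultimately show ?case using m(1) elim(1) mm unfolding sphere_law_def by blast
  qed
  then show ?thesis unfolding eventually_ex by blast
qed

text \<open>For an arbitrary Borel \<open>f\<close> neither integral need be defined, hence the two
  readings: integrable \<open>f\<close>, and nonnegative \<open>f\<close> with infinity allowed as a
  value.\<close>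

theorem theorem5p1:
  fixes nrm :: "'h::{real_inner, polish_space} \<Rightarrow> real"
    and j :: "'h \<Rightarrow> 'b::banach"
    and L V E :: "'h set"
    and \<mu> :: "'b measure"
    and I :: "'h \<Rightarrow> 'b \<Rightarrow> real"
    and f :: "'h \<Rightarrow> real"
    and Z :: "nat \<Rightarrow> 'h set"
  assumes infinite_dim: "\<not> fin_dim_subspace (UNIV :: 'h set)"
    and norm: "measurable_norm nrm"
    and completion: "is_completion nrm j"
    and L: "affine L" "closed L" "L \<noteq> {}" "finite_codim L"
    and mu: "is_mu_L j L \<mu>"
    and I: "is_I_L j \<mu> I"
    and V: "fin_dim_subspace V" "V \<noteq> {0}"
    and onto: "orth_proj V ` L = V"
    and E: "orthonormal_basis V E"
    and f: "f \<in> borel_measurable (restrict_space borel V)"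
    and Z: "\<And>N. fin_dim_subspace (Z N)" "V \<subseteq> Z 0" "\<And>N. Z N \<subseteq> Z (Suc N)"
    and dense: "closure (\<Union>N. Z N) = UNIV"
  shows "(integrable \<mu> (\<lambda>x. f (proj_B I E x)) \<longrightarrow>
           (\<forall>\<^sub>F N in sequentially. integrable (sigma_bar L (Z N)) (\<lambda>z. f (orth_proj V z))) \<and>
           (\<lambda>N. LINT z|sigma_bar L (Z N). f (orth_proj V z))
             \<longlonglongrightarrow> (LINT x|\<mu>. f (proj_B I E x)))
       \<and> ((\<forall>v\<in>V. 0 \<le> f v) \<longrightarrow>
           (\<lambda>N. \<integral>\<^sup>+ z. ennreal (f (orth_proj V z)) \<partial>sigma_bar L (Z N))
             \<longlonglongrightarrow> (\<integral>\<^sup>+ x. ennreal (f (proj_B I E x)) \<partial>\<mu>))"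
proof -
  interpret exhausting Z by unfold_locales (fact Z dense)+
  interpret wiener_space nrm j by unfold_locales (fact norm completion)+
  interpret prob_space \<mu> using mu by (simp add: is_mu_L_def)
  have onE: "orthonormal E" and spE: "span E = V" using E by (auto simp: orthonormal_basis_iff)
  interpret E: frame E "\<lambda>e. e" "\<lambda>e. e" by (rule orthonormal_frame[OF onE])
  let ?P = "orth_proj V"
  have PV: "proj_subspace V" using orthonormal_proj_subspace[OF onE] spE by simp
  have PP [simp]: "?P (?P z) = ?P z" for z using orth_proj_id[OF PV orth_proj_mem[OF PV]] .
  have P_meas [measurable]: "?P \<in> borel_measurable borel"
    by (intro borel_measurable_continuous_onI continuous_orth_proj PV)
  have fP [measurable]: "(\<lambda>z. f (?P z)) \<in> borel_measurable borel"
    using orth_proj_mem[OF PV] by (intro measurable_compose[OF measurable_restrict_space2 f]) auto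
  have P_proj: "?P (proj_B I E x) = proj_B I E x" for x
    unfolding proj_B_def using spE
    by (intro orth_proj_id[OF PV]) (auto intro: span_sum span_scale span_base)
  obtain G b where G: "finite G" "L = {y. \<forall>g\<in>G. inner g y = b g}"
    by (rule finite_codim_constraints[OF L])
  have exZ: "exhausting Z" by unfold_locales
  obtain c m where cm: "\<forall>\<^sub>F N in sequentially. sphere_law L (Z N) V E (c N) (m N) \<and>
    dim (Z N) \<le> m N + (card G + card E + 2)"
    using sigma_bar_density_eventually[OF infinite_dim exZ G(1,2) L(3) onE spE onto] by blast
  define k where "k = card G + card E + 2"
  obtain N0 where N0: "\<And>N. N \<ge> N0 \<Longrightarrow> sphere_law L (Z N) V E (c N) (m N) \<and> dim (Z N) \<le> m N + k"
    using cm unfolding eventually_sequentially k_def by blast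
  note N0 = N0[unfolded sphere_law_def]
  obtain c0 where c0: "c0 > 0" and mm [measurable]: "(\<lambda>v. minsq L V (?P v)) \<in> borel_measurable borel"
    and pB [measurable]: "proj_B I E \<in> borel_measurable \<mu>"
    and I0': "\<forall>F\<in>borel_measurable borel. (\<integral>\<^sup>+x. F (proj_B I E x) \<partial>\<mu>)
      = ennreal c0 * (\<integral>\<^sup>+v. F v * ennreal (exp (- minsq L V v / 2)) \<partial>leb_on E)"
    by (rule proj_B_density[OF L(1-3) mu I onE spE onto])
  define w0 where "w0 = (\<lambda>v. ennreal (exp (- minsq L V (?P v) / 2)))"
  \<comment> \<open>Zero for small \<open>N\<close>, so that measurability and domination hold for
    every index and not just eventually.\<close>
  define w where "w = (\<lambda>N v. if N \<ge> N0 then sphere_weight (dim (Z N)) (m N) (minsq (L \<inter> Z N) V (?P v)) else 0)"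
  have w0_meas [measurable]: "w0 \<in> borel_measurable borel" unfolding w0_def by measurable
  have w_meas [measurable]: "w N \<in> borel_measurable borel" for N
  proof (cases "N \<ge> N0")
    case True
    then have [measurable]: "(\<lambda>v. minsq (L \<inter> Z N) V (?P v)) \<in> borel_measurable borel" using N0 by blast
    show ?thesis using True unfolding w_def sphere_weight_def by simp
  qed (simp add: w_def)
  have PE: "?P v = v" if "v \<in> E.S" for v using that spE orth_proj_id[OF PV] by simp
  have I0: "(\<integral>\<^sup>+x. F (proj_B I E x) \<partial>\<mu>) = ennreal c0 * (\<integral>\<^sup>+v. F v * w0 v \<partial>leb_on E)"
    if "F \<in> borel_measurable borel" for F :: "'h \<Rightarrow> ennreal"
  proof -
    have "(\<integral>\<^sup>+v. F v * ennreal (exp (- minsq L V v / 2)) \<partial>leb_on E) = (\<integral>\<^sup>+v. F v * w0 v \<partial>leb_on E)"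
      using E.AE_in_S by (intro nn_integral_cong_AE) (auto simp: w0_def PE elim!: eventually_mono)
    then show ?thesis using I0' that by simp
  qed
  have IN: "(\<integral>\<^sup>+z. F (?P z) \<partial>sigma_bar L (Z N)) = ennreal (c N) * (\<integral>\<^sup>+v. F v * w N v \<partial>leb_on E)"
    if "N \<ge> N0" "F \<in> borel_measurable borel" for N and F :: "'h \<Rightarrow> ennreal"
    using N0[OF that(1)] that by (simp add: w_def)
  have dom: "AE v in leb_on E. w N v \<le> ennreal (exp (real k / 2)) * w0 v" for N
  proof (cases "N \<ge> N0")
    case True
    show ?thesis
    proof (intro AE_I2)
      fix v
      let ?q = "minsq (L \<inter> Z N) V (?P v)"
      have "sqrt (max 0 (1 - ?q / dim (Z N))) ^ m N \<le> exp (real k / 2) * exp (- ?q / 2)"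
        using N0[OF True] by (intro sqrt_power_le_exp) (auto simp: minsq_def)
      also have "\<dots> \<le> exp (real k / 2) * exp (- minsq L V (?P v) / 2)"
        using minsq_le_Int[OF G onE spE onto orth_proj_mem[OF PV], of v N]
          N0[OF True] orth_proj_mem[OF PV, of v] by simp
      finally show "w N v \<le> ennreal (exp (real k / 2)) * w0 v"
        using True by (simp add: w_def w0_def sphere_weight_def ennreal_mult[symmetric] ennreal_leI)
    qed
  qed (simp add: w_def)
  have lim: "AE v in leb_on E. (\<lambda>N. w N v) \<longlonglongrightarrow> w0 v"
  proof (intro AE_I2)
    fix v
    have "(\<lambda>N. sqrt (max 0 (1 - minsq (L \<inter> Z N) V (?P v) / real (dim (Z N)))) ^ m N) \<longlonglongrightarrow> exp (- minsq L V (?P v) / 2)"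
    proof (rule tendsto_sqrt_power_exp)
      show "(\<lambda>N. minsq (L \<inter> Z N) V (?P v)) \<longlonglongrightarrow> minsq L V (?P v)"
        by (rule tendsto_minsq[OF G onE spE onto orth_proj_mem[OF PV]])
      show "filterlim (\<lambda>N. dim (Z N)) at_top sequentially" by (rule filterlim_dim_Z[OF infinite_dim])
      show "\<forall>\<^sub>F N in sequentially. m N \<le> dim (Z N) \<and> dim (Z N) \<le> m N + k"
        unfolding eventually_sequentially using N0 by blast
    qed
    then have "(\<lambda>N. sphere_weight (dim (Z N)) (m N) (minsq (L \<inter> Z N) V (?P v))) \<longlonglongrightarrow> w0 v"
      unfolding w0_def sphere_weight_def by (rule tendsto_ennrealI)
    moreover have "\<forall>\<^sub>F N in sequentially. sphere_weight (dim (Z N)) (m N) (minsq (L \<inter> Z N) V (?P v)) = w N v"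
      unfolding eventually_sequentially by (intro exI[of _ N0]) (simp add: w_def)
    ultimately show "(\<lambda>N. w N v) \<longlonglongrightarrow> w0 v" by (rule Lim_transform_eventually)
  qed
  have conv: "(\<lambda>N. \<integral>\<^sup>+v. g v * w N v \<partial>leb_on E) \<longlonglongrightarrow> (\<integral>\<^sup>+v. g v * w0 v \<partial>leb_on E)"
    if "g \<in> borel_measurable borel" "\<And>x. g x < \<infinity>" for g
    by (rule nn_integral_density_tendsto[OF _ _ _ that(2) _ dom lim]) (use that(1) in simp_all)
  have c_lim: "(\<lambda>N. ennreal (c N)) \<longlonglongrightarrow> ennreal c0"
  proof -
    \<comment> \<open>Testing with the constant function 1 shows that each constant is the
      reciprocal of the integral of its weight; the integrals converge by \<open>conv\<close>, and
      inversion is continuous on \<open>ennreal\<close>.\<close>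
    have one: "ennreal c0 * (\<integral>\<^sup>+v. w0 v \<partial>leb_on E) = 1"
      using I0[of "\<lambda>_. 1"] by (simp add: emeasure_space_1)
    have oneN: "ennreal (c N) * (\<integral>\<^sup>+v. w N v \<partial>leb_on E) = 1" if N: "N \<ge> N0" for N
    proof -
      interpret N: prob_space "sigma_bar L (Z N)" using N0[OF N] by blast
      show ?thesis using IN[OF N, of "\<lambda>_. 1"] by (simp add: N.emeasure_space_1)
    qed
    have inv: "x = inverse y" if "x * y = 1" for x y :: ennreal
    proof -
      have "y \<noteq> 0" "y \<noteq> top" using that by (auto simp: ennreal_mult_top split: if_splits)
      then have "x = x * (y / y)" by (simp add: ennreal_divide_self less_top)
      also have "\<dots> = inverse y" using that by (simp add: mult.assoc[symmetric] divide_ennreal_def)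
      finally show ?thesis .
    qed
    have "(\<lambda>N. inverse (\<integral>\<^sup>+v. w N v \<partial>leb_on E)) \<longlonglongrightarrow> inverse (\<integral>\<^sup>+v. w0 v \<partial>leb_on E)"
    proof (rule continuous_on_tendsto_compose[of UNIV inverse])
      show "continuous_on UNIV (inverse :: ennreal \<Rightarrow> ennreal)"
        by (intro continuous_on_inverse_ennreal continuous_on_id)
    qed (use conv[of "\<lambda>_. 1"] in simp_all)
    moreover have "\<forall>\<^sub>F N in sequentially. inverse (\<integral>\<^sup>+v. w N v \<partial>leb_on E) = ennreal (c N)"
      unfolding eventually_sequentially using inv[OF oneN] by metis
    ultimately have "(\<lambda>N. ennreal (c N)) \<longlonglongrightarrow> inverse (\<integral>\<^sup>+v. w0 v \<partial>leb_on E)"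
      by (rule Lim_transform_eventually)
    then show ?thesis using inv[OF one] by simp
  qed
  \<comment> \<open>The function \<open>h\<close> will be the absolute value, for integrability, and
    then the identity and negation: since \<open>ennreal\<close> sends negative numbers to 0, these
    give the positive and negative parts of \<open>f\<close>.\<close>
  have nn_conv: "(\<lambda>N. \<integral>\<^sup>+z. ennreal (h (f (?P z))) \<partial>sigma_bar L (Z N)) \<longlonglongrightarrow> (\<integral>\<^sup>+x. ennreal (h (f (proj_B I E x))) \<partial>\<mu>)"
    if [measurable]: "h \<in> borel_measurable borel" for h :: "real \<Rightarrow> real"
  proof -
    let ?F = "\<lambda>v. ennreal (h (f (?P v)))"
    have F [measurable]: "?F \<in> borel_measurable borel" by measurable
    have "(\<lambda>N. ennreal (c N) * (\<integral>\<^sup>+v. ?F v * w N v \<partial>leb_on E)) \<longlonglongrightarrow> ennreal c0 * (\<integral>\<^sup>+v. ?F v * w0 v \<partial>leb_on E)"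
      using c0 by (intro tendsto_mult_ennreal c_lim conv) auto
    moreover have "\<forall>\<^sub>F N in sequentially. ennreal (c N) * (\<integral>\<^sup>+v. ?F v * w N v \<partial>leb_on E) = (\<integral>\<^sup>+z. ennreal (h (f (?P z))) \<partial>sigma_bar L (Z N))"
      unfolding eventually_sequentially using IN[OF _ F] by (intro exI[of _ N0]) simp
    ultimately have "(\<lambda>N. \<integral>\<^sup>+z. ennreal (h (f (?P z))) \<partial>sigma_bar L (Z N)) \<longlonglongrightarrow> ennreal c0 * (\<integral>\<^sup>+v. ?F v * w0 v \<partial>leb_on E)"
      by (rule Lim_transform_eventually)
    then show ?thesis using I0[OF F] by (simp add: P_proj)
  qed
  have s: "sets (sigma_bar L (Z N)) = sets borel" for N
    by (simp add: sigma_bar_def sphere_area_def)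
  have fm: "(\<lambda>z. f (?P z)) \<in> borel_measurable (sigma_bar L (Z N))" for N
    using fP unfolding measurable_cong_sets[OF s refl] .
  have "(\<forall>\<^sub>F N in sequentially. integrable (sigma_bar L (Z N)) (\<lambda>z. f (?P z))) \<and>
           (\<lambda>N. LINT z|sigma_bar L (Z N). f (?P z)) \<longlonglongrightarrow> (LINT x|\<mu>. f (proj_B I E x))"
    if int: "integrable \<mu> (\<lambda>x. f (proj_B I E x))"
  proof
    have abs: "(\<integral>\<^sup>+x. ennreal \<bar>f (proj_B I E x)\<bar> \<partial>\<mu>) < \<infinity>" using int by (simp add: integrable_iff_bounded)
    have "\<forall>\<^sub>F N in sequentially. (\<integral>\<^sup>+z. ennreal \<bar>f (?P z)\<bar> \<partial>sigma_bar L (Z N)) < \<infinity>"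
      by (rule order_tendstoD(2)[OF nn_conv abs]) measurable
    then show ev: "\<forall>\<^sub>F N in sequentially. integrable (sigma_bar L (Z N)) (\<lambda>z. f (?P z))"
      by (rule eventually_mono) (simp add: integrable_iff_bounded fm)
    have fin: "(\<integral>\<^sup>+x. ennreal (f (proj_B I E x)) \<partial>\<mu>) \<noteq> \<infinity>" "(\<integral>\<^sup>+x. ennreal (- f (proj_B I E x)) \<partial>\<mu>) \<noteq> \<infinity>"
      using int by (auto simp: real_integrable_def)
    have "(\<lambda>N. enn2real (\<integral>\<^sup>+z. ennreal (f (?P z)) \<partial>sigma_bar L (Z N)) - enn2real (\<integral>\<^sup>+z. ennreal (- f (?P z)) \<partial>sigma_bar L (Z N)))
      \<longlonglongrightarrow> enn2real (\<integral>\<^sup>+x. ennreal (f (proj_B I E x)) \<partial>\<mu>) - enn2real (\<integral>\<^sup>+x. ennreal (- f (proj_B I E x)) \<partial>\<mu>)"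
      using fin nn_conv[of "\<lambda>x. x"] nn_conv[of uminus]
      by (intro tendsto_diff tendsto_enn2real) (auto simp: less_top)
    moreover have "\<forall>\<^sub>F N in sequentially. enn2real (\<integral>\<^sup>+z. ennreal (f (?P z)) \<partial>sigma_bar L (Z N)) - enn2real (\<integral>\<^sup>+z. ennreal (- f (?P z)) \<partial>sigma_bar L (Z N))
      = (LINT z|sigma_bar L (Z N). f (?P z))"
      using ev by (rule eventually_mono) (simp add: real_lebesgue_integral_def)
    ultimately show "(\<lambda>N. LINT z|sigma_bar L (Z N). f (?P z)) \<longlonglongrightarrow> (LINT x|\<mu>. f (proj_B I E x))"
      unfolding real_lebesgue_integral_def[OF int] by (rule Lim_transform_eventually)
  qed
  then show ?thesis using nn_conv[of "\<lambda>x. x"] by simp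
qed

end
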